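(* For formal variables $T$, $q$ and $u$, $$\sum_{\lambda\in\mathcal{DD}'} (-u^{-2})^{d_\lambda}T^{|\lambda|/2}\prod_{s\in\lambda}\frac{1-u^{-2\varepsilon'_s}q^{2h_s}}{1-q^{2h_s}}=\prod_{m,r\ge 1}\frac{ \left(1-q^{2(r+2)}u^{2}T^m\right)^{\lceil r/2 \rceil}\left(1-q^{2(r-1)}u^{-2}T^m\right)^{\lceil r/2 \rceil}}{\left(1-q^{2(r+1)}T^m\right)^{\lceil r/2 \rceil}\left(1-q^{2(r+2)}T^m\right)^{\lceil r/2 \rceil}}.$$
   Context: The identity is one of formal power series in $T$. For a partition $\lambda$, $h_s$ is the hook length of a box $s$, $d_\lambda=\max\{s:\lambda_s\ge s\}$ is the Durfee square size ($0$ for the empty partition), and $\varepsilon'_s=1$ if $s$ is strictly above the main diagonal of the Ferrers diagram (English convention), $\varepsilon'_s=-1$ otherwise. $\mathcal{DD}$ is the set of partitions with $\lambda_i=\lambda'_i+1$ for $1\le i\le d_\lambda$ ($\lambda'$ the conjugate; the empty partition included), and $\mathcal{DD}'=\{\lambda'\mid\lambda\in\mathcal{DD}\}$. This is the $q$-Nekrasov–Okounkov formula attached to the affine type $D^{(1)}_t$.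
   Formalization: The printed denominator is false already at the coefficient of T (at u=1 the left side has no q, the right side does); the denominator factors are corrected to (1-q^{2r}T^m) and (1-q^{2(r+1)}T^m), each to the power ⌈r/2⌉, in place of exponents 2(r+1) and 2(r+2). *)

theory Defs
  imports
    "HOL-Analysis.Infinite_Sum"
    "HOL-Computational_Algebra.Formal_Laurent_Series"
begin

section \<open>Integer partitions\<close>

text \<open>Partitions are weakly decreasing lists of positive parts. Parts, rows and columns are numbered
  from 1, and boxes are pairs (row, column) in the English convention.\<close>

definition partitions :: "nat list set" where
  "partitions = {l. sorted_wrt (\<ge>) l \<and> 0 \<notin> set l}"

text \<open>Parts beyond the length are 0; so is the part with the meaningless index 0.\<close>

definition part :: "nat list \<Rightarrow> nat \<Rightarrow> nat" where
  "part l i = (if 1 \<le> i \<and> i \<le> length l then l ! (i - 1) else 0)"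

definition diagram :: "nat list \<Rightarrow> (nat \<times> nat) set" where
  "diagram l = {(i, j). 1 \<le> i \<and> i \<le> length l \<and> 1 \<le> j \<and> j \<le> part l i}"

definition conjugate :: "nat list \<Rightarrow> nat list" where
  "conjugate l = map (\<lambda>j. card {i. (i, j) \<in> diagram l}) [1..<Suc (part l 1)]"

text \<open>Arm, plus leg, plus one; for boxes of the diagram the subtractions do not truncate.\<close>

definition hook :: "nat list \<Rightarrow> nat \<times> nat \<Rightarrow> nat" where
  "hook l = (\<lambda>(i, j). (part l i - j) + (part (conjugate l) j - i) + 1)"

definition durfee :: "nat list \<Rightarrow> nat" where
  "durfee l = Max (insert 0 {s. 1 \<le> s \<and> s \<le> length l \<and> part l s \<ge> s})"

definition eps' :: "nat \<times> nat \<Rightarrow> int" where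
  "eps' = (\<lambda>(i, j). if i < j then 1 else - 1)"

text \<open>All members of \<open>DD\<close>, hence of \<open>DD'\<close>, have even size, so halving the size is exact.\<close>

definition DD :: "nat list set" where
  "DD = {l \<in> partitions. \<forall>i. 1 \<le> i \<and> i \<le> durfee l \<longrightarrow> part l i = part (conjugate l) i + 1}"

definition DD' :: "nat list set" where
  "DD' = conjugate ` DD"

section \<open>The formal variables\<close>

text \<open>The ambient ring consists of the power series in \<open>T\<close> whose coefficients are power series in
  \<open>q\<close>, with coefficients in the field of formal Laurent series in \<open>u\<close>. Although this ring is not a
  field, \<open>inverse\<close> and \<open>/\<close> yield true inverses and quotients for \<open>u\<close> and for all series
  whose constant coefficient is 1, by the two lemmas below.\<close>

definition fps_T :: "'a::field_char_0 fls fps fps" where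
  "fps_T = fps_X"

definition fps_q :: "'a::field_char_0 fls fps fps" where
  "fps_q = fps_const fps_X"

definition fps_u :: "'a::field_char_0 fls fps fps" where
  "fps_u = fps_const (fps_const fls_X)"

lemma fps_u_mult_inverse: "fps_u * inverse fps_u = (1 :: 'a::field_char_0 fls fps fps)"
proof -
  have "fps_const fls_X * inverse (fps_const fls_X) = (1 :: 'a fls fps)"
    by (simp add: mult.commute[of "fps_const fls_X"] inverse_mult_eq_1)
  hence "fps_u * Abs_fps (natfun_inverse fps_u) = (1 :: 'a fls fps fps)"
    by (intro fps_right_inverse) (simp add: fps_u_def)
  thus ?thesis by (simp add: fps_inverse_def)
qed

lemma fps_mult_divide_cancel:
  fixes f g :: "'a::field_char_0 fls fps fps"
  assumes "fps_nth (fps_nth g 0) 0 = 1"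
  shows "g * (f / g) = f"
proof -
  have g0: "fps_nth g 0 \<noteq> 0" using assms by auto
  hence [simp]: "subdegree g = 0" by simp
  have "fps_nth g 0 * inverse (fps_nth g 0) = 1"
    using assms by (simp add: mult.commute[of "fps_nth g 0"] inverse_mult_eq_1)
  hence "g * Abs_fps (natfun_inverse g) = 1"
    by (intro fps_right_inverse) simp
  hence "g * inverse g = 1" by (simp add: fps_inverse_def)
  thus ?thesis by (simp add: fps_divide_def fps_unit_factor_def mult.left_commute[of g])
qed

section \<open>Infinite products\<close>

text \<open>The metric of \<^typ>\<open>'c fps fps\<close> treats the coefficients as discrete, and the product over
  all \<open>m\<close> and \<open>r\<close> does not converge in it, since for fixed \<open>m\<close> infinitely many factors involve
  \<open>T ^ m\<close>. Hence products are taken unconditionally (along the finite sets of indices) in the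
  coefficientwise topology: the coefficient of each power of \<open>T\<close> has to converge in the metric of
  \<^typ>\<open>'c fps\<close>, which here is the \<open>q\<close>-adic one.\<close>

definition has_formal_prod ::
    "('i \<Rightarrow> 'c::comm_ring_1 fps fps) \<Rightarrow> 'c fps fps \<Rightarrow> 'i set \<Rightarrow> bool"
    (infixr "has'_formal'_prod" 46) where
  "(f has_formal_prod P) I \<longleftrightarrow>
    (\<forall>n. ((\<lambda>F. fps_nth (\<Prod>i\<in>F. f i) n) \<longlongrightarrow> fps_nth P n) (finite_subsets_at_top I))"

end

theory Submission
  imports Defs "Jordan_Normal_Form.Char_Poly"
begin

text \<open>
  Put \<open>x = q\<^sup>2\<close> and \<open>U = u\<^sup>2\<close>. A partition in \<open>DD'\<close> is determined by the finite set \<open>S\<close> of leg lengths of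
  its diagonal boxes, which may be any finite set of positive integers. Multiplied by \<open>U\<^sup>N\<close>, the coefficients
  of \<open>T\<^sup>N\<close> on both sides are polynomials in \<open>U\<close> over the power series in \<open>x\<close>; they are compared at
  \<open>U = x\<^sup>-\<^sup>s\<close> with \<open>s = 2 (n + 1)\<close>.

  There the weight of \<open>S\<close> vanishes unless \<open>S\<close> has no hook of length \<open>s\<close>. The remaining sets are indexed by
  \<open>v \<in> \<int>\<^sup>n\<close> with \<open>v\<^sub>j \<equiv> j\<close> modulo \<open>s\<close>, and their weights telescope to the Weyl denominator of type \<open>C\<^sub>n\<close>
  at \<open>v\<close>, divided by its value at \<open>(1, \<dots>, n)\<close>. Hence the sum is the determinant of the theta series
  \<open>\<Theta>\<^sub>i(q\<^sup>2\<^sup>j\<^sup>+\<^sup>1)\<close>. The products \<open>e f\<^sup>n\<^sup>-\<^sup>1\<^sup>-\<^sup>a g\<^sup>a\<close> of an odd theta series \<open>e\<close> and two even ones \<open>f\<close>, \<open>g\<close> are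
  combinations of the \<open>\<Theta>\<^sub>i\<close> whose coefficients do not involve \<open>q\<close>, and their determinant is of Vandermonde
  type, so by the addition formula it is a product of theta functions. By the Jacobi triple product the two
  sides therefore agree up to a power series in \<open>T\<close> that does not involve \<open>q\<close>.

  By induction on \<open>N\<close>, the difference of the \<open>N\<close>-th coefficients then is a polynomial in \<open>U\<close> whose value at
  \<open>x\<^sup>-\<^sup>s\<close> times \<open>x\<^sup>s\<^sup>N\<close> is free of \<open>x\<close> for infinitely many \<open>s\<close>. Looking at the orders in \<open>x\<close>, this forces it
  to be a constant multiple of \<open>U\<^sup>N\<close>. At \<open>U = x\<^sup>-\<^sup>1\<close> both sides are trivial, so the constant is 0.
\<close>

section \<open>Vandermonde-type determinants\<close>

text \<open>The period \<open>2 * (n + 1)\<close> is a degree: in the variable \<open>z\<close>,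
  \<open>theta_even\<close> and \<open>theta_odd\<close> have degree 2 and the odd series,
  \<open>theta (z\<^sup>2)\<close> divided by \<open>z\<close>, has degree 4, so each of the n
  products has degree \<open>2 * (n + 1)\<close>. Odd theta functions of this degree have n
  independent coefficients, one for each \<open>Theta n i\<close>. The determinant
  \<open>Mdet\<close> of the resulting square matrix is never evaluated: only its independence of q
  and its nonzero constant coefficient are used. This avoids the constant term that is the hard part
  of a direct proof of such a determinant formula. Both sides are compared through logarithmic
  derivatives, because the recursion that these yield for the coefficients is polynomial in the
  data. The same expressions can therefore be read in three rings: polynomials in U over series in
  q, where the identity is proved; Laurent series in q, where U becomes a negative power of q; and
  series in q over Laurent series in u, where U becomes the square of u.\<close>

lemma det_newton:
  fixes x :: "nat \<Rightarrow> 'r :: comm_ring_1" and c :: "nat \<Rightarrow> 'r"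
  assumes A: "\<And>i j. i < n \<Longrightarrow> j < n \<Longrightarrow> A i j = c i * (\<Sum>k<n. (\<Prod>l<k. x i - x l) * u k j)"
    and u0: "\<And>k j. j < k \<Longrightarrow> u k j = 0" and u1: "\<And>j. u j j = 1"
  shows "det (mat n n (\<lambda>(i, j). A i j)) = (\<Prod>i<n. c i) * (\<Prod>j<n. \<Prod>l<j. x j - x l)"
proof -
  \<comment> \<open>Both factors are triangular: \<open>\<Prod>l<k. x i - x l\<close> vanishes for
    \<open>i < k\<close>, and \<open>R\<close> holds the coordinates of the columns in the Newton
    basis with nodes \<open>x 0, x 1, ...\<close>.\<close>
  define L where "L = mat n n (\<lambda>(i, k). c i * (\<Prod>l<k. x i - x l))"
  define R where "R = mat n n (\<lambda>(k, j). u k j)"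
  have "mat n n (\<lambda>(i, j). A i j) = L * R"
    by (rule eq_matI) (auto simp: L_def R_def A scalar_prod_def sum_distrib_left mult.assoc
        lessThan_atLeast0 intro!: sum.cong)
  moreover have "det (L * R) = det L * det R"
    by (rule det_mult[of _ n]) (auto simp: L_def R_def)
  moreover have "det R = 1"
  proof -
    have "det R = prod_list (diag_mat R)"
      by (rule det_upper_triangular[of _ n]) (auto simp: R_def u0 upper_triangular_def)
    also have "diag_mat R = map (\<lambda>i. 1) [0..<n]"
      by (auto simp: diag_mat_def R_def u1)
    finally show ?thesis by (simp add: map_replicate_const)
  qed
  moreover have "det L = (\<Prod>i<n. c i) * (\<Prod>j<n. \<Prod>l<j. x j - x l)"
  proof -
    have "det L = prod_list (diag_mat L)"
    proof (rule det_lower_triangular[of n])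
      fix i j assume "i < j" "j < n"
      moreover from this have "(\<Prod>l<j. x i - x l) = 0" by (intro prod_zero) auto
      ultimately show "L $$ (i, j) = 0" by (simp add: L_def)
    qed (auto simp: L_def)
    also have "diag_mat L = map (\<lambda>i. c i * (\<Prod>l<i. x i - x l)) [0..<n]"
      by (auto simp: diag_mat_def L_def)
    also have "prod_list \<dots> = (\<Prod>i<n. c i * (\<Prod>l<i. x i - x l))"
      by (simp add: prod.distinct_set_conv_list [symmetric] atLeast0LessThan)
    finally show ?thesis by (simp add: prod.distrib)
  qed
  ultimately show ?thesis by simp
qed

text \<open>Divided differences: \<open>newton_pow x j i\<close> is the coefficient of the
  \<open>j\<close>-th Newton basis polynomial in \<open>y ^ i\<close>, a complete homogeneous
  symmetric polynomial in \<open>x 0, ..., x j\<close>. The recursion is multiplication by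
  \<open>y\<close>, which sends the \<open>k\<close>-th basis polynomial to the next one plus
  \<open>x k\<close> times itself.\<close>

fun newton_pow :: "(nat \<Rightarrow> 'r :: comm_ring_1) \<Rightarrow> nat \<Rightarrow> nat \<Rightarrow> 'r" where
  "newton_pow x j 0 = (if j = 0 then 1 else 0)"
| "newton_pow x j (Suc i) = (if j = 0 then 0 else newton_pow x (j - 1) i) + x j * newton_pow x j i"

lemma newton_pow_gt: "i < k \<Longrightarrow> newton_pow x k i = 0"
  by (induction x k i rule: newton_pow.induct) auto

lemma newton_pow_eq: "newton_pow x j j = 1"
  by (induction j) (auto simp: newton_pow_gt)

lemma sum_newton_shift:
  fixes x :: "nat \<Rightarrow> 'r :: comm_ring_1"
  shows "(\<Sum>k<n. (\<Prod>l<k. y - x l) * (if k = 0 then 0 else a (k - 1)))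
     = (\<Sum>k<n - 1. (y - x k) * (\<Prod>l<k. y - x l) * a k)"
proof (cases n)
  case (Suc m)
  then show ?thesis
    by (simp add: sum.lessThan_Suc_shift mult_ac del: sum.lessThan_Suc)
qed auto

text \<open>Multiplication by \<open>y\<close> in Newton coordinates; \<open>a (n - 1) = 0\<close>
  keeps the result within the first \<open>n\<close> basis polynomials.\<close>

lemma newton_step:
  fixes x :: "nat \<Rightarrow> 'r :: comm_ring_1"
  assumes "n > 0" "a (n - 1) = 0"
  shows "(\<Sum>k<n. (\<Prod>l<k. y - x l) * ((if k = 0 then 0 else a (k - 1)) + x k * a k))
     = y * (\<Sum>k<n. (\<Prod>l<k. y - x l) * a k)"
proof -
  obtain m where m: "n = Suc m" using assms(1) by (cases n) auto
  have "(\<Sum>k<n. (\<Prod>l<k. y - x l) * ((if k = 0 then 0 else a (k - 1)) + x k * a k))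
     = (\<Sum>k<n. (\<Prod>l<k. y - x l) * (if k = 0 then 0 else a (k - 1))) + (\<Sum>k<n. (\<Prod>l<k. y - x l) * (x k * a k))"
    by (simp add: algebra_simps sum.distrib)
  also have "\<dots> = (\<Sum>k<m. (y - x k) * (\<Prod>l<k. y - x l) * a k) + (\<Sum>k<m. (\<Prod>l<k. y - x l) * (x k * a k))"
    unfolding sum_newton_shift using assms(2) by (simp add: m)
  also have "\<dots> = (\<Sum>k<m. y * ((\<Prod>l<k. y - x l) * a k))"
    by (simp add: sum.distrib [symmetric] algebra_simps)
  finally show ?thesis using assms(2) by (simp add: m sum_distrib_left)
qed

lemma newton_pow_sum:
  "i < n \<Longrightarrow> (\<Sum>k<n. (\<Prod>l<k. y - x l) * newton_pow x k i) = y ^ i"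
proof (induction i)
  case 0
  have "(\<Sum>k<n. (\<Prod>l<k. y - x l) * newton_pow x k 0) = (\<Sum>k<n. if k = 0 then 1 else 0)"
    by (intro sum.cong) auto
  with 0 show ?case by simp
next
  case (Suc i)
  have "newton_pow x (n - 1) i = 0" using Suc.prems by (intro newton_pow_gt) simp
  then show ?case using Suc newton_step[of n "\<lambda>k. newton_pow x k i" y x] by simp
qed

text \<open>\<open>f\<^sup>n\<^sup>-\<^sup>1\<^sup>-\<^sup>a g\<^sup>a\<close> is dehomogenised by \<open>g = f h\<close>.\<close>

lemma det_vandermonde_hom:
  fixes f h :: "nat \<Rightarrow> 'r :: comm_ring_1"
  shows "det (mat n n (\<lambda>(i, j). c i * f i ^ (n - 1 - j) * (f i * h i) ^ j)) =
    (\<Prod>i<n. c i) * (\<Prod>j<n. \<Prod>l<j. f l * (f j * h j) - f j * (f l * h l))"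
proof -
  \<comment> \<open>Each index lies in exactly \<open>n - 1\<close> of the pairs
    \<open>l < j\<close>.\<close>
  have "(\<Prod>i<n. f i ^ (n - 1)) = (\<Prod>j<n. \<Prod>l<j. f l * f j)"
  proof (induction n)
    case (Suc n)
    show ?case
    proof (cases n)
      case (Suc m)
      have "(\<Prod>i<n. f i ^ n) = (\<Prod>i<n. f i ^ (n - 1)) * (\<Prod>i<n. f i)"
        by (simp add: Suc prod.distrib mult_ac)
      have "(\<Prod>i<Suc n. f i ^ (Suc n - 1)) = (\<Prod>i<n. f i ^ n) * f n ^ n" by simp
      also have "\<dots> = (\<Prod>i<n. f i ^ (n - 1)) * ((\<Prod>i<n. f i) * f n ^ n)"
        by (simp only: \<open>(\<Prod>i<n. f i ^ n) = _\<close> mult.assoc)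
      also have "(\<Prod>i<n. f i) * f n ^ n = (\<Prod>l<n. f l * f n)"
        by (simp add: prod.distrib)
      also have "(\<Prod>i<n. f i ^ (n - 1)) * \<dots> = (\<Prod>j<Suc n. \<Prod>l<j. f l * f j)"
        using Suc.IH by simp
      finally show ?thesis .
    qed auto
  qed auto
  moreover have "(\<Prod>j<n. \<Prod>l<j. f l * (f j * h j) - f j * (f l * h l)) =
      (\<Prod>j<n. \<Prod>l<j. f l * f j) * (\<Prod>j<n. \<Prod>l<j. h j - h l)"
    by (simp add: prod.distrib [symmetric] algebra_simps)
  moreover have "det (mat n n (\<lambda>(i, j). c i * f i ^ (n - 1 - j) * (f i * h i) ^ j))
     = (\<Prod>i<n. c i * f i ^ (n - 1)) * (\<Prod>j<n. \<Prod>l<j. h j - h l)"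
  proof (rule det_newton[of n _ "\<lambda>i. c i * f i ^ (n - 1)" h "newton_pow h"])
    fix i j assume "i < n" "j < n"
    hence "f i ^ (n - 1) = f i ^ (n - 1 - j) * f i ^ j"
      by (simp add: power_add [symmetric])
    with \<open>j < n\<close> show "c i * f i ^ (n - 1 - j) * (f i * h i) ^ j =
        c i * f i ^ (n - 1) * (\<Sum>k<n. (\<Prod>l<k. h i - h l) * newton_pow h k j)"
      by (subst newton_pow_sum) (simp_all add: power_mult_distrib mult_ac)
  qed (auto simp: newton_pow_gt newton_pow_eq)
  ultimately show ?thesis by (simp add: prod.distrib mult_ac)
qed

text \<open>Newton coordinates of the quotient of \<open>Y^(2i+1) - Y^-(2i+1)\<close> by
  \<open>Y - Y^-1\<close>. As a polynomial in \<open>t = Y^2 + Y^-2\<close> it obeys the Chebyshev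
  recursion \<open>V (i + 2) = t * V (i + 1) - V i\<close> with \<open>V 0 = 1\<close> and
  \<open>V 1 = 1 + t\<close>.\<close>

fun odd_coeff :: "(nat \<Rightarrow> 'r :: comm_ring_1) \<Rightarrow> nat \<Rightarrow> nat \<Rightarrow> 'r" where
  "odd_coeff t k 0 = (if k = 0 then 1 else 0)"
| "odd_coeff t k (Suc 0) = (if k = 0 then 1 + t 0 else if k = 1 then 1 else 0)"
| "odd_coeff t k (Suc (Suc i)) = (if k = 0 then 0 else odd_coeff t (k - 1) (Suc i))
     + t k * odd_coeff t k (Suc i) - odd_coeff t k i"

lemma odd_coeff_gt: "i < k \<Longrightarrow> odd_coeff t k i = 0"
  by (induction t k i rule: odd_coeff.induct) auto

lemma odd_coeff_eq: "odd_coeff t j j = 1"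
  by (induction j rule: induct_nat_012) (auto simp: odd_coeff_gt)

lemma odd_coeff_sum:
  fixes Y :: "'k :: field"
  assumes Y: "Y \<noteq> 0" and i: "i < n"
  shows "(Y - inverse Y) * (\<Sum>k<n. (\<Prod>l<k. (Y\<^sup>2 + inverse Y ^ 2) - t l) * odd_coeff t k i)
     = Y ^ (2 * i + 1) - inverse Y ^ (2 * i + 1)"
  using i
proof (induction i rule: induct_nat_012)
  case 0
  have "(\<Sum>k<n. (\<Prod>l<k. (Y\<^sup>2 + inverse Y ^ 2) - t l) * odd_coeff t k 0) = (\<Sum>k<n. if k = 0 then 1 else 0)"
    by (intro sum.cong) auto
  with 0 show ?case by simp
next
  case 1
  then obtain m where m: "n = Suc (Suc m)" by (metis Suc_lessE less_imp_Suc_add add_Suc)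
  have "(\<Sum>k<n. (\<Prod>l<k. (Y\<^sup>2 + inverse Y ^ 2) - t l) * odd_coeff t k 1) = (1 + t 0) + ((Y\<^sup>2 + inverse Y ^ 2) - t 0)"
    unfolding m by (simp add: sum.lessThan_Suc_shift del: sum.lessThan_Suc)
  with Y show ?case by (simp add: field_simps power2_eq_square power3_eq_cube)
next
  case (ge2 i)
  let ?t = "Y\<^sup>2 + inverse Y ^ 2"
  let ?S = "\<lambda>i. (\<Sum>k<n. (\<Prod>l<k. ?t - t l) * odd_coeff t k i)"
  have "odd_coeff t (n - 1) (Suc i) = 0" using ge2.prems by (intro odd_coeff_gt) simp
  hence "?S (Suc (Suc i)) = ?t * ?S (Suc i) - ?S i"
    using newton_step[of n "\<lambda>k. odd_coeff t k (Suc i)" ?t t] ge2.prems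
    by (simp add: right_diff_distrib sum_subtractf del: sum.lessThan_Suc)
  moreover have "(Y - inverse Y) * (?t * A - B) = ?t * ((Y - inverse Y) * A) - (Y - inverse Y) * B" for A B
    by (simp add: algebra_simps)
  ultimately have "(Y - inverse Y) * ?S (Suc (Suc i)) = ?t * ((Y - inverse Y) * ?S (Suc i)) - (Y - inverse Y) * ?S i"
    by (simp only:)
  also have "\<dots> = ?t * (Y ^ (2 * Suc i + 1) - inverse Y ^ (2 * Suc i + 1)) - (Y ^ (2 * i + 1) - inverse Y ^ (2 * i + 1))"
    using ge2 by simp
  also have "\<dots> = Y ^ (2 * Suc (Suc i) + 1) - inverse Y ^ (2 * Suc (Suc i) + 1)"
  proof -
    have "Y * inverse Y = 1" using Y by simp
    moreover have "(Y\<^sup>2 + J\<^sup>2) * (Y ^ (2 * Suc i + 1) - J ^ (2 * Suc i + 1)) - (Y ^ (2 * i + 1) - J ^ (2 * i + 1))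
        = Y ^ (2 * Suc (Suc i) + 1) - J ^ (2 * Suc (Suc i) + 1)" if J: "Y * J = 1" for J
    proof -
      have 1: "Z ^ (2 * Suc i + 1) = Z * Z * Z ^ (2 * i + 1)"
           "Z ^ (2 * Suc (Suc i) + 1) = Z * Z * Z * Z * Z ^ (2 * i + 1)" for Z :: 'k
        by (simp_all add: mult_ac)
      have "(Y\<^sup>2 + J\<^sup>2) * (Y * Y * A - J * J * B) - (A - B) = Y * Y * Y * Y * A - J * J * J * J * B" for A B
      proof -
        have "(Y\<^sup>2 + J\<^sup>2) * (Y * Y * A - J * J * B) - (A - B) =
           Y * Y * Y * Y * A - J * J * J * J * B + ((Y * J) * (Y * J) - 1) * (A - B)"
          by (simp add: algebra_simps power2_eq_square)
        thus ?thesis by (simp add: J)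
      qed
      thus ?thesis unfolding 1 by blast
    qed
    ultimately show ?thesis by blast
  qed
  finally show ?case .
qed

text \<open>A Weyl denominator formula: up to the row factors \<open>Y i - inverse (Y i)\<close>,
  column \<open>j\<close> is a monic polynomial of degree \<open>j\<close> in
  \<open>Y^2 + Y^-2\<close>.\<close>

lemma det_odd_powers:
  fixes Y :: "nat \<Rightarrow> 'k :: field"
  assumes Y: "\<And>i. i < n \<Longrightarrow> Y i \<noteq> 0"
  shows "det (mat n n (\<lambda>(i, j). Y i ^ (2 * j + 1) - inverse (Y i) ^ (2 * j + 1))) =
    (\<Prod>i<n. Y i - inverse (Y i)) *
    (\<Prod>j<n. \<Prod>l<j. ((Y j)\<^sup>2 + inverse (Y j) ^ 2) - ((Y l)\<^sup>2 + inverse (Y l) ^ 2))"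
proof (rule det_newton[where u = "odd_coeff (\<lambda>l. (Y l)\<^sup>2 + inverse (Y l) ^ 2)"])
  fix i j assume "i < n" "j < n"
  thus "Y i ^ (2 * j + 1) - inverse (Y i) ^ (2 * j + 1) = (Y i - inverse (Y i)) *
        (\<Sum>k<n. (\<Prod>l<k. ((Y i)\<^sup>2 + inverse (Y i) ^ 2) - ((Y l)\<^sup>2 + inverse (Y l) ^ 2)) *
          odd_coeff (\<lambda>l. (Y l)\<^sup>2 + inverse (Y l) ^ 2) k j)"
    using odd_coeff_sum[OF Y, of i j n "\<lambda>l. (Y l)\<^sup>2 + inverse (Y l) ^ 2"] by simp
qed (auto simp: odd_coeff_gt odd_coeff_eq)

section \<open>Generating series\<close>

text \<open>The series \<open>\<Sum>p\<in>I. t p * T ^ E p\<close>. If infinitely many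
  \<open>p\<close> shared an exponent, \<open>sum\<close> would return 0, so rules such as
  \<open>gser_mult\<close> ask for \<open>finite_fibres\<close>.\<close>

definition gser :: "('i \<Rightarrow> nat) \<Rightarrow> ('i \<Rightarrow> 'r :: comm_ring_1) \<Rightarrow> 'i set \<Rightarrow> 'r fps" where
  "gser E t I = Abs_fps (\<lambda>N. \<Sum>p | p \<in> I \<and> E p = N. t p)"

definition finite_fibres :: "('i \<Rightarrow> nat) \<Rightarrow> 'i set \<Rightarrow> bool" where
  "finite_fibres E I \<longleftrightarrow> (\<forall>N. finite {p \<in> I. E p \<le> N})"

lemma gser_nth: "fps_nth (gser E t I) N = (\<Sum>p | p \<in> I \<and> E p = N. t p)"
  by (simp add: gser_def)

lemma finite_fibresD: "finite_fibres E I \<Longrightarrow> finite {p \<in> I. E p = N}"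
  unfolding finite_fibres_def by (rule finite_subset[of _ "{p \<in> I. E p \<le> N}"]) auto

lemma finite_fibres_times:
  assumes "finite_fibres E I" "finite_fibres E' J"
  shows "finite_fibres (\<lambda>(p, p'). E p + E' p') (I \<times> J)"
  unfolding finite_fibres_def
proof
  fix N
  have "{p \<in> I \<times> J. (case p of (p, p') \<Rightarrow> E p + E' p') \<le> N} \<subseteq> {p \<in> I. E p \<le> N} \<times> {p \<in> J. E' p \<le> N}"
    by auto
  thus "finite {p \<in> I \<times> J. (case p of (p, p') \<Rightarrow> E p + E' p') \<le> N}"
    by (rule finite_subset) (use assms in \<open>auto simp: finite_fibres_def\<close>)
qed

lemma gser_mult:
  assumes "finite_fibres E I" "finite_fibres E' J"
  shows "gser E t I * gser E' t' J = gser (\<lambda>(p, p'). E p + E' p') (\<lambda>(p, p'). t p * t' p') (I \<times> J)"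
proof (rule fps_ext)
  fix N
  let ?A = "\<lambda>M. {p \<in> I. E p = M}" and ?B = "\<lambda>M. {p \<in> J. E' p = M}"
  have "fps_nth (gser E t I * gser E' t' J) N = (\<Sum>M=0..N. (\<Sum>p\<in>?A M. t p) * (\<Sum>p\<in>?B (N - M). t' p))"
    by (simp add: fps_mult_nth gser_nth)
  also have "\<dots> = (\<Sum>M=0..N. \<Sum>pp\<in>?A M \<times> ?B (N - M). t (fst pp) * t' (snd pp))"
    by (simp add: sum_product sum.cartesian_product case_prod_unfold)
  also have "\<dots> = (\<Sum>(M, pp)\<in>(SIGMA M:{0..N}. ?A M \<times> ?B (N - M)). t (fst pp) * t' (snd pp))"
    by (rule sum.Sigma) (use assms in \<open>auto intro: finite_fibresD\<close>)
  also have "\<dots> = (\<Sum>(p, p') | (p, p') \<in> I \<times> J \<and> E p + E' p' = N. t p * t' p')"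
    by (rule sum.reindex_bij_witness[of _ "\<lambda>pp. (E (fst pp), pp)" snd]) auto
  also have "{pp. case pp of (p, p') \<Rightarrow> (p, p') \<in> I \<times> J \<and> E p + E' p' = N}
     = {pp. pp \<in> I \<times> J \<and> (case pp of (p, p') \<Rightarrow> E p + E' p') = N}"
    by auto
  finally show "fps_nth (gser E t I * gser E' t' J) N =
     fps_nth (gser (\<lambda>(p, p'). E p + E' p') (\<lambda>(p, p'). t p * t' p') (I \<times> J)) N"
    by (simp add: gser_nth)
qed

lemma gser_reindex:
  assumes "bij_betw \<phi> J I"
    and "\<And>p. p \<in> J \<Longrightarrow> E' p = E (\<phi> p)" "\<And>p. p \<in> J \<Longrightarrow> t' p = t (\<phi> p)"
  shows "gser E t I = gser E' t' J"
proof (rule fps_ext)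
  fix N
  have "bij_betw \<phi> {p \<in> J. E' p = N} {p \<in> I. E p = N}"
    using assms(1,2) unfolding bij_betw_def inj_on_def by auto
  from sum.reindex_bij_betw[OF this, of t]
  show "fps_nth (gser E t I) N = fps_nth (gser E' t' J) N"
    by (auto simp add: gser_nth assms(3) intro!: sum.cong)
qed

lemma finite_fibres_reindex:
  assumes "bij_betw \<phi> J I" "finite_fibres E I" "\<And>p. p \<in> J \<Longrightarrow> E' p = E (\<phi> p)"
  shows "finite_fibres E' J"
  unfolding finite_fibres_def
proof
  fix N
  have "bij_betw \<phi> {p \<in> J. E' p \<le> N} {p \<in> I. E p \<le> N}"
    using assms(1,3) unfolding bij_betw_def inj_on_def by auto
  with assms(2) show "finite {p \<in> J. E' p \<le> N}"
    using bij_betw_finite unfolding finite_fibres_def by blast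
qed

lemma gser_cong:
  assumes "\<And>p. p \<in> I \<Longrightarrow> E p = E' p" "\<And>p. p \<in> I \<Longrightarrow> t p = t' p"
  shows "gser E t I = gser E' t' I"
  by (rule gser_reindex[of id]) (use assms in auto)

lemma gser_mono_neutral:
  assumes "finite_fibres E I" "J \<subseteq> I" "\<And>p. p \<in> I - J \<Longrightarrow> t p = 0"
  shows "gser E t I = gser E t J"
proof (rule fps_ext)
  fix N
  show "fps_nth (gser E t I) N = fps_nth (gser E t J) N"
    unfolding gser_nth
    by (rule sum.mono_neutral_right) (use assms in \<open>auto intro: finite_fibresD\<close>)
qed

lemma gser_cmult: "fps_const c * gser E t I = gser E (\<lambda>p. c * t p) I"
  by (rule fps_ext) (simp add: gser_nth sum_distrib_left)

lemma gser_sum: "(\<Sum>a\<in>A. gser E (t a) I) = gser E (\<lambda>p. \<Sum>a\<in>A. t a p) I"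
  by (rule fps_ext) (simp add: fps_sum_nth gser_nth sum.swap[of _ _ A])

lemma gser_Un:
  assumes "finite_fibres E (I \<union> J)" "I \<inter> J = {}"
  shows "gser E t (I \<union> J) = gser E t I + gser E t J"
proof (rule fps_ext)
  fix N
  have "finite {p \<in> I. E p = N}" "finite {p \<in> J. E p = N}"
    using finite_fibresD[OF assms(1), of N] by (auto elim: finite_subset[rotated])
  moreover have "{p. p \<in> I \<union> J \<and> E p = N} = {p \<in> I. E p = N} \<union> {p \<in> J. E p = N}" by auto
  ultimately show "fps_nth (gser E t (I \<union> J)) N = fps_nth (gser E t I + gser E t J) N"
    using assms(2) by (simp add: gser_nth) (subst sum.union_disjoint, auto)
qed

text \<open>Both claims share one induction, since the step for the second applies
  \<open>gser_mult\<close>, which needs the first.\<close>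

lemma gser_prod:
  assumes "finite A" "\<And>i. i \<in> A \<Longrightarrow> finite_fibres (E i) (I i)"
  shows "finite_fibres (\<lambda>l. \<Sum>i\<in>A. E i (l i)) (PiE A I) \<and>
    (\<Prod>i\<in>A. gser (E i) (t i) (I i)) = gser (\<lambda>l. \<Sum>i\<in>A. E i (l i)) (\<lambda>l. \<Prod>i\<in>A. t i (l i)) (PiE A I)"
  using assms
proof (induction A rule: finite_induct)
  case empty
  have "1 = gser (\<lambda>l. 0) (\<lambda>l. 1) {\<lambda>x. undefined}"
    by (rule fps_ext) (auto simp: gser_nth)
  then show ?case by (auto simp: finite_fibres_def)
next
  case (insert a A)
  let ?J = "PiE A I"
  have IH: "finite_fibres (\<lambda>l. \<Sum>i\<in>A. E i (l i)) ?J"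
     "(\<Prod>i\<in>A. gser (E i) (t i) (I i)) = gser (\<lambda>l. \<Sum>i\<in>A. E i (l i)) (\<lambda>l. \<Prod>i\<in>A. t i (l i)) ?J"
    using insert by auto
  have bij: "bij_betw (\<lambda>l. (l a, l(a := undefined))) (PiE (insert a A) I) (I a \<times> ?J)"
    by (rule bij_betw_byWitness[where f' = "\<lambda>(y, l). l(a := y)"])
       (use insert.hyps in \<open>auto simp: PiE_def extensional_def Pi_def fun_upd_def\<close>)
  have s: "(\<Sum>i\<in>A. E i ((l(a := undefined)) i)) = (\<Sum>i\<in>A. E i (l i))"
    "(\<Prod>i\<in>A. t i ((l(a := undefined)) i)) = (\<Prod>i\<in>A. t i (l i))" for l
    using insert.hyps by (auto intro!: sum.cong prod.cong)
  have 1: "finite_fibres (E a) (I a)" using insert by auto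
  have "finite_fibres (\<lambda>(p, l). E a p + (\<Sum>i\<in>A. E i (l i))) (I a \<times> ?J)"
    using finite_fibres_times[OF 1 IH(1)] .
  from finite_fibres_reindex[OF bij this, of "\<lambda>l. \<Sum>i\<in>insert a A. E i (l i)"]
  have "finite_fibres (\<lambda>l. \<Sum>i\<in>insert a A. E i (l i)) (PiE (insert a A) I)"
    using insert.hyps by (simp add: s del: fun_upd_apply)
  moreover have "(\<Prod>i\<in>insert a A. gser (E i) (t i) (I i)) =
     gser (\<lambda>l. \<Sum>i\<in>insert a A. E i (l i)) (\<lambda>l. \<Prod>i\<in>insert a A. t i (l i)) (PiE (insert a A) I)"
  proof -
    have "(\<Prod>i\<in>insert a A. gser (E i) (t i) (I i)) =
       gser (\<lambda>(p, l). E a p + (\<Sum>i\<in>A. E i (l i))) (\<lambda>(p, l). t a p * (\<Prod>i\<in>A. t i (l i))) (I a \<times> ?J)"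
      using insert.hyps by (simp add: IH(2) gser_mult[OF 1 IH(1)])
    also have "\<dots> = gser (\<lambda>l. \<Sum>i\<in>insert a A. E i (l i)) (\<lambda>l. \<Prod>i\<in>insert a A. t i (l i)) (PiE (insert a A) I)"
      by (rule gser_reindex[OF bij]) (use insert.hyps in \<open>simp_all add: s del: fun_upd_apply\<close>)
    finally show ?thesis .
  qed
  ultimately show ?case by blast
qed

lemma finite_fibres_int:
  assumes "\<And>k :: int. \<bar>k\<bar> \<le> int (E k) + int c"
  shows "finite_fibres E I"
  unfolding finite_fibres_def
proof
  fix N
  have "{p \<in> I. E p \<le> N} \<subseteq> {- (int N + int c)..int N + int c}"
  proof
    fix p assume "p \<in> {p \<in> I. E p \<le> N}"
    with assms[of p] show "p \<in> {- (int N + int c)..int N + int c}" by (simp add: abs_le_iff)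
  qed
  thus "finite {p \<in> I. E p \<le> N}" by (rule finite_subset) simp
qed

section \<open>Weights and their telescoping at a specialised parameter\<close>

definition hk :: "nat set \<Rightarrow> nat \<Rightarrow> nat \<Rightarrow> nat" where
  "hk S m l = (if l \<in> S then m + l else m - l)"

text \<open>If \<open>S\<close> is the set of legs of the diagonal boxes of a partition in \<open>DD'\<close>, the hook lengths in the
  principal hook of \<open>m \<in> S\<close> are \<open>hk S m l\<close>: those on or below the diagonal for \<open>0 \<le> l \<le> m\<close>, those above
  it for \<open>1 \<le> l < m\<close>. The factor \<open>1 - x\<^sup>h / U\<close> of the latter is replaced by \<open>U - x\<^sup>h\<close>, so that \<open>wt\<close> is
  polynomial in \<open>U\<close> and equals \<open>U\<close> to the power \<open>\<Sum>S\<close> times the weight in the theorem. The argument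
  \<open>D\<close> stands for \<open>y \<mapsto> (1 - x\<^sup>y)\<^sup>-\<^sup>1\<close>.\<close>

definition wfac :: "'r :: comm_ring_1 \<Rightarrow> 'r \<Rightarrow> (nat \<Rightarrow> 'r) \<Rightarrow> nat set \<Rightarrow> nat \<Rightarrow> 'r" where
  "wfac x U D S m = - ((\<Prod>l=0..m. (1 - U * x ^ hk S m l) * D (hk S m l)) *
     (\<Prod>l=1..<m. (U - x ^ hk S m l) * D (hk S m l)))"

definition wt :: "'r :: comm_ring_1 \<Rightarrow> 'r \<Rightarrow> (nat \<Rightarrow> 'r) \<Rightarrow> nat set \<Rightarrow> 'r" where
  "wt x U D S = (\<Prod>m\<in>S. wfac x U D S m)"

lemma wt_empty [simp]: "wt x U D {} = 1"
  by (simp add: wt_def)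

lemma wfac_cong:
  assumes "\<And>l. l \<le> m \<Longrightarrow> l \<in> S \<longleftrightarrow> l \<in> S'"
  shows "wfac x U D S m = wfac x U D S' m"
proof -
  have "hk S m l = hk S' m l" if "l \<le> m" for l
    using assms[OF that] by (simp add: hk_def)
  thus ?thesis unfolding wfac_def by (intro arg_cong[where f = uminus] arg_cong2[where f = "(*)"] prod.cong) auto
qed

text \<open>A factor of \<open>wt\<close> sees only the elements up to its own index, so a new
  maximum leaves the other factors alone. The induction in \<open>core_weight\<close> removes maxima
  in this way.\<close>

lemma wt_insert_max:
  assumes "finite S" "\<And>k. k \<in> S \<Longrightarrow> k < m"
  shows "wt x U D (insert m S) = wfac x U D (insert m S) m * wt x U D S"
proof -
  have "m \<notin> S" using assms(2) by blast
  moreover have "wfac x U D (insert m S) k = wfac x U D S k" if "k \<in> S" for k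
    by (rule wfac_cong) (use assms(2)[OF that] in auto)
  ultimately show ?thesis using assms(1) by (simp add: wt_def)
qed

lemma hk_inj:
  assumes "0 \<notin> S" shows "inj_on (hk S m) {0..m}"
  by (rule inj_onI) (use assms in \<open>auto simp: hk_def split: if_splits\<close>)

text \<open>Multiplied out because factors may vanish. Replacing \<open>t i\<close> by
  \<open>c\<close> affects only the pairs containing \<open>i\<close>, and the signs from the order
  within a pair are the same on both sides.\<close>

lemma vdet_update:
  fixes t :: "nat \<Rightarrow> 'k :: comm_ring_1"
  assumes "i < n"
  shows "(\<Prod>j<n. \<Prod>l<j. t j - t l) * (\<Prod>j\<in>{..<n} - {i}. c - t j) =
    (\<Prod>j<n. \<Prod>l<j. (t(i := c)) j - (t(i := c)) l) * (\<Prod>j\<in>{..<n} - {i}. t i - t j)"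
  using assms
proof (induction n)
  case (Suc n)
  show ?case
  proof (cases "i = n")
    case True
    have "{..<Suc n} - {i} = {..<n}" using True by auto
    moreover have "(\<Prod>j<n. \<Prod>l<j. (t(i := c)) j - (t(i := c)) l) = (\<Prod>j<n. \<Prod>l<j. t j - t l)"
      using True by (intro prod.cong) auto
    moreover have "(\<Prod>l<n. (t(i := c)) n - (t(i := c)) l) = (\<Prod>l<n. c - t l)"
      using True by (intro prod.cong) auto
    ultimately show ?thesis using True by (simp add: mult_ac)
  next
    case False
    hence i: "i < n" using Suc.prems by simp
    have s: "{..<Suc n} - {i} = insert n ({..<n} - {i})" using i by auto
    have p: "(\<Prod>l<n. g l) = g i * (\<Prod>l\<in>{..<n} - {i}. g l)" for g :: "nat \<Rightarrow> 'k"
      using i by (subst prod.remove[of _ i]) auto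
    let ?R = "\<Prod>l\<in>{..<n} - {i}. t n - t l"
    have r: "(\<Prod>l\<in>{..<n} - {i}. (t(i := c)) n - (t(i := c)) l) = ?R"
      using i by (intro prod.cong) auto
    have "(\<Prod>j<Suc n. \<Prod>l<j. t j - t l) * (\<Prod>j\<in>{..<Suc n} - {i}. c - t j)
      = ((\<Prod>j<n. \<Prod>l<j. t j - t l) * (\<Prod>j\<in>{..<n} - {i}. c - t j)) * ((t n - t i) * (c - t n) * ?R)"
      by (simp add: s p mult_ac)
    also have "\<dots> = ((\<Prod>j<n. \<Prod>l<j. (t(i := c)) j - (t(i := c)) l) * (\<Prod>j\<in>{..<n} - {i}. t i - t j)) *
        ((t n - c) * (t i - t n) * ?R)"
      by (subst Suc.IH[OF i]) (simp add: algebra_simps)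
    also have "\<dots> = (\<Prod>j<Suc n. \<Prod>l<j. (t(i := c)) j - (t(i := c)) l) * (\<Prod>j\<in>{..<Suc n} - {i}. t i - t j)"
      unfolding s prod.lessThan_Suc p[of "\<lambda>l. (t(i := c)) n - (t(i := c)) l"] r
      using i by (simp add: mult_ac)
    finally show ?thesis .
  qed
qed auto

locale generic_q =
  fixes q :: "'k :: field"
  assumes q0: "q \<noteq> 0" and q_generic: "\<And>y :: int. y \<noteq> 0 \<Longrightarrow> q powi y \<noteq> 1"
begin

definition br :: "int \<Rightarrow> 'k" where "br y = 1 - q powi (2 * y)"

lemma br_nz [simp]: "y \<noteq> 0 \<Longrightarrow> br y \<noteq> 0"
  using q_generic[of "2 * y"] by (simp add: br_def)

lemma br_neg: "br (- y) = - (q powi (- 2 * y)) * br y"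
  using q0 by (simp add: br_def algebra_simps power_int_add [symmetric])

text \<open>With \<open>R y = br (y + s) / br y\<close>, the factor at \<open>y\<close> is
  \<open>R y / R (y - s)\<close>, so the product along \<open>t mod s, ..., t - s\<close> collapses
  to \<open>R (t - s) / R (t mod s - s)\<close>. The class of 0 would put \<open>br 0 = 0\<close>
  into a denominator.\<close>

lemma br_chain:
  fixes t s :: int
  assumes "s > 0" "t > 0" "t mod s \<noteq> 0"
  shows "finite {y. 0 < y \<and> y < t \<and> y mod s = t mod s} \<and>
    (\<Prod>y | 0 < y \<and> y < t \<and> y mod s = t mod s. br (y - s) * br (y + s) / (br y)\<^sup>2) =
    br t / br (t - s) * (br (t mod s - s) / br (t mod s))"
  using assms(2,3)
proof (induction "nat t" arbitrary: t rule: less_induct)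
  case less
  let ?Y = "\<lambda>t. {y. 0 < y \<and> y < t \<and> y mod s = t mod s}"
  show ?case
  proof (cases "t < s")
    case True
    have Y: "?Y t = {}" using True less.prems
      by (auto simp: mod_pos_pos_trivial)
    have "t mod s = t" using True less.prems by simp
    thus ?thesis unfolding Y using less.prems True by simp
  next
    case False
    with less.prems have ts: "t - s > 0" by (cases "t = s") auto
    have "t - 2 * s \<noteq> 0" using less.prems by auto
    have m: "(t - s) mod s = t mod s" by simp
    have Y: "?Y t = insert (t - s) (?Y (t - s))"
    proof (intro Set.set_eqI iffI)
      fix y assume y: "y \<in> ?Y t"
      hence "s dvd t - y" by (auto simp: mod_eq_dvd_iff dvd_diff_commute)
      then obtain k where k: "t - y = s * k" by auto
      hence "k > 0" using y assms(1) by (auto simp: zero_less_mult_iff) (smt (verit) mult_nonneg_nonpos)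
      hence "s \<le> t - y" unfolding k using assms(1) by (simp add: mult_le_cancel_left1)
      thus "y \<in> insert (t - s) (?Y (t - s))" using y by (auto simp: m)
    qed (use ts assms(1) in \<open>auto simp: m\<close>)
    have IH: "finite (?Y (t - s))"
      "(\<Prod>y\<in>?Y (t - s). br (y - s) * br (y + s) / (br y)\<^sup>2) =
       br (t - s) / br (t - s - s) * (br (t mod s - s) / br (t mod s))"
      using less.hyps[of "t - s"] less.prems ts assms(1) by (simp_all add: m)
    have "(\<Prod>y\<in>?Y t. br (y - s) * br (y + s) / (br y)\<^sup>2) =
       br (t - s - s) * br t / (br (t - s))\<^sup>2 * (\<Prod>y\<in>?Y (t - s). br (y - s) * br (y + s) / (br y)\<^sup>2)"
      unfolding Y using IH(1) by (subst prod.insert) auto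
    also have "\<dots> = br t / br (t - s) * (br (t mod s - s) / br (t mod s))"
    proof -
      have "t - s - s \<noteq> 0" using \<open>t - 2 * s \<noteq> 0\<close> by simp
      hence "br (t - s - s) \<noteq> 0" "br (t - s) \<noteq> 0" using ts by simp_all
      thus ?thesis unfolding IH(2) by (simp add: field_simps power2_eq_square)
    qed
    finally show ?thesis using Y IH(1) by simp
  qed
qed

text \<open>\<open>Y\<close> consists of one chain in every nonzero residue class, and
  \<open>t i\<close> is the exclusive upper end of a chain. The contributions of the lower ends do
  not depend on \<open>t\<close> and form the last product.\<close>

lemma br_telescope:
  fixes s :: int and t :: "'i \<Rightarrow> int"
  assumes s: "s > 0" and I: "bij_betw (\<lambda>i. t i mod s) I {1..<s}" and tpos: "\<And>i. i \<in> I \<Longrightarrow> t i > 0"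
    and Y: "\<And>y. y \<in> Y \<longleftrightarrow> y > 0 \<and> (\<exists>i\<in>I. y mod s = t i mod s \<and> y < t i)"
  shows "(\<Prod>y\<in>Y. br (y - s) * br (y + s) / (br y)\<^sup>2) =
    (\<Prod>i\<in>I. br (t i) / br (t i - s)) * (\<Prod>r=1..<s. br (r - s) / br r)"
proof -
  have fI: "finite I" using bij_betw_finite[OF I] by simp
  have tm: "t i mod s \<noteq> 0" if "i \<in> I" for i
    using bij_betwE[OF I] that by auto
  let ?Y = "\<lambda>i. {y. 0 < y \<and> y < t i \<and> y mod s = t i mod s}"
  have "Y = (\<Union>i\<in>I. ?Y i)" using Y by auto
  moreover have "(\<Prod>y\<in>(\<Union>i\<in>I. ?Y i). br (y - s) * br (y + s) / (br y)\<^sup>2) =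
     (\<Prod>i\<in>I. \<Prod>y\<in>?Y i. br (y - s) * br (y + s) / (br y)\<^sup>2)"
  proof (rule prod.UNION_disjoint[OF fI])
    show "\<forall>i\<in>I. finite (?Y i)" using br_chain s tpos tm by blast
    show "\<forall>i\<in>I. \<forall>j\<in>I. i \<noteq> j \<longrightarrow> ?Y i \<inter> ?Y j = {}"
      using I unfolding bij_betw_def inj_on_def by auto
  qed
  moreover have "\<dots> = (\<Prod>i\<in>I. br (t i) / br (t i - s) * (br (t i mod s - s) / br (t i mod s)))"
    by (intro prod.cong refl) (use br_chain s tpos tm in blast)
  moreover have "(\<Prod>i\<in>I. br (t i mod s - s) / br (t i mod s)) = (\<Prod>r=1..<s. br (r - s) / br r)"
    by (rule prod.reindex_bij_betw[OF I])
  moreover have "(\<Prod>i\<in>I. br (t i) / br (t i - s) * (br (t i mod s - s) / br (t i mod s))) =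
    (\<Prod>i\<in>I. br (t i) / br (t i - s)) * (\<Prod>i\<in>I. br (t i mod s - s) / br (t i mod s))"
    by (rule prod.distrib)
  ultimately show ?thesis by (simp only:)
qed

lemma power_int_sum: "(\<Prod>r\<in>A. q powi f r) = q powi (\<Sum>r\<in>A. f r)"
  using q0 by (induction A rule: infinite_finite_induct) (auto simp: power_int_add)

text \<open>After the reflection of \<open>r\<close> to \<open>2 * e - r\<close> in the numerators,
  each quotient is \<open>br (- r) / br r\<close>, which is minus a power of \<open>q\<close>; the
  sign survives because \<open>2 * e - 1\<close> is odd.\<close>

lemma br_residues:
  assumes "e > 0"
  shows "(\<Prod>r=1..<2 * e. br (r - 2 * e) / br r) = - (q powi (- 2 * e * (2 * e - 1)))"
proof -
  have "(\<Prod>r=1..<2 * e. br (r - 2 * e)) = (\<Prod>r=1..<2 * e. br (- r))"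
    by (rule prod.reindex_bij_witness[of _ "\<lambda>r. 2 * e - r" "\<lambda>r. 2 * e - r"]) auto
  hence "(\<Prod>r=1..<2 * e. br (r - 2 * e) / br r) = (\<Prod>r=1..<2 * e. br (- r) / br r)"
    by (simp add: prod_dividef)
  also have "\<dots> = (\<Prod>r=1..<2 * e. - (q powi (- 2 * r)))"
    by (intro prod.cong) (auto simp: br_neg)
  also have "\<dots> = (- 1) ^ nat (2 * e - 1) * (\<Prod>r=1..<2 * e. q powi (- 2 * r))"
    by (subst prod_uminus) simp
  also have "(\<Prod>r=1..<2 * e. q powi (- 2 * r)) = q powi (\<Sum>r=1..<2 * e. - 2 * r)"
    by (rule power_int_sum)
  also have "(\<Sum>r=1..<2 * e. - 2 * r) = - 2 * e * (2 * e - 1)"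
  proof -
    have "(\<Sum>r=1..<k. - 2 * r) = - k * (k - 1)" if "k \<ge> 1" for k :: int
      using that
    proof (induction k rule: int_ge_induct)
      case (step i)
      have "{1..<i + 1} = insert i {1..<i}" using step by auto
      with step show ?case by (simp add: algebra_simps)
    qed auto
    from this[of "2 * e"] assms show ?thesis by simp
  qed
  also have "(- 1 :: 'k) ^ nat (2 * e - 1) = - 1"
  proof -
    have "odd (nat (2 * e - 1))" using assms by (simp add: even_nat_iff)
    thus ?thesis by simp
  qed
  finally show ?thesis by simp
qed

end

text \<open>The sets \<open>S\<close> whose weight survives at \<open>U = x\<^sup>-\<^sup>s\<close>, where \<open>s = 2 (n + 1)\<close>, are those for which no
  \<open>hk S m l\<close> equals \<open>s\<close>. Such a set is recorded by the largest \<open>k + s / 2\<close>, taken with a sign, in each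
  residue class \<open>\<plusminus> (j + 1)\<close> modulo \<open>s\<close>. The classes of \<open>0\<close> and \<open>s / 2\<close> do not occur.\<close>

definition core_set :: "nat \<Rightarrow> (nat \<Rightarrow> int) \<Rightarrow> nat set" where
  "core_set n v = {k. 0 < k \<and> (\<exists>j<n. \<exists>\<sigma>\<in>{1, -1}.
     (int k + (int n + 1)) mod (2 * (int n + 1)) = (\<sigma> * v j) mod (2 * (int n + 1)) \<and>
     int k + (int n + 1) \<le> \<sigma> * v j)}"

text \<open>Both signs are allowed because the induction in \<open>core_weight\<close> reflects
  coordinates; the final sum uses only the residue \<open>j + 1\<close> (see
  \<open>vshift\<close>).\<close>

definition signed_residues :: "nat \<Rightarrow> (nat \<Rightarrow> int) \<Rightarrow> bool" where
  "signed_residues n v \<longleftrightarrow> (\<forall>j<n. v j mod (2 * (int n + 1)) = int j + 1 \<or>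
     v j mod (2 * (int n + 1)) = 2 * (int n + 1) - (int j + 1))"

lemma signed_mod:
  assumes "signed_residues n v" "j < n" "\<sigma> \<in> {1, -1}"
  shows "(\<sigma> * v j) mod (2 * (int n + 1)) =
    (if (\<sigma> = 1) = (v j mod (2 * (int n + 1)) = int j + 1) then int j + 1
     else 2 * (int n + 1) - (int j + 1))"
proof -
  let ?s = "2 * (int n + 1)"
  have v: "v j mod ?s = int j + 1 \<or> v j mod ?s = ?s - (int j + 1)"
    using assms by (auto simp: signed_residues_def)
  have "(- v j) mod ?s = ?s - v j mod ?s"
    using v assms(2) by (subst zmod_zminus1_eq_if) auto
  with v assms(2,3) show ?thesis by auto
qed

lemma signed_mod_neq:
  assumes "signed_residues n v" "j < n" "\<sigma> \<in> {1, -1}"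
  shows "(\<sigma> * v j) mod (2 * (int n + 1)) \<notin> {0, int n + 1}"
  using assms(2) unfolding signed_mod[OF assms] by (auto split: if_splits)

lemma signed_mod_unique:
  assumes "signed_residues n v" "j < n" "\<sigma> \<in> {1, -1}" "j' < n" "\<sigma>' \<in> {1, -1}"
    and "(\<sigma> * v j) mod (2 * (int n + 1)) = (\<sigma>' * v j') mod (2 * (int n + 1))"
  shows "j = j' \<and> \<sigma> = \<sigma>'"
  using assms(6) unfolding signed_mod[OF assms(1,2,3)] signed_mod[OF assms(1,4,5)]
  using assms(2-5) by (auto split: if_splits)

lemma signed_mod_surj:
  assumes "signed_residues n v" "0 < \<rho>" "\<rho> < 2 * (int n + 1)" "\<rho> \<noteq> int n + 1"
  obtains j \<sigma> where "j < n" "\<sigma> \<in> {1, -1}" "(\<sigma> * v j) mod (2 * (int n + 1)) = \<rho>"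
proof -
  define j where "j = (if \<rho> < int n + 1 then nat (\<rho> - 1) else nat (2 * (int n + 1) - \<rho> - 1))"
  have j: "j < n" "\<rho> = int j + 1 \<or> \<rho> = 2 * (int n + 1) - (int j + 1)"
    using assms(2-4) by (auto simp: j_def)
  have "(1 * v j) mod (2 * (int n + 1)) = \<rho> \<or> (-1 * v j) mod (2 * (int n + 1)) = \<rho>"
    using signed_mod[OF assms(1) j(1), of 1] signed_mod[OF assms(1) j(1), of "-1"] j
    by (auto split: if_splits)
  with that j(1) show ?thesis by blast
qed

text \<open>The residue determines index and sign (\<open>signed_mod_unique\<close>), so each
  residue class of the set is an initial segment cut off by a single coordinate.\<close>

lemma core_set_mem:
  assumes "signed_residues n v" "j < n" "\<sigma> \<in> {1, -1}" "0 < k"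
    and "(int k + (int n + 1)) mod (2 * (int n + 1)) = (\<sigma> * v j) mod (2 * (int n + 1))"
  shows "k \<in> core_set n v \<longleftrightarrow> int k + (int n + 1) \<le> \<sigma> * v j"
proof
  assume "k \<in> core_set n v"
  then obtain j' \<sigma>' where *: "j' < n" "\<sigma>' \<in> {1, -1}"
    "(int k + (int n + 1)) mod (2 * (int n + 1)) = (\<sigma>' * v j') mod (2 * (int n + 1))"
    "int k + (int n + 1) \<le> \<sigma>' * v j'" unfolding core_set_def by blast
  with signed_mod_unique[OF assms(1,2,3) *(1,2)] assms(5)
  show "int k + (int n + 1) \<le> \<sigma> * v j" by auto
qed (use assms in \<open>unfold core_set_def, blast\<close>)

lemma core_set_not_mem:
  assumes "signed_residues n v"
    and "(int k + (int n + 1)) mod (2 * (int n + 1)) \<in> {0, int n + 1}"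
  shows "k \<notin> core_set n v"
proof
  assume "k \<in> core_set n v"
  then obtain j \<sigma> where *: "j < n" "\<sigma> \<in> {1, -1}"
    "(int k + (int n + 1)) mod (2 * (int n + 1)) = (\<sigma> * v j) mod (2 * (int n + 1))"
    unfolding core_set_def by blast
  from * assms(2) show False unfolding signed_mod[OF assms(1) *(1,2)]
    by (auto split: if_splits)
qed

lemma finite_core_set: "finite (core_set n v)"
proof -
  have "core_set n v \<subseteq> {..nat (\<Sum>j<n. \<bar>v j\<bar>)}"
  proof
    fix k assume "k \<in> core_set n v"
    then obtain j \<sigma> where *: "j < n" "\<sigma> \<in> {1, -1 :: int}" "int k + (int n + 1) \<le> \<sigma> * v j"
      unfolding core_set_def by blast
    have "\<bar>v j\<bar> \<le> (\<Sum>j<n. \<bar>v j\<bar>)" using *(1) by (intro member_le_sum) auto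
    with * show "k \<in> {..nat (\<Sum>j<n. \<bar>v j\<bar>)}" by auto
  qed
  thus ?thesis by (rule finite_subset) simp
qed

lemma zero_notin_core_set: "0 \<notin> core_set n v"
  by (simp add: core_set_def)

text \<open>A coordinate of largest modulus governs the largest element \<open>a - e\<close>.
  Lowering it by one period removes just this element, and since \<open>a - 2 * e > - e\<close> the
  opposite class stays empty.\<close>

lemma core_step:
  fixes a :: int and n :: nat
  defines "e \<equiv> int n + 1"
  assumes v: "signed_residues n v" and i: "i < n" "v i = a" and a: "a > e"
    and mx: "\<forall>j<n. \<bar>v j\<bar> \<le> a"
  shows "core_set n v = insert (nat (a - e)) (core_set n (v(i := a - 2 * e)))"
    and "k \<in> core_set n (v(i := a - 2 * e)) \<Longrightarrow> k < nat (a - e)"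
    and "signed_residues n (v(i := a - 2 * e))"
proof -
  let ?v' = "v(i := a - 2 * e)" and ?m = "nat (a - e)"
  have sm: "(a - 2 * e) mod (2 * e) = a mod (2 * e)" by simp
  show v': "signed_residues n ?v'"
    using v i sm by (auto simp: signed_residues_def e_def)
  have le: "k \<le> ?m" if "k \<in> core_set n v" for k
  proof -
    from that obtain j \<sigma> where *: "j < n" "\<sigma> \<in> {1, -1 :: int}" "int k + (int n + 1) \<le> \<sigma> * v j"
      unfolding core_set_def by blast
    with mx[rule_format, OF *(1)] show ?thesis by (auto simp: e_def)
  qed
  have m: "?m \<in> core_set n v"
    using core_set_mem[OF v i(1), of 1 ?m] a i by (simp add: e_def)
  have sub: "k \<in> core_set n v" if k: "k \<in> core_set n ?v'" for k
  proof -
    from k obtain j \<sigma> where *: "j < n" "\<sigma> \<in> {1, -1 :: int}" "int k + e \<le> \<sigma> * ?v' j" "k > 0"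
      "(int k + e) mod (2 * e) = (\<sigma> * ?v' j) mod (2 * e)"
      unfolding core_set_def e_def by blast
    show ?thesis
    proof (cases "j = i")
      case True
      with * a have "\<sigma> = 1" by auto
      with * True a i sm show ?thesis
        using core_set_mem[OF v i(1), of 1 k] by (simp add: e_def)
    next
      case False
      with * show ?thesis using core_set_mem[OF v *(1,2,4)] by (simp add: e_def)
    qed
  qed
  have m': "?m \<notin> core_set n ?v'"
    using core_set_mem[OF v' i(1), of 1 ?m] a i sm by (simp add: e_def)
  show "k < ?m" if "k \<in> core_set n ?v'" for k
    using le[OF sub[OF that]] that m' by (cases "k = ?m") auto
  show "core_set n v = insert ?m (core_set n ?v')"
  proof (intro Set.set_eqI iffI)
    fix k assume k: "k \<in> core_set n v"
    show "k \<in> insert ?m (core_set n ?v')"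
    proof (cases "k = ?m")
      case False
      from k obtain j \<sigma> where *: "j < n" "\<sigma> \<in> {1, -1 :: int}" "int k + e \<le> \<sigma> * v j" "k > 0"
        "(int k + e) mod (2 * e) = (\<sigma> * v j) mod (2 * e)"
        unfolding core_set_def e_def by blast
      show ?thesis
      proof (cases "j = i")
        case True
        with * a i have \<sigma>: "\<sigma> = 1" by (auto simp: e_def)
        with * True i have "int k + e \<le> a" "(int k + e) mod (2 * e) = a mod (2 * e)" by auto
        hence "2 * e dvd a - (int k + e)" by (metis mod_eq_dvd_iff)
        then obtain c where c: "a - (int k + e) = 2 * e * c" by auto
        have "a - (int k + e) \<noteq> 0" using False a by auto
        with c \<open>int k + e \<le> a\<close> have "c > 0"
          by (smt (verit) e_def mult_nonneg_nonpos of_nat_0_le_iff mult_eq_0_iff)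
        hence "2 * e * 1 \<le> 2 * e * c" by (intro mult_left_mono) (auto simp: e_def)
        hence "int k + e \<le> a - 2 * e" using c by simp
        thus ?thesis
          using core_set_mem[OF v' i(1), of 1 k] * \<sigma> True i sm by (simp add: e_def)
      next
        case False
        with * show ?thesis using core_set_mem[OF v' *(1,2,4)] by (simp add: e_def)
      qed
    qed simp
  qed (use m sub in auto)
qed

context generic_q begin

text \<open>In every nonzero residue class modulo \<open>s\<close>, the hook lengths of the largest
  element are exactly the positive numbers below a certain end, so \<open>br_telescope\<close>
  applies. The outcome is the quotient of Weyl denominators found in
  \<open>vdet_step\<close>.\<close>

lemma wfac_core:
  fixes a :: int and n :: nat and v :: "nat \<Rightarrow> int"
  defines "e \<equiv> int n + 1"
  assumes v: "signed_residues n v" and i: "i < n" "v i = a" and a: "a > e"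
    and mx: "\<forall>j<n. \<bar>v j\<bar> \<le> a"
  shows "q powi (4 * e * (a - e)) * wfac (q\<^sup>2) (q powi (- 4 * e)) (\<lambda>y. inverse (1 - q\<^sup>2 ^ y)) (core_set n v) (nat (a - e)) =
     q powi (2 * (3 * e - 2 * e\<^sup>2)) * (br a / br (a - 2 * e)) *
     (\<Prod>j\<in>{..<n} - {i}. br (a - v j) * br (a + v j) / (br (a - 2 * e - v j) * br (a - 2 * e + v j)))"
proof -
  define s where "s = 2 * e"
  have e: "e > 0" and s: "s > 0" by (auto simp: s_def e_def)
  define m where "m = nat (a - e)"
  have m: "int m = a - e" "m > 0" using a by (auto simp: m_def)
  define S where "S = core_set n v"
  note step = core_step[OF v i a[unfolded e_def] mx, folded e_def]
  have S: "m \<in> S" "0 \<notin> S" using step(1) zero_notin_core_set a by (auto simp: S_def m_def)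
  have Sm: "k \<le> m" if "k \<in> S" for k
    using that step(1,2) unfolding S_def m_def by fastforce
  \<comment> \<open>Indices of the chains. The ends \<open>a\<close>, \<open>a + e\<close> and
    \<open>2 * a\<close> belong to the residues \<open>r\<close> for which \<open>a - r\<close> is
    congruent to 0, \<open>s / 2\<close> and \<open>- v i\<close>; the end
    \<open>a - \<sigma> * v j\<close> belongs to the one with \<open>a - r\<close> congruent to
    \<open>\<sigma> * v j\<close>.\<close>
  define Ix where "Ix = {0, 1, 2 :: nat} <+> (({..<n} - {i}) \<times> {1, -1 :: int})"
  define t where "t = case_sum (\<lambda>c :: nat. if c = 0 then a else if c = 1 then a + e else 2 * a) (\<lambda>(j, \<sigma>). a - \<sigma> * v j)"
  have finIx: "finite Ix" by (simp add: Ix_def)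
  have cardIx: "card Ix = nat (s - 1)"
  proof -
    have "card Ix = 3 + (n - 1) * 2" unfolding Ix_def using i by (subst card_Plus) (auto simp: card_cartesian_product)
    thus ?thesis using i by (auto simp: s_def e_def)
  qed
  have surj: "r \<in> (\<lambda>\<iota>. t \<iota> mod s) ` Ix" if r: "r \<in> {1..<s}" for r
  proof -
    define \<rho> where "\<rho> = (a - r) mod s"
    have r': "r mod s = r" using r by simp
    have eqI: "r = b mod s" if "(a - b) mod s = \<rho>" for b
    proof -
      have "(a - (a - b)) mod s = (a - (a - r)) mod s"
        using mod_diff_cong[OF refl, of "a - b" s "a - r" a] that unfolding \<rho>_def by blast
      thus ?thesis using r' by simp
    qed
    consider "\<rho> = 0" | "\<rho> = e" | "0 < \<rho>" "\<rho> < s" "\<rho> \<noteq> e"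
      using s pos_mod_bound[of s "a - r"] pos_mod_sign[of s "a - r"] unfolding \<rho>_def by linarith
    then show ?thesis
    proof cases
      case 1
      have "r = t (Inl 0) mod s" using 1 eqI[of a] by (simp add: t_def)
      thus ?thesis by (auto simp: Ix_def)
    next
      case 2
      have "(a - (a + e)) mod s = (- e + s) mod s" by simp
      also have "\<dots> = e" using e by (simp add: s_def)
      finally have "r = t (Inl 1) mod s" using 2 eqI[of "a + e"] by (simp add: t_def)
      thus ?thesis by (auto simp: Ix_def)
    next
      case 3
      then obtain j \<sigma> where j: "j < n" "\<sigma> \<in> {1, -1}" "(\<sigma> * v j) mod s = \<rho>"
        using signed_mod_surj[OF v, of \<rho>] by (auto simp: s_def e_def)
      show ?thesis
      proof (cases "j = i")
        case True
        have "\<sigma> \<noteq> 1"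
        proof
          assume "\<sigma> = 1"
          hence "r = 0 mod s" using j True i eqI[of 0] by simp
          thus False using r by simp
        qed
        hence "\<sigma> = -1" using j by simp
        hence "r = t (Inl 2) mod s" using j True i eqI[of "2 * a"] by (simp add: t_def)
        thus ?thesis by (auto simp: Ix_def)
      next
        case False
        hence "r = t (Inr (j, \<sigma>)) mod s" using j eqI[of "a - \<sigma> * v j"] by (simp add: t_def)
        thus ?thesis using j False by (force simp: Ix_def)
      qed
    qed
  qed
  \<comment> \<open>There are \<open>3 + 2 * (n - 1) = s - 1\<close> indices and as many nonzero
    classes, so surjectivity makes the map bijective.\<close>
  have img: "(\<lambda>\<iota>. t \<iota> mod s) ` Ix = {1..<s}"
  proof (rule card_seteq[symmetric])
    show "card ((\<lambda>\<iota>. t \<iota> mod s) ` Ix) \<le> card {1..<s}"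
      using card_image_le[OF finIx, of "\<lambda>\<iota>. t \<iota> mod s"] cardIx by simp
  qed (use surj finIx in auto)
  have bij: "bij_betw (\<lambda>\<iota>. t \<iota> mod s) Ix {1..<s}"
    unfolding bij_betw_def using img cardIx finIx by (auto intro!: eq_card_imp_inj_on)
  have tpos: "t \<iota> > 0" if "\<iota> \<in> Ix" for \<iota>
  proof -
    have P: "a - \<sigma> * v j > 0" if "j < n" "j \<noteq> i" "\<sigma> \<in> {1, -1}" for j \<sigma>
    proof -
      have "\<sigma> * v j \<noteq> a" using signed_mod_unique[OF v that(1,3) i(1), of 1] that(2) i(2) by auto
      with mx[rule_format, OF that(1)] that(3) show ?thesis by auto
    qed
    consider "\<iota> \<in> {Inl 0, Inl 1, Inl 2}" | j \<sigma> where "\<iota> = Inr (j, \<sigma>)" "j < n" "j \<noteq> i" "\<sigma> \<in> {1, -1}"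
      using \<open>\<iota> \<in> Ix\<close> unfolding Ix_def by auto
    then show ?thesis
    proof cases
      case 1
      thus ?thesis using a e by (auto simp: t_def)
    next
      case (2 j \<sigma>)
      thus ?thesis using P[of j \<sigma>] by (simp add: t_def)
    qed
  qed
  define Y where "Y = (\<lambda>l. int (hk S m l)) ` {0..m}"
  \<comment> \<open>A length up to \<open>m\<close> is \<open>m - l\<close> for a gap
    \<open>l\<close>, a length above \<open>m\<close> is \<open>m + l\<close> with
    \<open>l \<in> S\<close>. Questions about \<open>Y\<close> thus become questions about
    \<open>S\<close>, answered class by class.\<close>
  have Ymem: "y \<in> Y \<longleftrightarrow> (0 < y \<and> y \<le> int m \<and> nat (int m - y) \<notin> S) \<or> (int m < y \<and> nat (y - int m) \<in> S)" for y :: int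
  proof
    assume "y \<in> Y"
    then obtain l where l: "l \<le> m" "y = int (hk S m l)" by (auto simp: Y_def)
    show "(0 < y \<and> y \<le> int m \<and> nat (int m - y) \<notin> S) \<or> (int m < y \<and> nat (y - int m) \<in> S)"
    proof (cases "l \<in> S")
      case True
      hence "l > 0" using S(2) by (cases l) auto
      with True l show ?thesis by (simp add: hk_def)
    next
      case False
      hence "l \<noteq> m" using S(1) by auto
      with l(1) have "l < m" by simp
      hence "nat (int m - y) = l" using False l by (simp add: hk_def)
      with False \<open>l < m\<close> l show ?thesis by (simp add: hk_def)
    qed
  next
    assume "(0 < y \<and> y \<le> int m \<and> nat (int m - y) \<notin> S) \<or> (int m < y \<and> nat (y - int m) \<in> S)"
    thus "y \<in> Y"
    proof (elim disjE conjE)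
      assume "0 < y" "y \<le> int m" "nat (int m - y) \<notin> S"
      thus ?thesis unfolding Y_def by (intro image_eqI[of _ _ "nat (int m - y)"]) (auto simp: hk_def)
    next
      assume "m < y" "nat (y - int m) \<in> S"
      thus ?thesis unfolding Y_def using Sm by (intro image_eqI[of _ _ "nat (y - int m)"]) (auto simp: hk_def)
    qed
  qed
  have le_iff: "c \<le> d - s \<longleftrightarrow> c < d" if "c mod s = d mod s" for c d :: int
  proof -
    have "s dvd d - c" using that by (metis mod_eq_dvd_iff)
    then obtain b where b: "d - c = s * b" by auto
    show ?thesis
    proof
      assume "c < d"
      hence "b > 0" using b s by (smt (verit) mult_nonneg_nonpos)
      hence "s * 1 \<le> s * b" using s by (intro mult_left_mono) auto
      thus "c \<le> d - s" using b by simp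
    qed (use s in auto)
  qed
  have modI: "c mod s = d mod s" if "c - d = b * s" for b c d :: int
    using that by (metis add_diff_cancel_left' diff_add_cancel mod_mult_self1 add.commute)
  have in_low: "k \<in> S \<longleftrightarrow> int k + e \<le> \<sigma> * v j"
    if "0 < k" "j < n" "\<sigma> \<in> {1, -1}" "(int k + e) mod s = (\<sigma> * v j) mod s" for k j \<sigma>
    using core_set_mem[OF v that(2,3,1)] that(4) by (simp add: S_def s_def e_def)
  have notin: "k \<notin> S" if "(int k + e) mod s \<in> {0, e}" for k
    using core_set_not_mem[OF v, of k] that unfolding S_def s_def e_def by blast
  have key: "y \<in> Y \<longleftrightarrow> y < t \<iota>" if y: "y > 0" and \<iota>: "\<iota> \<in> Ix" and yt: "y mod s = t \<iota> mod s" for y \<iota>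
  proof -
    have "\<exists>b. y - t \<iota> = b * s" using yt by (metis mod_eq_dvd_iff dvd_def mult.commute)
    then obtain b where b: "y - t \<iota> = b * s" by blast
    consider "\<iota> = Inl 0" | "\<iota> = Inl 1" | "\<iota> = Inl 2" | j \<sigma> where "\<iota> = Inr (j, \<sigma>)" "j < n" "j \<noteq> i" "\<sigma> \<in> {1, -1}"
      using \<iota> unfolding Ix_def by auto
    then show ?thesis
    proof cases
      case 1
      hence t: "t \<iota> = a" by (simp add: t_def)
      show ?thesis
      proof (cases "y \<le> int m")
        case True
        have "(int (nat (int m - y)) + e) mod s = 0 mod s"
          using True b t m by (intro modI[of _ _ "- b"]) (auto simp: algebra_simps)
        hence "nat (int m - y) \<notin> S" using notin[of "nat (int m - y)"] by simp
        thus ?thesis using Ymem[of y] True y m e t by auto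
      next
        case False
        have "(int (nat (y - int m)) + e) mod s = 0 mod s"
          using False b t m by (intro modI[of _ _ "b + 1"]) (auto simp: algebra_simps s_def)
        hence "nat (y - int m) \<notin> S" using notin[of "nat (y - int m)"] by simp
        moreover have "\<not> y < a" using False le_iff[of y a] yt t m e s_def by auto
        ultimately show ?thesis using Ymem[of y] False t by auto
      qed
    next
      case 2
      hence t: "t \<iota> = a + e" by (simp add: t_def)
      have es: "e mod s = e" using e by (simp add: s_def)
      show ?thesis
      proof (cases "y \<le> int m")
        case True
        have "(int (nat (int m - y)) + e) mod s = e mod s"
          using True b t m by (intro modI[of _ _ "- b - 1"]) (auto simp: algebra_simps s_def)
        hence "nat (int m - y) \<notin> S" using notin[of "nat (int m - y)"] es by simp
        thus ?thesis using Ymem[of y] True y m e t by auto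
      next
        case False
        have "(int (nat (y - int m)) + e) mod s = e mod s"
          using False b t m by (intro modI[of _ _ "b + 1"]) (auto simp: algebra_simps s_def)
        hence "nat (y - int m) \<notin> S" using notin[of "nat (y - int m)"] es by simp
        moreover have "\<not> y < a + e" using False le_iff[of y "a + e"] yt t m e s_def by auto
        ultimately show ?thesis using Ymem[of y] False t by auto
      qed
    next
      case 3
      hence t: "t \<iota> = 2 * a" by (simp add: t_def)
      show ?thesis
      proof (cases "y \<le> int m")
        case True
        have "nat (int m - y) \<notin> S"
        proof
          assume *: "nat (int m - y) \<in> S"
          hence "nat (int m - y) > 0" using S(2) by (cases "nat (int m - y)") auto
          moreover have "(int (nat (int m - y)) + e) mod s = (-1 * v i) mod s"
            using True b t m i by (intro modI[of _ _ "- b"]) (auto simp: algebra_simps s_def)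
          ultimately show False using in_low[of "nat (int m - y)" i "-1"] * i a e by auto
        qed
        thus ?thesis using Ymem[of y] True y m e t a by auto
      next
        case False
        have "(int (nat (y - int m)) + e) mod s = (1 * v i) mod s"
          using False b t m i by (intro modI[of _ _ "b + 1"]) (auto simp: algebra_simps s_def)
        hence "nat (y - int m) \<in> S \<longleftrightarrow> y - m + e \<le> a"
          using in_low[of "nat (y - int m)" i 1] i False by auto
        also have "\<dots> \<longleftrightarrow> y \<le> 2 * a - s" using m by (auto simp: s_def)
        also have "\<dots> \<longleftrightarrow> y < 2 * a" using le_iff[of y "2 * a"] yt t by simp
        finally show ?thesis using Ymem[of y] False t by auto
      qed
    next
      case (4 j \<sigma>)
      hence t: "t \<iota> = a - \<sigma> * v j" by (simp add: t_def)
      show ?thesis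
      proof (cases "y \<le> int m")
        case True
        have c: "(int (nat (int m - y)) + e) mod s = (\<sigma> * v j) mod s"
          using True b t m i by (intro modI[of _ _ "- b"]) (auto simp: algebra_simps s_def)
        have "nat (int m - y) \<noteq> 0"
        proof
          assume 0: "nat (int m - y) = 0"
          hence "e mod s = (\<sigma> * v j) mod s" using c by simp
          moreover have "e mod s = e" using e by (simp add: s_def)
          ultimately have "(\<sigma> * v j) mod s = e" by simp
          thus False
            using signed_mod_neq[OF v 4(2,4)] unfolding s_def e_def by blast
        qed
        hence "nat (int m - y) \<in> S \<longleftrightarrow> m - y + e \<le> \<sigma> * v j"
          using in_low[of "nat (int m - y)" j \<sigma>] 4 c by auto
        thus ?thesis using Ymem[of y] True y t m by auto
      next
        case False
        have "(int (nat (y - int m)) + e) mod s = ((- \<sigma>) * v j) mod s"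
          using False b t m i by (intro modI[of _ _ "b + 1"]) (auto simp: algebra_simps s_def)
        hence "nat (y - int m) \<in> S \<longleftrightarrow> y - m + e \<le> - \<sigma> * v j"
          using in_low[of "nat (y - int m)" j "- \<sigma>"] 4 False by auto
        also have "\<dots> \<longleftrightarrow> y \<le> t \<iota> - s" using m t by (auto simp: s_def)
        also have "\<dots> \<longleftrightarrow> y < t \<iota>" using le_iff[of y "t \<iota>"] yt by simp
        finally show ?thesis using Ymem[of y] False by auto
      qed
    qed
  qed
  have Yiff: "y \<in> Y \<longleftrightarrow> y > 0 \<and> (\<exists>\<iota>\<in>Ix. y mod s = t \<iota> mod s \<and> y < t \<iota>)" for y
  proof
    assume y: "y \<in> Y"
    hence ypos: "y > 0" using Ymem[of y] by auto
    \<comment> \<open>For a multiple of \<open>s\<close>, \<open>m - y\<close> would lie in the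
      class of \<open>v i\<close>, hence in \<open>S\<close>, and not be a gap; \<open>y - m\<close>
      would lie in the class of \<open>- v i\<close>, of which \<open>S\<close> has no
      element.\<close>
    have "y mod s \<noteq> 0"
    proof
      assume "y mod s = 0"
      then obtain b where b: "y = s * b" by (metis dvd_def mod_0_imp_dvd)
      show False
      proof (cases "y \<le> int m")
        case True
        have c: "(int (nat (int m - y)) + e) mod s = (1 * v i) mod s"
          using True b m i by (intro modI[of _ _ "- b"]) (auto simp: algebra_simps s_def)
        have "nat (int m - y) \<noteq> 0"
        proof
          assume 0: "nat (int m - y) = 0"
          hence "e mod s = (1 * v i) mod s" using c by simp
          moreover have "e mod s = e" using e by (simp add: s_def)
          ultimately have "(1 * v i) mod s = e" by simp
          thus False
            using signed_mod_neq[OF v i(1), of 1] unfolding s_def e_def by blast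
        qed
        hence "nat (int m - y) \<in> S" using in_low[of "nat (int m - y)" i 1] c i ypos m by auto
        thus False using Ymem[of y] True y by auto
      next
        case False
        have c: "(int (nat (y - int m)) + e) mod s = (- 1 * v i) mod s"
          using False b m i by (intro modI[of _ _ "b + 1"]) (auto simp: algebra_simps s_def)
        hence "nat (y - int m) \<notin> S"
          using in_low[of "nat (y - int m)" i "-1"] i False a e by auto
        thus False using Ymem[of y] False y by auto
      qed
    qed
    hence "y mod s \<in> {1..<s}" using s pos_mod_bound[of s y] pos_mod_sign[of s y] unfolding atLeastLessThan_iff by linarith
    then obtain \<iota> where \<iota>: "\<iota> \<in> Ix" "y mod s = t \<iota> mod s" using img by (metis (no_types, lifting) imageE)
    with key[OF ypos \<iota>] y ypos show "y > 0 \<and> (\<exists>\<iota>\<in>Ix. y mod s = t \<iota> mod s \<and> y < t \<iota>)" by blast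
  qed (use key in blast)
  define h where "h l = int (hk S m l)" for l
  have inj: "inj_on h {0..m}" using hk_inj[OF S(2), of m] by (auto simp: inj_on_def h_def)
  have tele: "(\<Prod>l=0..m. br (h l - s) * br (h l + s) / (br (h l))\<^sup>2) =
     (\<Prod>\<iota>\<in>Ix. br (t \<iota>) / br (t \<iota> - s)) * (\<Prod>r=1..<s. br (r - s) / br r)"
  proof -
    have "(\<Prod>l=0..m. br (h l - s) * br (h l + s) / (br (h l))\<^sup>2) =
      (\<Prod>y\<in>h ` {0..m}. br (y - s) * br (y + s) / (br y)\<^sup>2)"
      by (simp add: prod.reindex[OF inj])
    also have "h ` {0..m} = Y" by (simp add: Y_def h_def)
    finally show ?thesis using br_telescope[OF s bij tpos Yiff] by simp
  qed
  let ?P = "\<Prod>l=0..m. br (h l - s) / br (h l)" and ?Q = "\<Prod>l=1..<m. br (h l + s) / br (h l)"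
  \<comment> \<open>The factors \<open>U - x ^ h\<close> omit \<open>l = 0\<close> and
    \<open>l = m\<close>. What is missing is exactly the contribution of the ends
    \<open>a + e\<close> and \<open>2 * a\<close>, so \<open>?\<kappa>\<close> cancels.\<close>
  let ?\<kappa> = "br (a + e) / br (a - e) * (br (2 * a) / br (2 * a - s))"
  let ?J = "\<Prod>j\<in>{..<n} - {i}. br (a - v j) * br (a + v j) / (br (a - s - v j) * br (a - s + v j))"
  have lhs: "(\<Prod>l=0..m. br (h l - s) * br (h l + s) / (br (h l))\<^sup>2) = ?P * ?Q * ?\<kappa>"
  proof -
    have h0: "h 0 = a - e" "h m = 2 * a - s" using S m by (auto simp: h_def hk_def s_def)
    have set: "{0..m} = insert 0 (insert m {1..<m})" using m by auto
    have "(\<Prod>l=0..m. br (h l + s) / br (h l)) = ?Q * ?\<kappa>"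
      unfolding set using m by (simp add: h0 s_def mult_ac add_ac)
    moreover have "(\<Prod>l=0..m. br (h l - s) * br (h l + s) / (br (h l))\<^sup>2) =
       ?P * (\<Prod>l=0..m. br (h l + s) / br (h l))"
      by (simp add: prod.distrib [symmetric] power2_eq_square)
    ultimately show ?thesis by simp
  qed
  have rhs: "(\<Prod>\<iota>\<in>Ix. br (t \<iota>) / br (t \<iota> - s)) = br a / br (a - s) * ?\<kappa> * ?J"
  proof -
    have "(\<Prod>\<iota>\<in>Ix. br (t \<iota>) / br (t \<iota> - s)) =
      (\<Prod>c\<in>{0,1,2::nat}. br (t (Inl c)) / br (t (Inl c) - s)) *
      (\<Prod>p\<in>({..<n} - {i}) \<times> {1, -1 :: int}. br (t (Inr p)) / br (t (Inr p) - s))"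
      unfolding Ix_def by (subst prod.Plus) (auto simp: o_def)
    also have "(\<Prod>c\<in>{0,1,2::nat}. br (t (Inl c)) / br (t (Inl c) - s)) = br a / br (a - s) * ?\<kappa>"
      by (simp add: t_def s_def algebra_simps)
    also have "(\<Prod>p\<in>({..<n} - {i}) \<times> {1, -1 :: int}. br (t (Inr p)) / br (t (Inr p) - s)) =
        (\<Prod>j\<in>{..<n} - {i}. \<Prod>\<sigma>\<in>{1,-1}. br (a - \<sigma> * v j) / br (a - \<sigma> * v j - s))"
      by (subst prod.cartesian_product) (auto simp: t_def intro!: prod.cong)
    also have "\<dots> = ?J"
      by (intro prod.cong refl) (simp add: algebra_simps)
    finally show ?thesis .
  qed
  have \<kappa>: "?\<kappa> \<noteq> 0" using a e by (simp add: s_def)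
  have PQ: "?P * ?Q = br a / br (a - s) * ?J * (\<Prod>r=1..<s. br (r - s) / br r)"
  proof -
    have "(?P * ?Q) * ?\<kappa> = (br a / br (a - s) * ?J * (\<Prod>r=1..<s. br (r - s) / br r)) * ?\<kappa>"
      unfolding lhs [symmetric] tele rhs by (simp only: mult_ac)
    thus ?thesis using mult_right_cancel[OF \<kappa>] by blast
  qed
  have p: "(q\<^sup>2) ^ y = q powi (2 * int y)" for y
    by (simp add: power_mult [symmetric] power_int_def nat_mult_distrib)
  have f1: "(1 - q powi (- 4 * e) * (q\<^sup>2) ^ hk S m l) * inverse (1 - (q\<^sup>2) ^ hk S m l) = br (h l - s) / br (h l)" for l
    using q0 by (simp add: p br_def h_def s_def divide_inverse power_int_add [symmetric] algebra_simps)
  have f2: "(q powi (- 4 * e) - (q\<^sup>2) ^ hk S m l) * inverse (1 - (q\<^sup>2) ^ hk S m l) =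
       q powi (- 4 * e) * (br (h l + s) / br (h l))" for l
    using q0 by (simp add: p br_def h_def s_def divide_inverse power_int_add [symmetric] algebra_simps)
  have W: "wfac (q\<^sup>2) (q powi (- 4 * e)) (\<lambda>y. inverse (1 - q\<^sup>2 ^ y)) S m = - ((q powi (- 4 * e)) ^ (m - 1) * (?P * ?Q))"
    unfolding wfac_def f1 f2 prod.distrib [of "\<lambda>_. q powi (- 4 * e)"] by (simp only: prod_constant card_atLeastLessThan mult_ac)
  have pw: "q powi (4 * e * (a - e)) * (q powi (- 4 * e)) ^ (m - 1) = q powi (4 * e)"
  proof -
    have "(q powi (- 4 * e)) ^ (m - 1) = q powi (- 4 * e * int (m - 1))"
      by (simp only: power_int_mult power_int_of_nat)
    moreover have "4 * e * (a - e) + - 4 * e * int (m - 1) = 4 * e"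
    proof -
      have "int (m - 1) = a - e - 1" using m by (simp add: of_nat_diff)
      show ?thesis unfolding \<open>int (m - 1) = a - e - 1\<close> by (simp add: algebra_simps)
    qed
    ultimately show ?thesis using q0 by (simp add: power_int_add [symmetric])
  qed
  have "q powi (4 * e * (a - e)) * wfac (q\<^sup>2) (q powi (- 4 * e)) (\<lambda>y. inverse (1 - q\<^sup>2 ^ y)) S m =
     - (q powi (4 * e)) * (?P * ?Q)"
    unfolding W using pw by simp
  also have "\<dots> = q powi (4 * e) * q powi (- 2 * e * (2 * e - 1)) * (br a / br (a - s)) * ?J"
    unfolding PQ using br_residues[OF e] by (simp add: s_def mult_ac)
  also have "q powi (4 * e) * q powi (- 2 * e * (2 * e - 1)) = q powi (2 * (3 * e - 2 * e\<^sup>2))"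
    using q0 by (simp add: power_int_add [symmetric] power2_eq_square algebra_simps)
  finally show ?thesis by (simp add: S_def m_def s_def)
qed

end

lemma core_set_flip:
  assumes "i < n"
  shows "core_set n (v(i := - v i)) = core_set n v"
proof -
  have sub: "core_set n v \<subseteq> core_set n (v(i := - v i))" for v
  proof
    fix k assume "k \<in> core_set n v"
    then obtain j \<sigma> where *: "k > 0" "j < n" "\<sigma> \<in> {1, -1 :: int}" 
      "(int k + (int n + 1)) mod (2 * (int n + 1)) = (\<sigma> * v j) mod (2 * (int n + 1))"
      "int k + (int n + 1) \<le> \<sigma> * v j"
      unfolding core_set_def by blast
    define \<tau> where "\<tau> = (if j = i then - \<sigma> else \<sigma>)"
    have "\<tau> \<in> {1, -1}" "\<tau> * (v(i := - v i)) j = \<sigma> * v j" using *(3) by (auto simp: \<tau>_def)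
    with * show "k \<in> core_set n (v(i := - v i))" unfolding core_set_def mem_Collect_eq by metis
  qed
  show ?thesis using sub[of v] sub[of "v(i := - v i)"] by (simp add: subset_antisym)
qed

text \<open>Compensates that \<open>vdet\<close> is odd in each coordinate whereas
  \<open>core_set\<close> ignores signs.\<close>

definition res_sign :: "nat \<Rightarrow> (nat \<Rightarrow> int) \<Rightarrow> 'r :: comm_ring_1" where
  "res_sign n v = (\<Prod>j<n. if v j mod (2 * (int n + 1)) = int j + 1 then 1 else - 1)"

lemma signed_residues_flip:
  assumes "signed_residues n v" "i < n"
  shows "signed_residues n (v(i := - v i))"
    and "res_sign n (v(i := - v i)) = - (res_sign n v :: 'r :: comm_ring_1)"
proof -
  have *: "(- v i) mod (2 * (int n + 1)) = (if v i mod (2 * (int n + 1)) = int i + 1 then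
      2 * (int n + 1) - (int i + 1) else int i + 1)"
    using signed_mod[OF assms, of "-1"] by auto
  show "signed_residues n (v(i := - v i))"
    using assms(1) * unfolding signed_residues_def by auto
  have p: "(\<Prod>j<n. g j) = g i * (\<Prod>j\<in>{..<n} - {i}. g j)" for g :: "nat \<Rightarrow> 'r"
    using assms(2) by (subst prod.remove[of _ i]) auto
  have "(\<Prod>j\<in>{..<n} - {i}. if (v(i := - v i)) j mod (2 * (int n + 1)) = int j + 1 then 1 else - 1 :: 'r)
      = (\<Prod>j\<in>{..<n} - {i}. if v j mod (2 * (int n + 1)) = int j + 1 then 1 else - 1)"
    by (intro prod.cong) auto
  thus "res_sign n (v(i := - v i)) = - (res_sign n v :: 'r)"
    unfolding res_sign_def p using * assms(2) by auto
qed

context generic_q begin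

definition tt :: "int \<Rightarrow> 'k" where "tt a = q powi (2 * a) + q powi (- 2 * a)"

text \<open>The Weyl denominator at \<open>v\<close>, in the product form of
  \<open>det_odd_powers\<close> with \<open>Y j = q powi v j\<close>.\<close>

definition vdet :: "nat \<Rightarrow> (nat \<Rightarrow> int) \<Rightarrow> 'k" where
  "vdet n v = (\<Prod>j<n. q powi v j - q powi (- v j)) * (\<Prod>j<n. \<Prod>l<j. tt (v j) - tt (v l))"

lemma tt_diff: "tt a - tt b = q powi (- 2 * a) * br (a - b) * br (a + b)"
  using q0 by (simp add: tt_def br_def algebra_simps power_int_add [symmetric])

lemma odd_diff: "q powi a - q powi (- a) = - (q powi (- a)) * br a"
  using q0 by (simp add: br_def algebra_simps power_int_add [symmetric])

lemma vdet_flip: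
  assumes "i < n"
  shows "vdet n (v(i := - v i)) = - vdet n v"
proof -
  have t: "tt ((v(i := - v i)) j) = tt (v j)" for j by (simp add: tt_def)
  have p: "(\<Prod>j<n. g j) = g i * (\<Prod>j\<in>{..<n} - {i}. g j)" for g :: "nat \<Rightarrow> 'k"
    using assms by (subst prod.remove[of _ i]) auto
  have "(\<Prod>j\<in>{..<n} - {i}. q powi (v(i := - v i)) j - q powi (- (v(i := - v i)) j)) =
     (\<Prod>j\<in>{..<n} - {i}. q powi v j - q powi (- v j))"
    by (intro prod.cong) auto
  thus ?thesis
    unfolding vdet_def t p[of "\<lambda>j. q powi v j - q powi (- v j)"]
      p[of "\<lambda>j. q powi (v(i := - v i)) j - q powi (- (v(i := - v i)) j)"]
    by (simp add: algebra_simps)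
qed

lemma vdet_step:
  fixes a :: int and n :: nat and v :: "nat \<Rightarrow> int"
  defines "e \<equiv> int n + 1"
  assumes v: "signed_residues n v" and i: "i < n" "v i = a"
  shows "vdet n v = q powi (2 * (3 * e - 2 * e\<^sup>2)) * (br a / br (a - 2 * e)) *
     (\<Prod>j\<in>{..<n} - {i}. br (a - v j) * br (a + v j) / (br (a - 2 * e - v j) * br (a - 2 * e + v j))) *
     vdet n (v(i := a - 2 * e))"
proof -
  define s where "s = 2 * e"
  let ?J = "{..<n} - {i}"
  have nz: "a - s - \<sigma> * v j \<noteq> 0" if "j \<in> ?J" "\<sigma> \<in> {1, -1}" for j \<sigma>
  proof
    assume "a - s - \<sigma> * v j = 0"
    hence "v i = \<sigma> * v j + 2 * (int n + 1)" using i by (simp add: s_def e_def)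
    hence "(1 * v i) mod (2 * (int n + 1)) = (\<sigma> * v j) mod (2 * (int n + 1))"
      by (simp only: mult_1 mod_add_self2)
    from signed_mod_unique[OF v i(1) _ _ _ this] that show False by auto
  qed
  have nz0: "a - s \<noteq> 0"
  proof
    assume "a - s = 0"
    hence "(1 * v i) mod (2 * (int n + 1)) = 0" using i by (simp add: s_def e_def)
    with signed_mod_neq[OF v i(1), of 1] show False by simp
  qed
  have p: "(\<Prod>j<n. g j) = g i * (\<Prod>j\<in>?J. g j)" for g :: "nat \<Rightarrow> 'k"
    using i by (subst prod.remove[of _ i]) auto
  let ?v' = "v(i := a - s)"
  let ?\<Delta> = "\<lambda>v. \<Prod>j<n. \<Prod>l<j. tt (v j) - tt (v l)"
  have upd: "(\<lambda>j. tt (v j))(i := tt (a - s)) = (\<lambda>j. tt (?v' j))" by auto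
  have A: "?\<Delta> v * (\<Prod>j\<in>?J. tt (a - s) - tt (v j)) = ?\<Delta> ?v' * (\<Prod>j\<in>?J. tt a - tt (v j))"
    using vdet_update[OF i(1), of "\<lambda>j. tt (v j)" "tt (a - s)"] i(2) unfolding upd by simp
  have B: "(\<Prod>j\<in>?J. tt a - tt (v j)) = (\<Prod>j\<in>?J. tt (a - s) - tt (v j)) *
     (\<Prod>j\<in>?J. q powi (- 2 * s) * (br (a - v j) * br (a + v j) / (br (a - s - v j) * br (a - s + v j))))"
  proof -
    have "tt a - tt (v j) = (tt (a - s) - tt (v j)) *
        (q powi (- 2 * s) * (br (a - v j) * br (a + v j) / (br (a - s - v j) * br (a - s + v j))))"
      if "j \<in> ?J" for j
    proof -
      have "a - s - v j \<noteq> 0" "a - s + v j \<noteq> 0" using nz[OF that, of 1] nz[OF that, of "-1"] by simp_all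
      moreover have "q powi (- 2 * a) = q powi (- 2 * (a - s)) * q powi (- 2 * s)"
        using q0 by (simp add: power_int_add [symmetric] algebra_simps)
      ultimately show ?thesis by (simp add: tt_diff)
    qed
    thus ?thesis by (simp add: prod.distrib [symmetric])
  qed
  have C: "(\<Prod>j\<in>?J. tt (a - s) - tt (v j)) \<noteq> 0"
  proof -
    have "tt (a - s) - tt (v j) \<noteq> 0" if "j \<in> ?J" for j
    proof -
      have "a - s - v j \<noteq> 0" "a - s + v j \<noteq> 0" using nz[OF that, of 1] nz[OF that, of "-1"] by simp_all
      thus ?thesis using q0 by (simp add: tt_diff power_int_eq_0_iff)
    qed
    thus ?thesis by simp
  qed
  have \<Delta>: "?\<Delta> v = ?\<Delta> ?v' * (\<Prod>j\<in>?J. q powi (- 2 * s) * (br (a - v j) * br (a + v j) / (br (a - s - v j) * br (a - s + v j))))"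
  proof -
    have "x = y * w" if "x * c = y * d" "d = c * w" "c \<noteq> 0" for x y w c d :: 'k
      using that by simp
    from this[OF A B C] show ?thesis .
  qed
  have O: "(\<Prod>j<n. q powi v j - q powi (- v j)) =
     (q powi (- s) * (br a / br (a - s))) * (\<Prod>j<n. q powi ?v' j - q powi (- ?v' j))"
  proof -
    have "(\<Prod>j\<in>?J. q powi ?v' j - q powi (- ?v' j)) = (\<Prod>j\<in>?J. q powi v j - q powi (- v j))"
      by (intro prod.cong) auto
    moreover have "q powi a - q powi (- a) = (q powi (- s) * (br a / br (a - s))) * (q powi (a - s) - q powi (- (a - s)))"
    proof -
      have "q powi (- a) = q powi (- s) * q powi (- (a - s))"
        using q0 by (simp add: power_int_add [symmetric])
      thus ?thesis unfolding odd_diff[of a] odd_diff[of "a - s"] using nz0 by simp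
    qed
    ultimately show ?thesis unfolding p using i by simp
  qed
  \<comment> \<open>The odd factor of \<open>i\<close> yields \<open>q powi (- s)\<close>, and each
    of the \<open>n - 1\<close> pairs yields \<open>q powi (- 2 * s)\<close>. The total is the power
    of \<open>q\<close> in \<open>wfac_core\<close>.\<close>
  have E: "q powi (- s) * (\<Prod>j\<in>?J. q powi (- 2 * s)) = q powi (2 * (3 * e - 2 * e\<^sup>2))"
  proof -
    have "(\<Prod>j\<in>?J. q powi (- 2 * s)) = q powi (\<Sum>j\<in>?J. - 2 * s)" by (rule power_int_sum)
    also have "(\<Sum>j\<in>?J. - 2 * s) = - 2 * s * (e - 2)"
      using i by (simp add: e_def of_nat_diff)
    finally show ?thesis using q0 
      by (simp add: power_int_add [symmetric] s_def algebra_simps power2_eq_square)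
  qed
  show ?thesis
    unfolding vdet_def \<Delta> O E [symmetric] s_def [symmetric] prod.distrib by (simp only: mult_ac)
qed

text \<open>A largest \<open>\<bar>v j\<bar>\<close> is lowered by a period until all are at most
  \<open>e\<close>; then \<open>v\<close> is \<open>(1, ..., n)\<close> up to signs and the set is
  empty. The second claim expresses the size of the set by squared norms, which is what makes the
  sum over these sets a theta series.\<close>

lemma core_weight:
  fixes n :: nat
  defines "e \<equiv> int n + 1"
  assumes "signed_residues n v"
  shows "vdet n v = res_sign n v * vdet n (\<lambda>j. int j + 1) *
      (q powi (4 * e * int (\<Sum>(core_set n v))) *
        wt (q\<^sup>2) (q powi (- 4 * e)) (\<lambda>y. inverse (1 - q\<^sup>2 ^ y)) (core_set n v)) \<and>
    4 * e * int (\<Sum>(core_set n v)) = (\<Sum>j<n. (v j)\<^sup>2 - (int j + 1)\<^sup>2)"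
  using assms(2)
proof (induction "nat (\<Sum>j<n. \<bar>v j\<bar>)" arbitrary: v rule: less_induct)
  case less
  let ?W = "\<lambda>S. q powi (4 * e * int (\<Sum>S)) * wt (q\<^sup>2) (q powi (- 4 * e)) (\<lambda>y. inverse (1 - q\<^sup>2 ^ y)) S"
  let ?claim = "\<lambda>v. vdet n v = res_sign n v * vdet n (\<lambda>j. int j + 1) * ?W (core_set n v) \<and>
    4 * e * int (\<Sum>(core_set n v)) = (\<Sum>j<n. (v j)\<^sup>2 - (int j + 1)\<^sup>2)"
  have e: "e > 0" by (simp add: e_def)
  show ?case
  proof (cases "\<exists>j<n. \<bar>v j\<bar> > e")
    case False
    hence small: "\<bar>v j\<bar> \<le> e" if "j < n" for j using that by force
    have val: "v j = int j + 1 \<and> v j mod (2 * e) = int j + 1 \<or> v j = - (int j + 1) \<and> v j mod (2 * e) \<noteq> int j + 1" if j: "j < n" for j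
    proof -
      have *: "v j mod (2 * e) = int j + 1 \<or> v j mod (2 * e) = 2 * e - (int j + 1)"
        using less.prems j by (auto simp: signed_residues_def e_def)
      show ?thesis
      proof (cases "v j \<ge> 0")
        case True
        hence "v j mod (2 * e) = v j" using small[OF j] e by simp
        with * small[OF j] j show ?thesis by (auto simp: e_def)
      next
        case False
        hence "v j mod (2 * e) = v j + 2 * e"
        proof -
          have "(v j + 2 * e) mod (2 * e) = v j + 2 * e"
            using False small[OF j] e by (intro mod_pos_pos_trivial) auto
          thus ?thesis by simp
        qed
        with * small[OF j] j False show ?thesis by (auto simp: e_def)
      qed
    qed
    have empty: "core_set n v = {}"
    proof -
      have False if "k \<in> core_set n v" for k
      proof -
        from that obtain j \<sigma> where *: "k > 0" "j < n" "\<sigma> \<in> {1, -1 :: int}" "int k + (int n + 1) \<le> \<sigma> * v j"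
          unfolding core_set_def by blast
        with small[OF *(2)] show False by (auto simp: e_def)
      qed
      thus ?thesis by blast
    qed
    have sq: "(v j)\<^sup>2 = (int j + 1)\<^sup>2" if "j < n" for j using val[OF that] by (metis power2_minus)
    have t: "tt (v j) = tt (int j + 1)" if "j < n" for j using val[OF that] by (auto simp: tt_def add.commute)
    have "(\<Prod>j<n. \<Prod>l<j. tt (v j) - tt (v l)) = (\<Prod>j<n. \<Prod>l<j. tt (int j + 1) - tt (int l + 1))"
      by (intro prod.cong refl) (simp add: t)
    moreover have "(\<Prod>j<n. q powi v j - q powi (- v j)) =
       (\<Prod>j<n. (if v j mod (2 * (int n + 1)) = int j + 1 then 1 else - 1) * (q powi (int j + 1) - q powi (- (int j + 1))))"
    proof (intro prod.cong refl)
      fix j assume "j \<in> {..<n}"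
      hence "v j = int j + 1 \<and> v j mod (2 * e) = int j + 1 \<or> v j = - (int j + 1) \<and> v j mod (2 * e) \<noteq> int j + 1"
        using val by simp
      thus "q powi v j - q powi (- v j) = (if v j mod (2 * (int n + 1)) = int j + 1 then 1 else - 1) *
           (q powi (int j + 1) - q powi (- (int j + 1)))"
        unfolding e_def by (elim disjE conjE) (simp_all only: simp_thms if_True if_False mult_1 mult_minus1 minus_diff_eq minus_minus)
    qed
    ultimately have "vdet n v = res_sign n v * vdet n (\<lambda>j. int j + 1)"
      unfolding vdet_def res_sign_def by (simp add: prod.distrib)
    thus ?thesis using sq by (simp add: empty)
  next
    case True
    then obtain j0 where j0: "j0 < n" "\<bar>v j0\<bar> > e" by blast
    define a where "a = Max ((\<lambda>j. \<bar>v j\<bar>) ` {..<n})"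
    have fin: "finite ((\<lambda>j. \<bar>v j\<bar>) ` {..<n})" "(\<lambda>j. \<bar>v j\<bar>) ` {..<n} \<noteq> {}" using j0 by auto
    from Max_in[OF fin] obtain i where i: "i < n" "\<bar>v i\<bar> = a" unfolding a_def by auto
    have mx: "\<bar>v j\<bar> \<le> a" if "j < n" for j
      unfolding a_def using fin that by (intro Max_ge) auto
    have a: "a > e" using mx[OF j0(1)] j0(2) by simp
    \<comment> \<open>Stated for every \<open>u\<close> with the moduli of \<open>v\<close>: if
      \<open>v i\<close> is negative, the claim is needed at the reflected vector, which the
      induction hypothesis does not cover because its measure is no smaller.\<close>
    have pos: "?claim u" if u: "signed_residues n u" "u i = a" "\<And>j. j < n \<Longrightarrow> \<bar>u j\<bar> = \<bar>v j\<bar>" for u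
    proof -
      let ?u' = "u(i := a - 2 * e)"
      have umx: "\<forall>j<n. \<bar>u j\<bar> \<le> a" using u(3) mx by simp
      note step = core_step[OF u(1) i(1) u(2) a[unfolded e_def] umx, folded e_def]
      have "(\<Sum>j<n. \<bar>?u' j\<bar>) < (\<Sum>j<n. \<bar>u j\<bar>)"
        by (rule sum_strict_mono_ex1) (use i u(2) a e in auto)
      also have "\<dots> = (\<Sum>j<n. \<bar>v j\<bar>)" using u(3) by simp
      finally have "nat (\<Sum>j<n. \<bar>?u' j\<bar>) < nat (\<Sum>j<n. \<bar>v j\<bar>)"
        by (smt (verit) nat_less_iff sum_nonneg abs_ge_zero nat_mono_iff)
      from less.hyps[OF this step(3)]
      have IH: "vdet n ?u' = res_sign n ?u' * vdet n (\<lambda>j. int j + 1) * ?W (core_set n ?u')"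
        "4 * e * int (\<Sum>(core_set n ?u')) = (\<Sum>j<n. (?u' j)\<^sup>2 - (int j + 1)\<^sup>2)" by auto
      let ?m = "nat (a - e)"
      have nin: "?m \<notin> core_set n ?u'" using step(2) by blast
      have sumS: "int (\<Sum>(core_set n u)) = (a - e) + int (\<Sum>(core_set n ?u'))"
      proof -
        have "\<Sum>(core_set n u) = ?m + \<Sum>(core_set n ?u')"
          by (subst step(1)) (rule sum.insert[OF finite_core_set nin])
        thus ?thesis using a by simp
      qed
      have sgn: "res_sign n ?u' = (res_sign n u :: 'k)"
        unfolding res_sign_def using u(2) by (intro prod.cong) (auto simp: e_def)
      have W: "?W (core_set n u) = (q powi (4 * e * (a - e)) * wfac (q\<^sup>2) (q powi (- 4 * e)) (\<lambda>y. inverse (1 - q\<^sup>2 ^ y)) (core_set n u) ?m)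
           * ?W (core_set n ?u')"
      proof -
        have "q powi (4 * e * int (\<Sum>(core_set n u))) = q powi (4 * e * (a - e)) * q powi (4 * e * int (\<Sum>(core_set n ?u')))"
          unfolding sumS using q0 by (simp add: power_int_add [symmetric] algebra_simps)
        moreover have "wt (q\<^sup>2) (q powi (- 4 * e)) (\<lambda>y. inverse (1 - q\<^sup>2 ^ y)) (core_set n u) =
           wfac (q\<^sup>2) (q powi (- 4 * e)) (\<lambda>y. inverse (1 - q\<^sup>2 ^ y)) (core_set n u) ?m *
           wt (q\<^sup>2) (q powi (- 4 * e)) (\<lambda>y. inverse (1 - q\<^sup>2 ^ y)) (core_set n ?u')"
          unfolding step(1) by (rule wt_insert_max) (use finite_core_set step(2) in auto)
        ultimately show ?thesis by (simp only: mult_ac)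
      qed
      note wf = wfac_core[OF u(1) i(1) u(2) a[unfolded e_def] umx, folded e_def]
      have "vdet n u = res_sign n u * vdet n (\<lambda>j. int j + 1) * ?W (core_set n u)"
        unfolding W wf vdet_step[OF u(1) i(1) u(2), folded e_def] IH(1) sgn by (simp only: mult_ac)
      moreover have "4 * e * int (\<Sum>(core_set n u)) = (\<Sum>j<n. (u j)\<^sup>2 - (int j + 1)\<^sup>2)"
      proof -
        have p: "(\<Sum>j<n. g j) = g i + (\<Sum>j\<in>{..<n} - {i}. g j)" for g :: "nat \<Rightarrow> int"
          using i by (subst sum.remove[of _ i]) auto
        have "(\<Sum>j\<in>{..<n} - {i}. (?u' j)\<^sup>2 - (int j + 1)\<^sup>2) = (\<Sum>j\<in>{..<n} - {i}. (u j)\<^sup>2 - (int j + 1)\<^sup>2)"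
          by (intro sum.cong) auto
        hence "(\<Sum>j<n. (u j)\<^sup>2 - (int j + 1)\<^sup>2) = (\<Sum>j<n. (?u' j)\<^sup>2 - (int j + 1)\<^sup>2) + (a\<^sup>2 - (a - 2 * e)\<^sup>2)"
          unfolding p using u(2) by simp
        also have "\<dots> = 4 * e * int (\<Sum>(core_set n u))"
          unfolding IH(2) [symmetric] sumS by (simp add: algebra_simps power2_eq_square)
        finally show ?thesis by simp
      qed
      ultimately show ?thesis by blast
    qed
    show ?thesis
    proof (cases "v i \<ge> 0")
      case True
      thus ?thesis using pos[of v] less.prems i by auto
    next
      case False
      let ?u = "v(i := - v i)"
      have "?claim ?u"
        using pos[of ?u] signed_residues_flip(1)[OF less.prems i(1)] i False by auto
      moreover have "(\<Sum>j<n. (?u j)\<^sup>2 - (int j + 1)\<^sup>2) = (\<Sum>j<n. (v j)\<^sup>2 - (int j + 1)\<^sup>2)"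
        by (intro sum.cong) auto
      ultimately show ?thesis
        unfolding core_set_flip[OF i(1)] vdet_flip[OF i(1)] signed_residues_flip(2)[OF less.prems i(1)] by auto
    qed
  qed
qed

end

section \<open>Hook-free sets and the determinant of theta series\<close>

definition vshift :: "nat \<Rightarrow> (nat \<Rightarrow> int) \<Rightarrow> nat \<Rightarrow> int" where
  "vshift n b j = int j + 1 + 2 * (int n + 1) * b j"

text \<open>For the coordinate \<open>v = j + 1 + 2 * (n + 1) * b\<close> this is
  \<open>(v^2 - (j + 1)^2) / (4 * (n + 1))\<close>, its share in the size formula of
  \<open>core_weight\<close>.\<close>

definition qexp :: "nat \<Rightarrow> nat \<Rightarrow> int \<Rightarrow> nat" where
  "qexp n j b = nat ((int n + 1) * b\<^sup>2 + (int j + 1) * b)"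

lemma qexp_nonneg: "j < n \<Longrightarrow> (int n + 1) * b\<^sup>2 + (int j + 1) * b \<ge> \<bar>b\<bar>"
proof -
  assume j: "j < n"
  have "\<bar>b\<bar> \<le> b\<^sup>2"
  proof (cases "b = 0")
    case False
    hence "\<bar>b\<bar> * 1 \<le> \<bar>b\<bar> * \<bar>b\<bar>" by (intro mult_left_mono) auto
    thus ?thesis by (simp add: power2_eq_square)
  qed auto
  have "- ((int j + 1) * \<bar>b\<bar>) \<le> (int j + 1) * b"
    by (metis abs_ge_minus_self abs_mult abs_of_nonneg minus_le_iff add_nonneg_nonneg of_nat_0_le_iff zero_le_one)
  moreover have "(int n + 1) * \<bar>b\<bar> \<le> (int n + 1) * b\<^sup>2" using \<open>\<bar>b\<bar> \<le> b\<^sup>2\<close> by (intro mult_left_mono) auto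
  moreover have "(int j + 2) * \<bar>b\<bar> \<le> (int n + 1) * \<bar>b\<bar>" using j by (intro mult_right_mono) auto
  ultimately show ?thesis by (simp add: algebra_simps)
qed

lemma int_qexp: "j < n \<Longrightarrow> int (qexp n j b) = (int n + 1) * b\<^sup>2 + (int j + 1) * b"
  using qexp_nonneg[of j n b] by (simp add: qexp_def)

lemma finite_fibres_qexp: "j < n \<Longrightarrow> finite_fibres (qexp n j) I"
  by (rule finite_fibres_int[of _ 0]) (use qexp_nonneg[of j n] in \<open>auto simp: int_qexp\<close>)

lemma vshift_mod: "j < n \<Longrightarrow> vshift n b j mod (2 * (int n + 1)) = int j + 1"
  by (simp add: vshift_def)

lemma signed_residues_vshift: "signed_residues n (vshift n b)"
  unfolding signed_residues_def using vshift_mod by blast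

lemma res_sign_vshift: "res_sign n (vshift n b) = 1"
  unfolding res_sign_def by (rule prod.neutral) (simp add: vshift_mod del: distrib_left_numeral)

definition hook_free :: "nat \<Rightarrow> nat set \<Rightarrow> bool" where
  "hook_free s S \<longleftrightarrow> (\<forall>m\<in>S. \<forall>l\<le>m. hk S m l \<noteq> s)"

text \<open>If \<open>m \<in> S\<close> and \<open>m - s\<close> were a gap, this gap would produce
  the length \<open>s\<close>. So \<open>S\<close> is closed downwards along each residue class, as
  on the abacus of a core.\<close>

lemma hook_free_descend:
  assumes "hook_free s S" "k + s * c \<in> S"
  shows "k \<in> S"
  using assms(2)
proof (induction c)
  case (Suc c)
  show ?case
  proof (cases "k + s * c \<in> S")
    case False
    have "hk S (k + s * Suc c) (k + s * c) = s" using False by (simp add: hk_def)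
    with assms(1) Suc.prems False show ?thesis unfolding hook_free_def by fastforce
  qed (use Suc.IH in auto)
qed auto

lemma hook_free_sum:
  assumes "hook_free s S" "k \<in> S" "m \<in> S"
  shows "k + m \<noteq> s"
proof (cases "k \<le> m")
  case True
  with assms show ?thesis unfolding hook_free_def by (force simp: hk_def)
next
  case False
  hence "hk S k m \<noteq> s" using assms unfolding hook_free_def by auto
  thus ?thesis using assms by (simp add: hk_def)
qed

lemma hook_free_descend_int:
  assumes "hook_free (nat s) S" "s > 0" "K \<in> S" "k \<le> K" "(int K + e) mod s = (int k + e) mod s"
  shows "k \<in> S"
proof -
  have "(int K + e - e) mod s = (int k + e - e) mod s" using assms(5) by (intro mod_diff_cong) auto
  hence "s dvd int K - int k" by (simp add: mod_eq_dvd_iff)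
  then obtain c where c: "int K - int k = s * c" by auto
  hence "c \<ge> 0" using assms(2,4) by (smt (verit) mult_pos_neg of_nat_mono)
  hence "int K = int (k + nat s * nat c)" using c assms(2) by simp
  hence "K = k + nat s * nat c" by (simp only: of_nat_eq_iff)
  with hook_free_descend[OF assms(1)] assms(3) show ?thesis by blast
qed

text \<open>Different coordinates differ by at least a period. If the larger one exceeds
  \<open>e\<close>, it adds an element to its own class; otherwise the smaller one is below
  \<open>- e\<close> and adds one to the opposite class.\<close>

lemma core_set_inj:
  assumes "core_set n (vshift n b) = core_set n (vshift n b')" "j < n"
  shows "b' j \<le> b j"
proof (rule ccontr)
  define e where "e = int n + 1"
  define s where "s = 2 * e"
  have es: "e > 0" "s > 0" by (auto simp: e_def s_def)
  let ?v = "vshift n b j" and ?v' = "vshift n b' j"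
  assume "\<not> b' j \<le> b j"
  hence "s * (b j + 1) \<le> s * b' j" using es by (intro mult_left_mono) auto
  hence lt: "?v + s \<le> ?v'" by (simp add: vshift_def s_def e_def algebra_simps)
  note mem = core_set_mem[OF signed_residues_vshift assms(2)]
  have m: "?v mod (2 * (int n + 1)) = ?v' mod (2 * (int n + 1))" by (simp only: vshift_mod[OF assms(2)])
  have m': "(- ?v) mod (2 * (int n + 1)) = (- ?v') mod (2 * (int n + 1))"
    using m by (metis mod_minus_cong)
  have "?v' \<noteq> e"
    using signed_mod_neq[OF signed_residues_vshift[of n b'] assms(2), of 1]
    by (auto simp: e_def)
  then consider "?v' > e" | "?v' < e" by linarith
  thus False
  proof cases
    case 1
    define k where "k = nat (?v' - e)"
    have k: "int k + (int n + 1) = ?v'" "k > 0" using 1 by (auto simp: k_def e_def)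
    have "k \<in> core_set n (vshift n b')" using mem[of 1 k b'] k by simp
    moreover have "k \<notin> core_set n (vshift n b)" using mem[of 1 k b] k m lt es by simp
    ultimately show False using assms(1) by simp
  next
    case 2
    define k where "k = nat (- ?v - e)"
    have k: "int k + (int n + 1) = - ?v" "k > 0" using 2 lt by (auto simp: k_def e_def s_def)
    have "k \<in> core_set n (vshift n b)" using mem[of "-1" k b] k by simp
    moreover have "k \<notin> core_set n (vshift n b')" using mem[of "-1" k b'] k m' lt es by simp
    ultimately show False using assms(1) by simp
  qed
qed

lemma core_set_surj:
  assumes hf: "hook_free (2 * (n + 1)) S" and fin: "finite S" and S0: "0 \<notin> S"
  obtains b where "b \<in> PiE {..<n} (\<lambda>_. UNIV)" "core_set n (vshift n b) = S"
proof -
  define e where "e = int n + 1"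
  define s where "s = 2 * e"
  have es: "e > 0" "s > 0" by (auto simp: e_def s_def)
  have hf': "hook_free (nat s) S" using hf by (simp add: s_def e_def nat_mult_distrib nat_add_distrib)
  define C where "C \<rho> = {k \<in> S. (int k + e) mod s = \<rho>}" for \<rho>
  have finC: "finite (C \<rho>)" for \<rho> using fin by (simp add: C_def)
  \<comment> \<open>At most one of the classes \<open>j + 1\<close> and \<open>s - (j + 1)\<close>
    is inhabited (see \<open>C1\<close> below), and its maximum fixes the coordinate. The default
    \<open>j + 1\<close> encodes that both are empty.\<close>
  define v where "v j = (if C (int j + 1) \<noteq> {} then int (Max (C (int j + 1))) + e
     else if C (s - (int j + 1)) \<noteq> {} then - (int (Max (C (s - (int j + 1)))) + e) else int j + 1)" for j
  define b where "b = restrict (\<lambda>j. (v j - (int j + 1)) div s) {..<n}"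
  have desc: "k \<in> S" if "K \<in> C \<rho>" "k \<le> K" "(int k + e) mod s = \<rho>" for K k \<rho>
    using hook_free_descend_int[OF hf' es(2), of K k e] that by (auto simp: C_def)
  have vmod: "v j mod s = int j + 1" if j: "j < n" for j
  proof -
    have jm: "(int j + 1) mod s = int j + 1" using j by (simp add: s_def e_def)
    show ?thesis
    proof (cases "C (int j + 1) = {}")
      case False
      hence "Max (C (int j + 1)) \<in> C (int j + 1)" using finC by (intro Max_in) auto
      thus ?thesis using False by (simp add: v_def C_def)
    next
      case True
      show ?thesis
      proof (cases "C (s - (int j + 1)) = {}")
        case False
        hence "Max (C (s - (int j + 1))) \<in> C (s - (int j + 1))" using finC by (intro Max_in) auto
        hence m: "(int (Max (C (s - (int j + 1)))) + e) mod s = s - (int j + 1)" by (simp add: C_def)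
        have "(- (int (Max (C (s - (int j + 1)))) + e)) mod s = s - (s - (int j + 1))"
          using m j by (subst zmod_zminus1_eq_if) (auto simp: s_def e_def)
        thus ?thesis using True False by (simp add: v_def)
      qed (use True jm in \<open>simp add: v_def\<close>)
    qed
  qed
  have vb: "vshift n b j = v j" if j: "j < n" for j
  proof -
    have "v j - (int j + 1) = v j - v j mod s" using vmod[OF j] by simp
    also have "\<dots> = s * (v j div s)" by (simp add: minus_mod_eq_mult_div)
    finally have 1: "v j - (int j + 1) = s * (v j div s)" .
    hence "(v j - (int j + 1)) div s = v j div s" using es by simp
    with 1 show ?thesis using j by (simp add: vshift_def b_def s_def e_def)
  qed
  have mem: "k \<in> core_set n (vshift n b) \<longleftrightarrow> k \<in> S" if k: "k > 0" for k
  proof -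
    define r where "r = (int k + e) mod s"
    have rb: "0 \<le> r" "r < s" using es by (auto simp: r_def)
    have notmem: "k \<notin> core_set n (vshift n b)" if "r \<in> {0, e}"
      using core_set_not_mem[OF signed_residues_vshift[of n b], of k] that unfolding r_def s_def e_def by blast
    consider "r = 0" | "r = e" | "0 < r" "r < e" | "e < r" using rb by linarith
    then show ?thesis
    proof cases
      case 1
      \<comment> \<open>Descending by periods would reach \<open>e\<close>, and
        \<open>e + e = s\<close>.\<close>
      have "k \<notin> S"
      proof
        assume kS: "k \<in> S"
        have em: "(int (nat e) + e) mod s = 0" using es by (simp add: s_def)
        have "nat e \<le> k"
        proof -
          have "s dvd int k + e" using 1 by (auto simp: r_def)
          hence "s \<le> int k + e" using k es by (intro zdvd_imp_le) auto
          thus ?thesis using es by (simp add: s_def)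
        qed
        hence "nat e \<in> S" using desc[of k 0 "nat e"] kS 1 em by (simp add: C_def r_def)
        from hook_free_sum[OF hf' this this] show False using es by (simp add: s_def)
      qed
      thus ?thesis using notmem 1 by simp
    next
      case 2
      have "k \<notin> S"
      proof
        assume kS: "k \<in> S"
        have "(int 0 + e) mod s = e" using es by (simp add: s_def)
        hence "0 \<in> S" using desc[of k e 0] kS 2 by (simp add: C_def r_def)
        thus False using S0 by simp
      qed
      thus ?thesis using notmem 2 by simp
    next
      case 3
      define j where "j = nat (r - 1)"
      have j: "j < n" "r = int j + 1" using 3 by (auto simp: j_def e_def)
      have "k \<in> core_set n (vshift n b) \<longleftrightarrow> int k + e \<le> v j"
        using core_set_mem[OF signed_residues_vshift[of n b] j(1), of 1 k] k vb[OF j(1)] vmod[OF j(1)] j(2)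
        unfolding r_def s_def e_def by (simp only: mult_1 simp_thms insert_iff)
      also have "\<dots> \<longleftrightarrow> k \<in> S"
      proof (cases "C (int j + 1) = {}")
        case True
        hence "k \<notin> S" using j by (auto simp: C_def r_def)
        moreover have "v j < e" using True j(1) es by (auto simp: v_def e_def)
        ultimately show ?thesis by simp
      next
        case False
        hence M: "Max (C (int j + 1)) \<in> C (int j + 1)" using finC by (intro Max_in) auto
        have "int k + e \<le> v j \<longleftrightarrow> k \<le> Max (C (int j + 1))" using False by (simp add: v_def)
        also have "\<dots> \<longleftrightarrow> k \<in> S"
        proof
          assume "k \<in> S"
          hence "k \<in> C (int j + 1)" using j by (simp add: C_def r_def)
          thus "k \<le> Max (C (int j + 1))" using finC by (intro Max_ge) auto
        qed (use desc[OF M] j r_def in auto)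
        finally show ?thesis .
      qed
      finally show ?thesis .
    next
      case 4
      define j where "j = nat (s - r - 1)"
      have j: "j < n" "r = s - (int j + 1)" using 4 rb by (auto simp: j_def e_def s_def)
      have vneg: "(- v j) mod s = s - (int j + 1)"
        using vmod[OF j(1)] j by (subst zmod_zminus1_eq_if) auto
      have "k \<in> core_set n (vshift n b) \<longleftrightarrow> int k + e \<le> - v j"
        using core_set_mem[OF signed_residues_vshift[of n b] j(1), of "-1" k] k vb[OF j(1)] vneg j(2)
        unfolding r_def s_def e_def by (simp only: mult_minus1) simp
      also have "\<dots> \<longleftrightarrow> k \<in> S"
      proof (cases "C (s - (int j + 1)) = {}")
        case True
        hence "k \<notin> S" using j by (auto simp: C_def r_def)
        moreover have "v j \<ge> 0" using True j(1) es by (auto simp: v_def e_def)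
        ultimately show ?thesis using es by simp
      next
        case False
        hence M: "Max (C (s - (int j + 1))) \<in> C (s - (int j + 1))" using finC by (intro Max_in) auto
        \<comment> \<open>The two classes would descend to their least elements
          \<open>e + (j + 1)\<close> and \<open>e - (j + 1)\<close>, whose sum is
          \<open>s\<close>.\<close>
        have C1: "C (int j + 1) = {}"
        proof (rule ccontr)
          assume "C (int j + 1) \<noteq> {}"
          then obtain K where K: "K \<in> C (int j + 1)" by auto
          let ?k0 = "nat (e + (int j + 1))" and ?k1 = "nat (e - (int j + 1))"
          have k01: "int ?k0 = e + (int j + 1)" "int ?k1 = e - (int j + 1)" using j by (auto simp: e_def)
          have m0: "(int ?k0 + e) mod s = int j + 1"
          proof -
            have "int ?k0 + e = (int j + 1) + s" unfolding k01 by (simp add: s_def)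
            moreover have "(int j + 1) mod s = int j + 1" using j(1) by (simp add: s_def e_def)
            ultimately show ?thesis by simp
          qed
          have m1: "(int ?k1 + e) mod s = s - (int j + 1)"
            unfolding k01 using j es by (simp add: s_def e_def)
          have le: "int r \<le> int r'" if "(int r + e) mod s = (int r' + e) mod s" "int r < s" for r r' :: nat
          proof -
            have "(int r + e - e) mod s = (int r' + e - e) mod s" using that(1) by (intro mod_diff_cong) auto
            hence "int r = int r' mod s" using that(2) by simp
            thus ?thesis by (metis mod_less_eq_dividend of_nat_0_le_iff zmod_le_nonneg_dividend)
          qed
          have "?k0 \<in> S" using desc[OF K _ m0] le[of ?k0 K] K m0 j k01 by (simp add: C_def s_def e_def)
          moreover have "?k1 \<in> S" using desc[OF M _ m1] le[of ?k1 "Max (C (s - (int j + 1)))"] M m1 j k01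
            by (simp add: C_def s_def e_def)
          ultimately have "?k0 + ?k1 \<noteq> nat s" by (rule hook_free_sum[OF hf'])
          thus False using k01 es j by (simp add: s_def e_def)
        qed
        have "int k + e \<le> - v j \<longleftrightarrow> k \<le> Max (C (s - (int j + 1)))" using False C1 by (simp add: v_def)
        also have "\<dots> \<longleftrightarrow> k \<in> S"
        proof
          assume "k \<in> S"
          hence "k \<in> C (s - (int j + 1))" using j by (simp add: C_def r_def)
          thus "k \<le> Max (C (s - (int j + 1)))" using finC by (intro Max_ge) auto
        qed (use desc[OF M] j r_def in auto)
        finally show ?thesis .
      qed
      finally show ?thesis .
    qed
  qed
  have "core_set n (vshift n b) = S"
  proof (rule Set.set_eqI)
    fix k show "k \<in> core_set n (vshift n b) \<longleftrightarrow> k \<in> S"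
      using mem[of k] S0 zero_notin_core_set[of n "vshift n b"] by (cases "k = 0") auto
  qed
  moreover have "b \<in> PiE {..<n} (\<lambda>_. UNIV)" by (auto simp: b_def)
  ultimately show ?thesis using that by blast
qed

definition pos_sets :: "nat set set" where "pos_sets = {S. finite S \<and> 0 \<notin> S}"

lemma finite_fibres_pos_sets: "finite_fibres (\<lambda>S. \<Sum>S) pos_sets"
  unfolding finite_fibres_def
proof
  fix N
  have "{S \<in> pos_sets. \<Sum>S \<le> N} \<subseteq> Pow {..N}"
  proof
    fix S assume "S \<in> {S \<in> pos_sets. \<Sum>S \<le> N}"
    hence "finite S" "\<Sum>S \<le> N" by (auto simp: pos_sets_def)
    moreover have "k \<le> \<Sum>S" if "k \<in> S" for k using member_le_sum[OF that, of id] \<open>finite S\<close> by simp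
    ultimately show "S \<in> Pow {..N}" by fastforce
  qed
  thus "finite {S \<in> pos_sets. \<Sum>S \<le> N}" by (rule finite_subset) simp
qed

context generic_q begin

text \<open>The odd theta functions of degree \<open>2 * (n + 1)\<close> in \<open>z\<close>: up to
  normalisation, \<open>z^v - z^-v\<close> goes with the power \<open>v^2 / (4 * (n + 1))\<close> of
  \<open>T\<close>, for \<open>v\<close> congruent to \<open>i + 1\<close>.\<close>

definition Theta :: "nat \<Rightarrow> nat \<Rightarrow> 'k \<Rightarrow> 'k fps" where
  "Theta n i z = gser (qexp n i) (\<lambda>b. z powi (int i + 1 + 2 * (int n + 1) * b) -
     z powi (- (int i + 1 + 2 * (int n + 1) * b))) UNIV"

text \<open>The sum side at \<open>U = q powi (- 4 * (n + 1))\<close>; the power of \<open>q\<close>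
  undoes the factor \<open>U ^ \<Sum>S\<close> contained in \<open>wt\<close>.\<close>

definition Fser :: "nat \<Rightarrow> 'k fps" where
  "Fser n = gser (\<lambda>S. \<Sum>S) (\<lambda>S. q powi (4 * (int n + 1) * int (\<Sum>S)) *
     wt (q\<^sup>2) (q powi (- 4 * (int n + 1))) (\<lambda>y. inverse (1 - q\<^sup>2 ^ y)) S) pos_sets"

lemma wt_zero:
  assumes "finite S" "\<not> hook_free (2 * (n + 1)) S"
  shows "wt (q\<^sup>2) (q powi (- 4 * (int n + 1))) D S = 0"
proof -
  from assms(2) obtain m l where *: "m \<in> S" "l \<le> m" "hk S m l = 2 * (n + 1)"
    unfolding hook_free_def by blast
  have "1 - q powi (- 4 * (int n + 1)) * (q\<^sup>2) ^ (2 * (n + 1)) = 0"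
  proof -
    have "(q\<^sup>2) ^ (2 * (n + 1)) = q powi (4 * (int n + 1))"
      unfolding power_mult [symmetric] by (subst power_int_of_nat [symmetric]) (simp add: algebra_simps)
    thus ?thesis using q0 by (simp add: power_int_add [symmetric])
  qed
  hence "(\<Prod>l=0..m. (1 - q powi (- 4 * (int n + 1)) * (q\<^sup>2) ^ hk S m l) * D (hk S m l)) = 0"
    using * by (intro prod_zero) (auto intro!: bexI[of _ l])
  hence "wfac (q\<^sup>2) (q powi (- 4 * (int n + 1))) D S m = 0" by (simp add: wfac_def)
  thus ?thesis unfolding wt_def using assms(1) *(1) by (intro prod_zero) auto
qed

lemma vdet_rho_nz: "vdet n (\<lambda>j. int j + 1) \<noteq> 0"
proof -
  have "tt (int j + 1) - tt (int l + 1) \<noteq> 0" if "l < j" for j l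
    using that q0 by (simp add: tt_diff power_int_eq_0_iff)
  moreover have "q powi (int j + 1) - q powi (- (int j + 1)) \<noteq> 0" for j
    using q0 unfolding odd_diff by (simp add: power_int_eq_0_iff)
  ultimately show ?thesis by (simp add: vdet_def)
qed

lemma vdet_Fser:
  "fps_const (vdet n (\<lambda>j. int j + 1)) * Fser n =
     gser (\<lambda>b. \<Sum>j<n. qexp n j (b j)) (\<lambda>b. vdet n (vshift n b)) (PiE {..<n} (\<lambda>_. UNIV))"
proof -
  let ?t = "\<lambda>S. q powi (4 * (int n + 1) * int (\<Sum>S)) *
     wt (q\<^sup>2) (q powi (- 4 * (int n + 1))) (\<lambda>y. inverse (1 - q\<^sup>2 ^ y)) S"
  let ?I = "{S \<in> pos_sets. hook_free (2 * (n + 1)) S}"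
  let ?B = "PiE {..<n} (\<lambda>_. UNIV :: int set)"
  have "Fser n = gser (\<lambda>S. \<Sum>S) ?t ?I"
    unfolding Fser_def proof (rule gser_mono_neutral[OF finite_fibres_pos_sets])
    fix S assume "S \<in> pos_sets - ?I"
    hence "finite S" "\<not> hook_free (2 * (n + 1)) S" by (auto simp: pos_sets_def)
    from wt_zero[OF this] show "?t S = 0" by (simp only: mult_zero_right)
  qed auto
  moreover have bij: "bij_betw (\<lambda>b. core_set n (vshift n b)) ?B ?I"
  proof (rule bij_betw_imageI)
    show "inj_on (\<lambda>b. core_set n (vshift n b)) ?B"
    proof (rule inj_onI)
      fix b b' assume *: "b \<in> ?B" "b' \<in> ?B" "core_set n (vshift n b) = core_set n (vshift n b')"
      show "b = b'"
        using core_set_inj[OF *(3)] core_set_inj[OF *(3)[symmetric]]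
        by (intro PiE_ext[OF *(1,2)] antisym) auto
    qed
    \<comment> \<open>Indirect: a hook of length \<open>s\<close> would make the weight vanish, and
      then \<open>vdet\<close> by \<open>core_weight\<close>, but no factor of \<open>vdet\<close>
      is 0 when the signed residues are distinct.\<close>
    have "hook_free (2 * (n + 1)) (core_set n (vshift n b))" for b
    proof (rule ccontr)
      assume "\<not> hook_free (2 * (n + 1)) (core_set n (vshift n b))"
      from wt_zero[OF finite_core_set this] core_weight[OF signed_residues_vshift[of n b]]
      have "vdet n (vshift n b) = 0" by simp
      moreover have "tt (vshift n b j) - tt (vshift n b l) \<noteq> 0" if "l < j" "j < n" for j l
      proof -
        have "vshift n b j \<noteq> \<sigma> * vshift n b l" if "\<sigma> \<in> {1, -1}" for \<sigma>
          using signed_mod_unique[OF signed_residues_vshift[of n b] \<open>j < n\<close>, of 1 l \<sigma>] that \<open>l < j\<close> \<open>j < n\<close> by auto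
        from this[of 1] this[of "-1"] show ?thesis using q0 by (simp add: tt_diff power_int_eq_0_iff)
      qed
      moreover have "q powi vshift n b j - q powi (- vshift n b j) \<noteq> 0" if "j < n" for j
      proof -
        have "vshift n b j \<noteq> 0" using signed_mod_neq[OF signed_residues_vshift[of n b] that, of 1] by auto
        thus ?thesis using q0 unfolding odd_diff by (simp add: power_int_eq_0_iff)
      qed
      ultimately show False by (simp add: vdet_def)
    qed
    thus "(\<lambda>b. core_set n (vshift n b)) ` ?B = ?I"
      using core_set_surj[of n] finite_core_set zero_notin_core_set
      by (auto simp: pos_sets_def image_iff) metis
  qed
  moreover have "gser (\<lambda>S. \<Sum>S) ?t ?I = gser (\<lambda>b. \<Sum>j<n. qexp n j (b j)) (\<lambda>b. ?t (core_set n (vshift n b))) ?B"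
  proof (rule gser_reindex[OF bij])
    fix b
    have "4 * (int n + 1) * int (\<Sum>(core_set n (vshift n b))) = (\<Sum>j<n. (vshift n b j)\<^sup>2 - (int j + 1)\<^sup>2)"
      using core_weight[OF signed_residues_vshift[of n b]] by blast
    also have "\<dots> = (\<Sum>j<n. 4 * (int n + 1) * int (qexp n j (b j)))"
      by (intro sum.cong refl) (simp add: int_qexp vshift_def power2_eq_square algebra_simps)
    also have "\<dots> = 4 * (int n + 1) * int (\<Sum>j<n. qexp n j (b j))"
      by (simp add: sum_distrib_left)
    finally have "4 * (int n + 1) * int (\<Sum>(core_set n (vshift n b))) = 4 * (int n + 1) * int (\<Sum>j<n. qexp n j (b j))" .
    moreover have "4 * (int n + 1) \<noteq> 0" by simp
    ultimately show "(\<Sum>j<n. qexp n j (b j)) = \<Sum>(core_set n (vshift n b))"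
      by (metis mult_left_cancel of_nat_eq_iff)
  qed simp
  ultimately show ?thesis
    using core_weight[OF signed_residues_vshift[of n]]
    by (simp add: gser_cmult res_sign_vshift)
qed

text \<open>Once the sum over permutations is exchanged with that over \<open>b\<close>, each
  \<open>b\<close> contributes a determinant of odd powers of \<open>q powi vshift n b i\<close>.
  The points \<open>q ^ (2 * j + 1)\<close> are chosen so that \<open>det_odd_powers\<close>
  applies.\<close>

lemma det_Theta:
  "det (mat n n (\<lambda>(i, j). Theta n i (q ^ (2 * j + 1)))) = fps_const (vdet n (\<lambda>j. int j + 1)) * Fser n"
proof -
  let ?M = "mat n n (\<lambda>(i, j). Theta n i (q ^ (2 * j + 1)))"
  let ?B = "PiE {..<n} (\<lambda>_. UNIV :: int set)"
  let ?E = "\<lambda>b. \<Sum>j<n. qexp n j (b j)"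
  let ?t = "\<lambda>j v. (q ^ (2 * j + 1)) powi v - (q ^ (2 * j + 1)) powi (- v)"
  have sg: "signof p = (fps_const (signof p) :: 'k fps)" for p
    by (simp add: sign_def)
  have "det ?M = (\<Sum>p | p permutes {0..<n}. signof p * (\<Prod>i = 0..<n. ?M $$ (i, p i)))"
    by (rule det_def') simp
  also have "\<dots> = (\<Sum>p | p permutes {0..<n}. gser ?E (\<lambda>b. signof p * (\<Prod>i<n. ?t (p i) (vshift n b i))) ?B)"
  proof (rule sum.cong[OF refl], goal_cases)
    case (1 p)
    hence p: "p i < n" if "i < n" for i using that permutes_in_image[of p "{0..<n}" i] by auto
    have "(\<Prod>i = 0..<n. ?M $$ (i, p i)) = (\<Prod>i<n. Theta n i (q ^ (2 * p i + 1)))"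
      using p by (intro prod.cong) auto
    also have "\<dots> = gser ?E (\<lambda>b. \<Prod>i<n. ?t (p i) (vshift n b i)) ?B"
      unfolding Theta_def vshift_def
      by (rule conjunct2[OF gser_prod]) (auto intro: finite_fibres_qexp)
    finally show ?case by (subst sg) (simp add: gser_cmult)
  qed
  also have "\<dots> = gser ?E (\<lambda>b. \<Sum>p | p permutes {0..<n}. signof p * (\<Prod>i<n. ?t (p i) (vshift n b i))) ?B"
    by (rule gser_sum)
  also have "\<dots> = gser ?E (\<lambda>b. vdet n (vshift n b)) ?B"
  proof (rule gser_cong[OF refl])
    fix b
    define Y where "Y i = q powi vshift n b i" for i
    have Y: "Y i \<noteq> 0" for i using q0 by (simp add: Y_def power_int_eq_0_iff)
    have t: "?t j (vshift n b i) = Y i ^ (2 * j + 1) - inverse (Y i) ^ (2 * j + 1)" for i j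
    proof -
      have "(q ^ (2 * j + 1)) powi v = (q powi v) ^ (2 * j + 1)" for v :: int
        by (metis power_int_mult power_int_of_nat mult.commute)
      thus ?thesis by (simp add: Y_def power_int_minus power_inverse)
    qed
    have "(\<Sum>p | p permutes {0..<n}. signof p * (\<Prod>i<n. ?t (p i) (vshift n b i))) =
       det (mat n n (\<lambda>(i, j). Y i ^ (2 * j + 1) - inverse (Y i) ^ (2 * j + 1)))"
    proof (subst det_def'[of _ n], simp, rule sum.cong[OF refl], goal_cases)
      case (1 p)
      hence p: "p i < n" if "i < n" for i using that permutes_in_image[of p "{0..<n}" i] by auto
      show ?case unfolding t
        by (intro arg_cong2[where f = "(*)"] refl prod.cong) (use p in auto)
    qed
    also have "\<dots> = vdet n (vshift n b)"
    proof -
      have "(Y j)\<^sup>2 + inverse (Y j) ^ 2 = tt (vshift n b j)" for j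
      proof -
        have "q powi (2 * v) = (q powi v)\<^sup>2" for v
          using power_int_mult[of q v 2] by (simp add: mult.commute)
        from this[of "vshift n b j"] this[of "- vshift n b j"] show ?thesis
          by (simp add: Y_def tt_def power_int_minus)
      qed
      thus ?thesis by (subst det_odd_powers) (auto simp: q0 vdet_def power_int_minus Y_def)
    qed
    finally show "(\<Sum>p | p permutes {0..<n}. signof p * (\<Prod>i<n. ?t (p i) (vshift n b i))) = vdet n (vshift n b)" .
  qed
  finally show ?thesis by (simp add: vdet_Fser)
qed

end

section \<open>The Macdonald identity of type C\<close>

lemma fps_mult_gser_nth:
  assumes "finite_fibres E I"
  shows "fps_nth (A * gser E t I) N = (\<Sum>p | p \<in> I \<and> E p \<le> N. fps_nth A (N - E p) * t p)"
proof -
  have fin: "finite {p. p \<in> I \<and> E p = M}" for M using finite_fibresD[OF assms] by simp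
  have "fps_nth (A * gser E t I) N = (\<Sum>M=0..N. \<Sum>p | p \<in> I \<and> E p = N - M. fps_nth A M * t p)"
    by (simp add: fps_mult_nth gser_nth sum_distrib_left)
  also have "\<dots> = (\<Sum>(M, p)\<in>(SIGMA M:{0..N}. {p. p \<in> I \<and> E p = N - M}). fps_nth A M * t p)"
    by (rule sum.Sigma) (use fin in auto)
  also have "\<dots> = (\<Sum>p | p \<in> I \<and> E p \<le> N. fps_nth A (N - E p) * t p)"
    by (rule sum.reindex_bij_witness[of _ "\<lambda>p. (N - E p, p)" snd]) auto
  finally show ?thesis .
qed

section \<open>Theta series in one variable, their addition formula and their products\<close>

definition tri :: "int \<Rightarrow> nat" where "tri k = nat (k * (k - 1) div 2)"

lemma int_tri: "2 * int (tri k) = k * (k - 1)"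
proof -
  have "even (k * (k - 1))" by auto
  moreover have "k * (k - 1) \<ge> 0"
  proof (cases "k \<ge> 1")
    case False
    thus ?thesis by (intro mult_nonpos_nonpos) auto
  qed simp
  ultimately show ?thesis by (simp add: tri_def)
qed

lemma tri_ge: "\<bar>k\<bar> \<le> int (tri k) + 1"
proof -
  have "0 \<le> (\<bar>k\<bar> - 1) * (\<bar>k\<bar> - 2)"
    by (cases "\<bar>k\<bar> \<ge> 2") (auto intro: mult_nonneg_nonneg mult_nonpos_nonpos)
  hence "3 * \<bar>k\<bar> \<le> k * k + 2" by (simp add: algebra_simps)
  thus ?thesis using int_tri[of k] by (simp add: algebra_simps)
qed

definition sqr :: "int \<Rightarrow> nat" where "sqr k = nat (k * k)"
definition prn :: "int \<Rightarrow> nat" where "prn k = nat (k * (k + 1))"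

lemma int_sqr: "int (sqr k) = k * k" by (simp add: sqr_def)

lemma int_prn: "int (prn k) = k * (k + 1)"
proof -
  have "k * (k + 1) \<ge> 0"
  proof (cases "k \<ge> 0")
    case False
    thus ?thesis by (intro mult_nonpos_nonpos) auto
  qed simp
  thus ?thesis by (simp add: prn_def)
qed

lemma sqr_ge: "\<bar>k\<bar> \<le> int (sqr k) + 1" and prn_ge: "\<bar>k\<bar> \<le> int (prn k) + 1"
proof -
  have "0 \<le> (\<bar>k\<bar> - 1) * (\<bar>k\<bar> - 1)" by simp
  hence *: "2 * \<bar>k\<bar> \<le> k * k + 1" by (simp add: algebra_simps)
  thus "\<bar>k\<bar> \<le> int (sqr k) + 1" by (simp add: int_sqr)
  have "- \<bar>k\<bar> \<le> k" by simp
  with * show "\<bar>k\<bar> \<le> int (prn k) + 1" by (simp add: int_prn algebra_simps)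
qed

lemma finite_fibres_tri: "finite_fibres tri I" by (rule finite_fibres_int[of _ 1]) (use tri_ge in simp)
lemma finite_fibres_sqr: "finite_fibres sqr I" by (rule finite_fibres_int[of _ 1]) (use sqr_ge in simp)
lemma finite_fibres_prn: "finite_fibres prn I" by (rule finite_fibres_int[of _ 1]) (use prn_ge in simp)

definition psgn :: "int \<Rightarrow> int" where "psgn k = (if even k then 1 else - 1)"

text \<open>By the Jacobi triple product (proved later) this is \<open>(1 - y) * (\<Prod>j\<ge>1. (1
  - y * T^j) * (1 - T^j / y) * (1 - T^j))\<close>.\<close>

definition theta :: "'k :: field \<Rightarrow> 'k fps" where
  "theta y = gser tri (\<lambda>k. of_int (psgn k) * y powi k) UNIV"

definition theta_even :: "'k :: field \<Rightarrow> 'k fps" where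
  "theta_even z = gser sqr (\<lambda>p. z powi (2 * p)) UNIV"

text \<open>The factor \<open>T^(1/4)\<close> of the classical series is dropped, so that all
  exponents are natural numbers.\<close>

definition theta_odd :: "'k :: field \<Rightarrow> 'k fps" where
  "theta_odd z = gser prn (\<lambda>p. z powi (2 * p + 1)) UNIV"

text \<open>The pairs of indices are split by the parity of \<open>k + l\<close>. On each half, half
  sum and half difference are independent indices, and the exponents of \<open>T\<close>,
  \<open>z\<close> and \<open>a\<close> separate.\<close>

lemma theta_addition:
  fixes z a :: "'k :: field"
  assumes z: "z \<noteq> 0" and a: "a \<noteq> 0"
  shows "theta (z * a) * theta (z / a) =
     fps_const z * (theta_even a * theta_odd z - theta_even z * theta_odd a)"
proof -
  have zpow: "(z * a) powi A * (z / a) powi B = z powi (A + B) * a powi (A - B)" for A B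
    using z a by (simp add: power_int_mult_distrib power_int_divide_distrib power_int_add power_int_diff)
  let ?E = "\<lambda>(k, l). tri k + tri l"
  let ?t = "\<lambda>(k, l). (of_int (psgn k) * (z * a) powi k) * (of_int (psgn l) * (z / a) powi l)"
  let ?Ev = "{x :: int \<times> int. even (fst x + snd x)}" and ?Od = "{x :: int \<times> int. odd (fst x + snd x)}"
  have ff: "finite_fibres ?E UNIV"
    using finite_fibres_times[OF finite_fibres_tri finite_fibres_tri, of UNIV UNIV] by simp
  have U: "UNIV = ?Ev \<union> ?Od" by auto
  have "theta (z * a) * theta (z / a) = gser ?E ?t UNIV"
    unfolding theta_def by (subst gser_mult) (auto intro: finite_fibres_tri simp: UNIV_Times_UNIV)
  also have "\<dots> = gser ?E ?t ?Ev + gser ?E ?t ?Od"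
    using gser_Un[of ?E ?Ev ?Od ?t] ff U by auto
  also have "gser ?E ?t ?Ev = gser (\<lambda>(q, p). sqr q + prn p) (\<lambda>(q, p). z * (a powi (2 * q) * z powi (2 * p + 1))) (UNIV \<times> UNIV)"
  proof (rule gser_reindex)
    show "bij_betw (\<lambda>(q, p). (p + 1 + q, p + 1 - q)) (UNIV \<times> UNIV) ?Ev"
    proof (rule bij_betw_byWitness[where f' = "\<lambda>(k, l). ((k - l) div 2, (k + l) div 2 - 1)"])
      show "\<forall>x\<in>?Ev. (\<lambda>(q, p). (p + 1 + q, p + 1 - q)) ((\<lambda>(k, l). ((k - l) div 2, (k + l) div 2 - 1)) x) = x"
        by (clarsimp, presburger)
    qed auto
  next
    fix x :: "int \<times> int"
    obtain q p where x: "x = (q, p)" by (cases x)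
    have "2 * int (tri (p + 1 + q) + tri (p + 1 - q)) = 2 * int (sqr q + prn p)"
      by (simp add: int_tri int_sqr int_prn algebra_simps)
    thus "(case x of (q, p) \<Rightarrow> sqr q + prn p) = (case (case x of (q, p) \<Rightarrow> (p + 1 + q, p + 1 - q)) of (k, l) \<Rightarrow> tri k + tri l)"
      using x by simp
    have "psgn (p + 1 + q) * psgn (p + 1 - q) = 1" by (auto simp: psgn_def)
    hence s: "of_int (psgn (p + 1 + q)) * of_int (psgn (p + 1 - q)) = (1 :: 'k)"
      by (metis of_int_1 of_int_mult)
    have "(z * a) powi (p + 1 + q) * (z / a) powi (p + 1 - q) = z powi (p + 1 + q + (p + 1 - q)) * a powi (p + 1 + q - (p + 1 - q))"
      by (rule zpow)
    also have "\<dots> = z * (a powi (2 * q) * z powi (2 * p + 1))"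
      using z power_int_add_1[of z "2 * p + 1"] by (simp add: algebra_simps)
    finally have "(of_int (psgn (p + 1 + q)) * of_int (psgn (p + 1 - q))) * ((z * a) powi (p + 1 + q) * (z / a) powi (p + 1 - q))
         = z * (a powi (2 * q) * z powi (2 * p + 1))" unfolding s by simp
    thus "(case x of (q, p) \<Rightarrow> z * (a powi (2 * q) * z powi (2 * p + 1))) =
        ?t (case x of (q, p) \<Rightarrow> (p + 1 + q, p + 1 - q))"
      using x by (simp add: mult_ac)
  qed
  also have "\<dots> = fps_const z * (theta_even a * theta_odd z)"
    unfolding theta_even_def theta_odd_def
    by (subst gser_mult) (auto intro!: finite_fibres_sqr finite_fibres_prn gser_cong simp: gser_cmult)
  also have "gser ?E ?t ?Od = gser (\<lambda>(p, q). sqr p + prn q) (\<lambda>(p, q). (- z) * (z powi (2 * p) * a powi (2 * q + 1))) (UNIV \<times> UNIV)"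
  proof (rule gser_reindex)
    show "bij_betw (\<lambda>(p, q). (p + q + 1, p - q)) (UNIV \<times> UNIV) ?Od"
    proof (rule bij_betw_byWitness[where f' = "\<lambda>(k, l). ((k + l - 1) div 2, (k - l - 1) div 2)"])
      show "\<forall>x\<in>?Od. (\<lambda>(p, q). (p + q + 1, p - q)) ((\<lambda>(k, l). ((k + l - 1) div 2, (k - l - 1) div 2)) x) = x"
        by (clarsimp, presburger)
    qed auto
  next
    fix x :: "int \<times> int"
    obtain p q where x: "x = (p, q)" by (cases x)
    have "2 * int (tri (p + q + 1) + tri (p - q)) = 2 * int (sqr p + prn q)"
      by (simp add: int_tri int_sqr int_prn algebra_simps)
    thus "(case x of (p, q) \<Rightarrow> sqr p + prn q) = (case (case x of (p, q) \<Rightarrow> (p + q + 1, p - q)) of (k, l) \<Rightarrow> tri k + tri l)"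
      using x by simp
    have "psgn (p + q + 1) * psgn (p - q) = -1" by (auto simp: psgn_def)
    hence s: "of_int (psgn (p + q + 1)) * of_int (psgn (p - q)) = (- 1 :: 'k)"
      by (metis of_int_1 of_int_minus of_int_mult)
    have "(z * a) powi (p + q + 1) * (z / a) powi (p - q) = z powi (p + q + 1 + (p - q)) * a powi (p + q + 1 - (p - q))"
      by (rule zpow)
    also have "\<dots> = z * (z powi (2 * p) * a powi (2 * q + 1))"
      using z power_int_add_1[of z "2 * p"] by (simp add: algebra_simps)
    finally have "(of_int (psgn (p + q + 1)) * of_int (psgn (p - q))) * ((z * a) powi (p + q + 1) * (z / a) powi (p - q))
         = - z * (z powi (2 * p) * a powi (2 * q + 1))" unfolding s by simp
    thus "(case x of (p, q) \<Rightarrow> - z * (z powi (2 * p) * a powi (2 * q + 1))) =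
        ?t (case x of (p, q) \<Rightarrow> (p + q + 1, p - q))"
      using x by (simp add: mult_ac)
  qed
  also have "\<dots> = - (fps_const z * (theta_even z * theta_odd a))"
  proof -
    have "fps_const (- z) * (theta_even z * theta_odd a) = gser (\<lambda>(p, q). sqr p + prn q) (\<lambda>(p, q). (- z) * (z powi (2 * p) * a powi (2 * q + 1))) (UNIV \<times> UNIV)"
      unfolding theta_even_def theta_odd_def
      by (subst gser_mult) (auto intro!: finite_fibres_sqr finite_fibres_prn gser_cong simp: gser_cmult)
    thus ?thesis by (simp add: fps_const_neg [symmetric] del: fps_const_neg)
  qed
  finally show ?thesis by (simp add: algebra_simps)
qed

text \<open>The index \<open>0\<close> carries \<open>z\<^sup>-\<^sup>1 \<theta>(z\<^sup>2)\<close>, the indices \<open>1, \<dots>, a\<close> the odd and the remaining ones the even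
  theta series.\<close>

definition pexp :: "nat \<Rightarrow> nat \<Rightarrow> int \<Rightarrow> nat" where
  "pexp a j k = (if j = 0 then tri k else if j \<le> a then prn k else sqr k)"

definition pwgt :: "nat \<Rightarrow> nat \<Rightarrow> int \<Rightarrow> int" where
  "pwgt a j k = (if j = 0 then 2 * k - 1 else if j \<le> a then 2 * k + 1 else 2 * k)"

text \<open>The coefficient of \<open>z powi k * T^N\<close> in the product of one series of index
  0, \<open>a\<close> odd and \<open>n - 1 - a\<close> even ones; an integer, hence free of
  \<open>q\<close>. Letting \<open>N\<close> be an integer allows shifts without case
  distinctions.\<close>

definition pcoeff :: "nat \<Rightarrow> nat \<Rightarrow> int \<Rightarrow> int \<Rightarrow> int" where
  "pcoeff n a k N = (\<Sum>l | l \<in> PiE {..<n} (\<lambda>_. UNIV) \<and> (\<Sum>j<n. pwgt a j (l j)) = k \<and>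
     (\<Sum>j<n. int (pexp a j (l j))) = N. psgn (l 0))"

lemma finite_fibres_pexp: "finite_fibres (pexp a j) I"
proof -
  have "pexp a j = (if j = 0 then tri else if j \<le> a then prn else sqr)"
    by (auto simp: pexp_def fun_eq_iff)
  thus ?thesis by (simp add: finite_fibres_tri finite_fibres_prn finite_fibres_sqr)
qed

lemma pcoeff_neg_exp: "N < 0 \<Longrightarrow> pcoeff n a k N = 0"
proof -
  assume N: "N < 0"
  have "(\<Sum>j<n. int (pexp a j (l j))) \<ge> 0" for l by (intro sum_nonneg) auto
  hence "(\<Sum>j<n. int (pexp a j (l j))) \<noteq> N" for l using N by (metis not_le)
  thus ?thesis by (simp add: pcoeff_def)
qed

text \<open>Quasi-periodicity in terms of coefficients: index 0 is shifted by 2, which preserves its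
  sign, and the others by 1. The shifts add up to \<open>n + 1\<close>, and the weights double
  them.\<close>

lemma pcoeff_shift:
  assumes n: "n > 0"
  shows "pcoeff n a (k + 2 * (int n + 1)) (N + k + (int n + 1)) = pcoeff n a k N"
proof -
  define d where "d j = (if j = 0 then 2 else 1 :: int)" for j :: nat
  have W: "pwgt a j (x + d j) = pwgt a j x + 2 * d j" for j x
    by (simp add: pwgt_def d_def)
  have E: "int (pexp a j (x + d j)) = int (pexp a j x) + pwgt a j x + d j" for j x
    using int_tri[of "x + 2"] int_tri[of x]
    by (simp add: pexp_def pwgt_def d_def int_prn int_sqr algebra_simps)
  have D: "(\<Sum>j<n. d j) = int n + 1"
  proof -
    obtain n' where "n = Suc n'" using n by (cases n) auto
    thus ?thesis by (simp add: d_def sum.lessThan_Suc_shift del: sum.lessThan_Suc)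
  qed
  have W': "(\<Sum>j<n. pwgt a j (l j + d j)) = (\<Sum>j<n. pwgt a j (l j)) + 2 * (int n + 1)" for l
    by (simp add: W sum.distrib D sum_distrib_left [symmetric] del: distrib_left_numeral)
  have E': "(\<Sum>j<n. int (pexp a j (l j + d j))) = (\<Sum>j<n. int (pexp a j (l j))) + (\<Sum>j<n. pwgt a j (l j)) + (int n + 1)" for l
    by (simp add: E sum.distrib D)
  have c: "(\<Sum>j<n. h j (restrict g {..<n} j)) = (\<Sum>j<n. h j (g j))" for h :: "nat \<Rightarrow> int \<Rightarrow> int" and g
    by (intro sum.cong) auto
  have P: "psgn (x + 2) = psgn x" "psgn (x - 2) = psgn x" for x by (simp_all add: psgn_def)
  show ?thesis unfolding pcoeff_def
  proof (rule sum.reindex_bij_witness[of _ "\<lambda>l. restrict (\<lambda>j. l j + d j) {..<n}" "\<lambda>l. restrict (\<lambda>j. l j - d j) {..<n}"], goal_cases)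
    case (1 l)
    thus ?case by (auto simp: PiE_def extensional_def fun_eq_iff)
  next
    case (2 l)
    have "(\<Sum>j<n. pwgt a j (l j)) = (\<Sum>j<n. pwgt a j (l j - d j)) + 2 * (int n + 1)"
      "(\<Sum>j<n. int (pexp a j (l j))) = (\<Sum>j<n. int (pexp a j (l j - d j))) + (\<Sum>j<n. pwgt a j (l j - d j)) + (int n + 1)"
      using W'[of "\<lambda>j. l j - d j"] E'[of "\<lambda>j. l j - d j"] by simp_all
    with 2 show ?case by (auto simp: c)
  next
    case (3 l)
    thus ?case by (auto simp: PiE_def extensional_def fun_eq_iff)
  next
    case (4 l)
    thus ?case using W'[of l] E'[of l] by (auto simp: c)
  next
    case (5 l)
    thus ?case using n by (simp add: d_def P)
  qed
qed

text \<open>Oddness under inversion of \<open>z\<close>: the reflections \<open>1 - l\<close>,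
  \<open>- 1 - l\<close> and \<open>- l\<close> preserve the exponents of the three kinds of series,
  and the first one reverses the sign.\<close>

lemma pcoeff_neg:
  assumes n: "n > 0"
  shows "pcoeff n a (- k) N = - pcoeff n a k N"
proof -
  define d where "d j = (if j = 0 then 1 else if j \<le> a then - 1 else 0 :: int)" for j :: nat
  have W: "pwgt a j (d j - x) = - pwgt a j x" for j x
    by (simp add: pwgt_def d_def)
  have E: "pexp a j (d j - x) = pexp a j x" for j x
    by (simp add: pexp_def d_def tri_def prn_def sqr_def algebra_simps)
  have c: "(\<Sum>j<n. h j (restrict g {..<n} j)) = (\<Sum>j<n. h j (g j))" for h :: "nat \<Rightarrow> int \<Rightarrow> int" and g
    by (intro sum.cong) auto
  have P: "psgn (1 - x) = - psgn x" for x by (simp add: psgn_def)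
  show ?thesis unfolding pcoeff_def sum_negf [symmetric]
  proof (rule sum.reindex_bij_witness[of _ "\<lambda>l. restrict (\<lambda>j. d j - l j) {..<n}" "\<lambda>l. restrict (\<lambda>j. d j - l j) {..<n}"], goal_cases)
    case (1 l)
    thus ?case by (auto simp: PiE_def extensional_def fun_eq_iff)
  next
    case (2 l)
    thus ?case by (auto simp: c W E sum_negf)
  next
    case (3 l)
    thus ?case by (auto simp: PiE_def extensional_def fun_eq_iff)
  next
    case (4 l)
    thus ?case by (auto simp: c W E sum_negf)
  next
    case (5 l)
    thus ?case using n by (simp add: d_def P)
  qed
qed

lemma pcoeff_iter:
  assumes n: "n > 0"
  shows "pcoeff n a (k + 2 * (int n + 1) * m) (N + k * m + (int n + 1) * m\<^sup>2) = pcoeff n a k N"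
proof (induction m rule: int_induct[where k = 0])
  case (step1 i)
  have "k + 2 * (int n + 1) * (i + 1) = (k + 2 * (int n + 1) * i) + 2 * (int n + 1)"
     "N + k * (i + 1) + (int n + 1) * (i + 1)\<^sup>2 = (N + k * i + (int n + 1) * i\<^sup>2) + (k + 2 * (int n + 1) * i) + (int n + 1)"
    by (simp_all add: algebra_simps power2_eq_square)
  with step1 show ?case by (simp only: pcoeff_shift[OF n])
next
  case (step2 i)
  have "k + 2 * (int n + 1) * i = (k + 2 * (int n + 1) * (i - 1)) + 2 * (int n + 1)"
     "N + k * i + (int n + 1) * i\<^sup>2 = (N + k * (i - 1) + (int n + 1) * (i - 1)\<^sup>2) + (k + 2 * (int n + 1) * (i - 1)) + (int n + 1)"
    by (simp_all add: algebra_simps power2_eq_square)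
  with step2 show ?case by (simp only: pcoeff_shift[OF n])
qed simp

text \<open>Reflection maps the classes of 0 and \<open>n + 1\<close> to themselves, so there a
  coefficient equals its negative. Up to sign, the classes \<open>1, ..., n\<close> remain, one for
  each \<open>Theta n i\<close>.\<close>

lemma pcoeff_walls:
  assumes n: "n > 0" and k: "k mod (2 * (int n + 1)) \<in> {0, int n + 1}"
  shows "pcoeff n a k N = 0"
proof -
  define r where "r = k mod (2 * (int n + 1))"
  define m where "m = k div (2 * (int n + 1))"
  have kr: "k = r + 2 * (int n + 1) * m" by (simp add: r_def m_def)
  have "pcoeff n a r M = 0" for M
  proof -
    consider "r = 0" | "r = int n + 1" using k unfolding r_def by blast
    then show ?thesis
    proof cases
      case 1
      thus ?thesis using pcoeff_neg[OF n, of a 0 M] by simp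
    next
      case 2
      have "pcoeff n a (- (int n + 1) + 2 * (int n + 1)) (M + - (int n + 1) + (int n + 1)) = pcoeff n a (- (int n + 1)) M"
        by (rule pcoeff_shift[OF n])
      moreover have "- (int n + 1) + 2 * (int n + 1) = int n + 1" "M + - (int n + 1) + (int n + 1) = M" by simp_all
      ultimately have "pcoeff n a (int n + 1) M = - pcoeff n a (int n + 1) M"
        by (simp only: pcoeff_neg[OF n])
      thus ?thesis using 2 by simp
    qed
  qed
  hence "pcoeff n a r (N - r * m - (int n + 1) * m\<^sup>2) = 0" .
  with pcoeff_iter[OF n, of a r m "N - r * m - (int n + 1) * m\<^sup>2"] show ?thesis
    unfolding kr [symmetric] by simp
qed

context generic_q begin

text \<open>By \<open>pcoeff_iter\<close>, \<open>pcoeff_neg\<close> and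
  \<open>pcoeff_walls\<close>, the coefficients at \<open>k = 1, ..., n\<close> determine all
  others. The comparison is made at one power of \<open>T\<close>, where finitely many exponents of
  \<open>z\<close> matter.\<close>

lemma theta_product_expand:
  assumes n: "n > 0" and z: "z \<noteq> 0"
  shows "(\<Prod>j<n. gser (pexp a j) (\<lambda>k. (if j = 0 then of_int (psgn k) else 1) * z powi pwgt a j k) UNIV) =
    (\<Sum>i<n. Abs_fps (\<lambda>N. of_int (pcoeff n a (int i + 1) (int N))) * Theta n i z)"
proof (rule fps_ext)
  fix N
  define e where "e = int n + 1"
  have e: "e > 0" by (simp add: e_def)
  let ?B = "PiE {..<n} (\<lambda>_. UNIV :: int set)"
  define w where "w l = (\<Sum>j<n. pwgt a j (l j))" for l
  let ?E = "\<lambda>l. \<Sum>j<n. pexp a j (l j)"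
  define c :: "int \<Rightarrow> 'k" where "c k = of_int (pcoeff n a k (int N))" for k
  have cneg: "c (- k) = - c k" for k unfolding c_def pcoeff_neg[OF n] by simp
  define X where "X = (SIGMA i:{..<n}. {m. qexp n i m \<le> N})"
  define \<kappa> where "\<kappa> = (\<lambda>(i :: nat, m). int i + 1 + 2 * e * m)"
  \<comment> \<open>The exponents in the classes \<open>1, ..., n\<close> that can occur at
    \<open>T ^ N\<close>; by \<open>supp\<close>, these and their negatives carry all nonzero
    coefficients.\<close>
  define A where "A = \<kappa> ` X"
  have finX: "finite X"
    unfolding X_def using finite_fibres_qexp[where I = UNIV] by (auto simp: finite_fibres_def)
  have \<kappa>mod: "\<kappa> (i, m) mod (2 * e) = int i + 1" if "i < n" for i m
    using that by (simp add: \<kappa>_def e_def)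
  have inj: "inj_on \<kappa> X"
  proof (rule inj_onI)
    fix x y assume "x \<in> X" "y \<in> X" "\<kappa> x = \<kappa> y"
    moreover obtain i m i' m' where "x = (i, m)" "y = (i', m')" by (cases x; cases y)
    ultimately have *: "i < n" "i' < n" "\<kappa> (i, m) = \<kappa> (i', m')" by (auto simp: X_def)
    hence "i = i'" using \<kappa>mod[of i m] \<kappa>mod[of i' m'] by simp
    with * e show "x = y" unfolding \<open>x = (i, m)\<close> \<open>y = (i', m')\<close> by (simp add: \<kappa>_def)
  qed
  have finA: "finite A" using finX by (simp add: A_def)
  have Amod: "0 < k mod (2 * e) \<and> k mod (2 * e) < e" if k: "k \<in> A" for k
  proof -
    obtain i m where im: "(i, m) \<in> X" "k = \<kappa> (i, m)" using k unfolding A_def by auto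
    hence "i < n" by (simp add: X_def)
    thus ?thesis using \<kappa>mod[of i m] im by (simp add: e_def)
  qed
  have supp1: "k \<in> A" if "c k \<noteq> 0" "k mod (2 * e) < e" for k
  proof -
    have "k mod (2 * e) \<noteq> 0" using that(1) pcoeff_walls[OF n, of k a "int N"] by (auto simp: c_def e_def)
    moreover have "k mod (2 * e) \<ge> 0" using e by simp
    ultimately have r: "k mod (2 * e) > 0" by linarith
    define i where "i = nat (k mod (2 * e) - 1)"
    define m where "m = k div (2 * e)"
    have i: "i < n" "int i + 1 = k mod (2 * e)" using r that(2) by (auto simp: i_def e_def)
    have k: "k = int i + 1 + 2 * (int n + 1) * m"
      unfolding i(2) m_def by (simp add: e_def)
    have "pcoeff n a k (int N) = pcoeff n a (int i + 1) (int N - int (qexp n i m))"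
      using pcoeff_iter[OF n, of a "int i + 1" m "int N - int (qexp n i m)"]
      unfolding k [symmetric] int_qexp[OF i(1)] by (simp add: algebra_simps)
    hence "pcoeff n a (int i + 1) (int N - int (qexp n i m)) \<noteq> 0" using that(1) by (auto simp: c_def)
    hence "\<not> int N - int (qexp n i m) < 0" using pcoeff_neg_exp by blast
    hence "(i, m) \<in> X" using i by (simp add: X_def)
    thus ?thesis unfolding A_def by (rule rev_image_eqI) (simp add: \<kappa>_def k e_def)
  qed
  have supp: "k \<in> A \<union> uminus ` A" if "c k \<noteq> 0" for k
  proof (cases "k mod (2 * e) < e")
    case False
    have ne: "k mod (2 * e) \<noteq> e" using that pcoeff_walls[OF n, of k a "int N"] by (auto simp: c_def e_def)
    have "(- k) mod (2 * e) = 2 * e - k mod (2 * e)"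
      using False e by (subst zmod_zminus1_eq_if) auto
    hence "(- k) mod (2 * e) < e" using False ne by linarith
    moreover have "c (- k) \<noteq> 0" using that cneg by simp
    ultimately have "- k \<in> A" by (intro supp1)
    thus ?thesis by force
  qed (use supp1[OF that] in auto)
  have disj: "A \<inter> uminus ` A = {}"
  proof (rule ccontr)
    assume "A \<inter> uminus ` A \<noteq> {}"
    then obtain k where k: "k \<in> A" "- k \<in> A" by force
    have "(- k) mod (2 * e) = 2 * e - k mod (2 * e)"
      using Amod[OF k(1)] by (subst zmod_zminus1_eq_if) auto
    with Amod[OF k(1)] Amod[OF k(2)] show False by linarith
  qed
  have gp: "finite_fibres ?E ?B" "(\<Prod>j<n. gser (pexp a j) (\<lambda>k. (if j = 0 then of_int (psgn k) else 1) * z powi pwgt a j k) UNIV)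
     = gser ?E (\<lambda>l. \<Prod>j<n. (if j = 0 then of_int (psgn (l j)) else 1) * z powi pwgt a j (l j)) ?B"
    using gser_prod[of "{..<n}" "pexp a" "\<lambda>_. UNIV" "\<lambda>j k. (if j = 0 then of_int (psgn k) else 1) * z powi pwgt a j k"]
      finite_fibres_pexp by auto
  define L where "L = {l. l \<in> ?B \<and> ?E l = N}"
  have finL: "finite L" using finite_fibresD[OF gp(1)] by (simp add: L_def)
  have t: "(\<Prod>j<n. (if j = 0 then of_int (psgn (l j)) else 1) * z powi pwgt a j (l j)) = of_int (psgn (l 0)) * z powi w l" for l
  proof -
    have "(\<Prod>j<n. (if j = 0 then of_int (psgn (l j)) else (1 :: 'k))) = of_int (psgn (l 0))"
      using n by (simp add: prod.delta)
    moreover have "(\<Prod>j\<in>J. z powi f j) = z powi (\<Sum>j\<in>J. f j)" for J :: "nat set" and f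
      using z by (induction J rule: infinite_finite_induct) (auto simp: power_int_add)
    ultimately show ?thesis by (simp add: prod.distrib w_def)
  qed
  have "fps_nth (\<Prod>j<n. gser (pexp a j) (\<lambda>k. (if j = 0 then of_int (psgn k) else 1) * z powi pwgt a j k) UNIV) N
     = (\<Sum>l\<in>L. of_int (psgn (l 0)) * z powi w l)"
    unfolding gp(2) t gser_nth L_def ..
  also have "\<dots> = (\<Sum>k\<in>w ` L. \<Sum>l | l \<in> L \<and> w l = k. of_int (psgn (l 0)) * z powi w l)"
    using sum.group[OF finL finite_imageI[OF finL] order_refl, where g = w and h = "\<lambda>l. of_int (psgn (l 0)) * z powi w l"] by simp
  also have "\<dots> = (\<Sum>k\<in>w ` L. c k * z powi k)"
  proof (rule sum.cong[OF refl])
    fix k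
    have "{l. l \<in> L \<and> w l = k} = {l. l \<in> ?B \<and> (\<Sum>j<n. pwgt a j (l j)) = k \<and> (\<Sum>j<n. int (pexp a j (l j))) = int N}"
      unfolding L_def w_def of_nat_sum [symmetric] of_nat_eq_iff by auto
    hence "c k = (\<Sum>l | l \<in> L \<and> w l = k. of_int (psgn (l 0)))"
      unfolding c_def pcoeff_def by simp
    thus "(\<Sum>l | l \<in> L \<and> w l = k. of_int (psgn (l 0)) * z powi w l) = c k * z powi k"
      by (simp add: sum_distrib_right)
  qed
  also have "\<dots> = (\<Sum>k\<in>w ` L \<union> (A \<union> uminus ` A). c k * z powi k)"
  proof (rule sum.mono_neutral_left)
    have "c k = 0" if "k \<notin> w ` L" for k
    proof -
      have "{l. l \<in> ?B \<and> (\<Sum>j<n. pwgt a j (l j)) = k \<and> (\<Sum>j<n. int (pexp a j (l j))) = int N} = {}"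
        using that unfolding L_def w_def of_nat_sum [symmetric] of_nat_eq_iff by auto
      thus ?thesis unfolding c_def pcoeff_def by (simp only: sum.empty of_int_0)
    qed
    thus "\<forall>k\<in>w ` L \<union> (A \<union> uminus ` A) - w ` L. c k * z powi k = 0" by simp
  qed (use finL finA in auto)
  also have "\<dots> = (\<Sum>k\<in>A \<union> uminus ` A. c k * z powi k)"
    by (rule sum.mono_neutral_right) (use finL finA supp in auto)
  also have "\<dots> = (\<Sum>k\<in>A. c k * z powi k) + (\<Sum>k\<in>uminus ` A. c k * z powi k)"
    by (rule sum.union_disjoint) (use finA disj in auto)
  also have "(\<Sum>k\<in>uminus ` A. c k * z powi k) = (\<Sum>k\<in>A. - (c k * z powi (- k)))"
    by (subst sum.reindex) (auto simp: cneg)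
  also have "(\<Sum>k\<in>A. c k * z powi k) + (\<Sum>k\<in>A. - (c k * z powi (- k))) = (\<Sum>k\<in>A. c k * (z powi k - z powi (- k)))"
    by (simp add: sum.distrib [symmetric] algebra_simps)
  also have "\<dots> = (\<Sum>(i, m)\<in>X. c (\<kappa> (i, m)) * (z powi \<kappa> (i, m) - z powi (- \<kappa> (i, m))))"
    unfolding A_def by (subst sum.reindex[OF inj]) (simp add: case_prod_unfold)
  also have "\<dots> = (\<Sum>i<n. \<Sum>m | qexp n i m \<le> N. c (\<kappa> (i, m)) * (z powi \<kappa> (i, m) - z powi (- \<kappa> (i, m))))"
    unfolding X_def using finite_fibres_qexp[where I = UNIV]
    by (intro sum.Sigma[symmetric]) (auto simp: finite_fibres_def)
  also have "\<dots> = (\<Sum>i<n. fps_nth (Abs_fps (\<lambda>N. of_int (pcoeff n a (int i + 1) (int N))) * Theta n i z) N)"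
  proof (rule sum.cong[OF refl])
    fix i assume "i \<in> {..<n}"
    hence i: "i < n" by simp
    have "c (\<kappa> (i, m)) = of_int (pcoeff n a (int i + 1) (int (N - qexp n i m)))" if "qexp n i m \<le> N" for m
    proof -
      have "int (N - qexp n i m) + (int i + 1) * m + (int n + 1) * m\<^sup>2 = int N"
        using that int_qexp[OF i, of m] by (simp add: of_nat_diff algebra_simps)
      with pcoeff_iter[OF n, of a "int i + 1" m "int (N - qexp n i m)"] show ?thesis
        by (simp add: c_def \<kappa>_def e_def)
    qed
    thus "(\<Sum>m | qexp n i m \<le> N. c (\<kappa> (i, m)) * (z powi \<kappa> (i, m) - z powi (- \<kappa> (i, m)))) =
       fps_nth (Abs_fps (\<lambda>N. of_int (pcoeff n a (int i + 1) (int N))) * Theta n i z) N"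
      unfolding Theta_def fps_mult_gser_nth[OF finite_fibres_qexp[OF i]]
      by (simp add: \<kappa>_def e_def)
  qed
  finally show "fps_nth (\<Prod>j<n. gser (pexp a j) (\<lambda>k. (if j = 0 then of_int (psgn k) else 1) * z powi pwgt a j k) UNIV) N =
    fps_nth (\<Sum>i<n. Abs_fps (\<lambda>N. of_int (pcoeff n a (int i + 1) (int N))) * Theta n i z) N"
    by (simp add: fps_sum_nth)
qed

lemma theta_product_eq:
  assumes n: "n > 0" and a: "a < n" and z: "z \<noteq> 0"
  shows "(\<Prod>j<n. gser (pexp a j) (\<lambda>k. (if j = 0 then of_int (psgn k) else 1) * z powi pwgt a j k) UNIV) =
    fps_const (inverse z) * theta (z\<^sup>2) * theta_even z ^ (n - 1 - a) * theta_odd z ^ a"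
proof -
  have set: "{..<n} = insert 0 ({1..a} \<union> {a<..<n})" using a by auto
  let ?g = "\<lambda>j. gser (pexp a j) (\<lambda>k. (if j = 0 then of_int (psgn k) else 1) * z powi pwgt a j k) UNIV"
  have "(\<Prod>j<n. ?g j) = ?g 0 * ((\<Prod>j=1..a. ?g j) * (\<Prod>j\<in>{a<..<n}. ?g j))"
    unfolding set by (subst prod.insert, simp, simp, subst prod.union_disjoint) auto
  also have "(\<Prod>j=1..a. ?g j) = (\<Prod>j=1..a. theta_odd z)"
    by (intro prod.cong) (auto simp: theta_odd_def pexp_def pwgt_def fun_eq_iff intro!: gser_cong)
  also have "(\<Prod>j\<in>{a<..<n}. ?g j) = (\<Prod>j\<in>{a<..<n}. theta_even z)"
    by (intro prod.cong) (auto simp: theta_even_def pexp_def pwgt_def fun_eq_iff intro!: gser_cong)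
  also have "?g 0 = fps_const (inverse z) * theta (z\<^sup>2)"
    unfolding theta_def gser_cmult
  proof (rule gser_cong)
    fix k :: int
    have "z powi (2 * k - 1) = inverse z * (z\<^sup>2) powi k"
      using z power_int_mult[of z 2 k] power_int_diff[of z "2 * k" 1] by (simp add: field_simps)
    thus "(if (0::nat) = 0 then of_int (psgn k) else 1) * z powi pwgt a 0 k = inverse z * (of_int (psgn k) * (z\<^sup>2) powi k)"
      by (simp add: pwgt_def)
  qed (simp add: pexp_def)
  finally show ?thesis by (simp add: mult_ac)
qed

definition Mdet :: "nat \<Rightarrow> 'k fps" where
  "Mdet n = det (mat n n (\<lambda>(a, i). Abs_fps (\<lambda>N. of_int (pcoeff n a (int i + 1) (int N)))))"

lemma theta_even_0: "fps_nth (theta_even z) 0 = 1"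
proof -
  have "sqr p = 0 \<longleftrightarrow> p = 0" for p
    unfolding of_nat_eq_0_iff[where 'a = int, symmetric] int_sqr by simp
  hence "{p. sqr p = 0} = {0}" by auto
  thus ?thesis by (simp add: theta_even_def gser_nth)
qed

lemma macdonald_identity_C:
  assumes n: "n > 0"
  shows "Mdet n * (fps_const (vdet n (\<lambda>j. int j + 1)) * Fser n) =
    (\<Prod>j<n. fps_const (inverse (q ^ (2 * j + 1))) * theta (q ^ (2 * (2 * j + 1)))) *
    (\<Prod>j<n. \<Prod>l<j. fps_const (inverse (q ^ (2 * j + 1))) * (theta (q ^ (2 * (j + l + 1))) * theta (q ^ (2 * (j - l)))))"
proof -
  \<comment> \<open>Squares, products and quotients of these points are powers of
    \<open>q\<^sup>2\<close>, with the exponents \<open>2 * j + 1\<close>, \<open>j + l + 1\<close>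
    and \<open>j - l\<close>: the heights of the positive roots of type C.\<close>
  define z where "z j = q ^ (2 * j + 1)" for j :: nat
  have z: "z j \<noteq> 0" for j using q0 by (simp add: z_def)
  let ?M = "mat n n (\<lambda>(a, i). Abs_fps (\<lambda>N. of_int (pcoeff n a (int i + 1) (int N)))) :: 'k fps mat"
  let ?Th = "mat n n (\<lambda>(i, j). Theta n i (z j))"
  define c where "c j = fps_const (inverse (z j)) * theta ((z j)\<^sup>2)" for j
  define f where "f j = theta_even (z j)" for j
  \<comment> \<open>\<open>theta_even\<close> has constant coefficient 1, so it can be divided by,
    as \<open>det_vandermonde_hom\<close> requires.\<close>
  define h where "h j = theta_odd (z j) * inverse (f j)" for j
  have fh: "f j * h j = theta_odd (z j)" for j
  proof -
    have "inverse (f j) * f j = 1" by (rule inverse_mult_eq_1) (simp add: f_def theta_even_0)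
    thus ?thesis by (simp add: h_def mult.left_commute mult.commute)
  qed
  have "transpose_mat (mat n n (\<lambda>(i, j). c i * f i ^ (n - 1 - j) * (f i * h i) ^ j)) = ?M * ?Th"
  proof (rule eq_matI)
    fix a j assume "a < dim_row (?M * ?Th)" "j < dim_col (?M * ?Th)"
    hence aj: "a < n" "j < n" by auto
    have "(?M * ?Th) $$ (a, j) = (\<Sum>i<n. Abs_fps (\<lambda>N. of_int (pcoeff n a (int i + 1) (int N))) * Theta n i (z j))"
      using aj by (simp add: scalar_prod_def lessThan_atLeast0)
    also have "\<dots> = c j * f j ^ (n - 1 - a) * (f j * h j) ^ a"
      unfolding theta_product_expand[OF n z, symmetric] theta_product_eq[OF n aj(1) z] fh by (simp only: c_def f_def)
    finally show "transpose_mat (mat n n (\<lambda>(i, j). c i * f i ^ (n - 1 - j) * (f i * h i) ^ j)) $$ (a, j) = (?M * ?Th) $$ (a, j)"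
      using aj by simp
  qed auto
  hence "det (transpose_mat (mat n n (\<lambda>(i, j). c i * f i ^ (n - 1 - j) * (f i * h i) ^ j))) = det ?M * det ?Th"
    by (simp add: det_mult[of _ n])
  hence "det (mat n n (\<lambda>(i, j). c i * f i ^ (n - 1 - j) * (f i * h i) ^ j)) = det ?M * det ?Th"
    by (subst (asm) det_transpose[of _ n]) auto
  hence "(\<Prod>i<n. c i) * (\<Prod>j<n. \<Prod>l<j. f l * (f j * h j) - f j * (f l * h l)) = Mdet n * det ?Th"
    unfolding det_vandermonde_hom Mdet_def .
  moreover have "f l * (f j * h j) - f j * (f l * h l) =
     fps_const (inverse (z j)) * (theta (q ^ (2 * (j + l + 1))) * theta (q ^ (2 * (j - l))))" if "l < j" for j l
  proof -
    have "z j * z l = q ^ (2 * (j + l + 1))" "z j / z l = q ^ (2 * (j - l))"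
      using that q0 by (simp_all add: z_def power_add [symmetric] power_diff [symmetric] algebra_simps)
    moreover have "theta (z j * z l) * theta (z j / z l) = fps_const (z j) * (f l * (f j * h j) - f j * (f l * h l))"
      unfolding fh by (simp only: f_def theta_addition[OF z z])
    ultimately have "theta (q ^ (2 * (j + l + 1))) * theta (q ^ (2 * (j - l))) =
       fps_const (z j) * (f l * (f j * h j) - f j * (f l * h l))"
      by (simp only:)
    moreover have "fps_const (inverse (z j)) * (fps_const (z j) * y) = y" for y
      using z by (simp add: mult.assoc [symmetric])
    ultimately show ?thesis by metis
  qed
  moreover have "c j = fps_const (inverse (q ^ (2 * j + 1))) * theta (q ^ (2 * (2 * j + 1)))" for j
    by (simp only: c_def z_def power_mult [symmetric] mult.commute)
  moreover have "det ?Th = fps_const (vdet n (\<lambda>j. int j + 1)) * Fser n"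
    unfolding z_def by (rule det_Theta)
  ultimately show ?thesis unfolding z_def by simp
qed

end

section \<open>The Jacobi triple product and logarithmic derivatives\<close>

text \<open>The simproc turns equations between series that are polynomials into equations of type \<open>poly\<close>,
  where the rules on coefficients of series no longer apply.\<close>

declare [[simproc del: poly_fps_eq]]

definition qfact :: "nat \<Rightarrow> 'k :: field fps" where
  "qfact k = (\<Prod>m=1..k. 1 - fps_X ^ m)"

text \<open>Gaussian binomial coefficients with base \<open>fps_X\<close>, defined by a Pascal rule
  so that no division is involved.\<close>

fun qbinom :: "nat \<Rightarrow> nat \<Rightarrow> 'k :: field fps" where
  "qbinom n 0 = 1"
| "qbinom 0 (Suc k) = 0"
| "qbinom (Suc n) (Suc k) = qbinom n (Suc k) + fps_X ^ (n - k) * qbinom n k"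

lemma qbinom_gt: "n < k \<Longrightarrow> qbinom n k = 0"
  by (induction n k rule: qbinom.induct) auto

lemma qbinom_self: "qbinom n n = 1"
  by (induction n) (simp_all add: qbinom_gt)

lemma qfact_Suc: "qfact (Suc k) = qfact k * (1 - fps_X ^ Suc k)"
  by (simp add: qfact_def)

lemma qbinom_qfact: "k \<le> n \<Longrightarrow> qbinom n k * qfact k * qfact (n - k) = (qfact n :: 'k :: field fps)"
proof (induction n k rule: qbinom.induct)
  case (3 n k)
  show ?case
  proof (cases "k = n")
    case True
    thus ?thesis by (simp add: qbinom_self qbinom_gt qfact_def)
  next
    case False
    hence "k < n" using 3 by simp
    then obtain d where d: "n = k + Suc d" by (metis less_iff_Suc_add add_Suc_right)
    have 1: "qbinom n (Suc k) * qfact (Suc k) * qfact d = (qfact n :: 'k fps)" using 3(1) d by simp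
    have 2: "qbinom n k * qfact k * qfact (Suc d) = (qfact n :: 'k fps)" using 3(2) d by simp
    have "qbinom (Suc n) (Suc k) * qfact (Suc k) * qfact (Suc n - Suc k) =
       (qbinom n (Suc k) * qfact (Suc k) * qfact d) * (1 - fps_X ^ Suc d) +
       fps_X ^ Suc d * (1 - fps_X ^ Suc k) * (qbinom n k * qfact k * qfact (Suc d) :: 'k fps)"
      by (simp add: d qfact_Suc algebra_simps)
    also have "\<dots> = qfact n * (1 - fps_X ^ Suc d * fps_X ^ Suc k)"
      unfolding 1 2 by (simp add: algebra_simps)
    also have "fps_X ^ Suc d * fps_X ^ Suc k = (fps_X ^ Suc n :: 'k fps)"
      by (simp add: d power_add)
    finally show ?thesis by (simp add: qfact_Suc)
  qed
qed (auto simp: qfact_def)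

lemma choose2_Suc: "Suc k * k div 2 = k * (k - 1) div 2 + k"
proof -
  have "Suc k * k = k * (k - 1) + k * 2" by (cases k) (auto simp: algebra_simps)
  thus ?thesis by simp
qed

text \<open>Homogeneous in \<open>A\<close> and \<open>B\<close>, since it is applied with
  \<open>A = fps_X ^ M\<close>, which has no inverse.\<close>

lemma q_binomial_theorem:
  fixes A B :: "'k :: field fps"
  shows "(\<Prod>m<n. A - fps_X ^ m * B) =
    (\<Sum>k\<le>n. (- 1) ^ k * fps_X ^ (k * (k - 1) div 2) * qbinom n k * B ^ k * A ^ (n - k))"
proof (induction n)
  case (Suc n)
  let ?t = "\<lambda>n k. (- 1) ^ k * fps_X ^ (k * (k - 1) div 2) * qbinom n k * B ^ k * A ^ (n - k)"
  have s: "?t (Suc n) (Suc k) = (if k < n then A * ?t n (Suc k) else 0) - fps_X ^ n * B * ?t n k" if k: "k \<le> n" for k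
  proof -
    have e: "fps_X ^ (Suc k * k div 2) * fps_X ^ (n - k) = (fps_X ^ (k * (k - 1) div 2) * fps_X ^ n :: 'k fps)"
      unfolding power_add [symmetric] choose2_Suc using k by simp
    have "(- 1) ^ Suc k * fps_X ^ (Suc k * k div 2) * (fps_X ^ (n - k) * qbinom n k) * B ^ Suc k * A ^ (n - k) =
        - ((fps_X ^ (Suc k * k div 2) * fps_X ^ (n - k)) * ((- 1) ^ k * qbinom n k * B ^ Suc k * A ^ (n - k)))"
      by (simp add: mult_ac)
    also have "\<dots> = - (fps_X ^ n * B * ?t n k)" unfolding e by (simp add: mult_ac)
    finally have 2: "(- 1) ^ Suc k * fps_X ^ (Suc k * k div 2) * (fps_X ^ (n - k) * qbinom n k) * B ^ Suc k * A ^ (n - k) =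
      - (fps_X ^ n * B * ?t n k)" .
    have 1: "(- 1) ^ Suc k * fps_X ^ (Suc k * k div 2) * qbinom n (Suc k) * B ^ Suc k * A ^ (n - k) =
       (if k < n then A * ?t n (Suc k) else 0)"
    proof (cases "k < n")
      case True
      hence "A ^ (n - k) = A * A ^ (n - Suc k)" by (metis Suc_diff_Suc power_Suc)
      thus ?thesis using True by (simp add: mult_ac)
    next
      case False
      hence "n < Suc k" by simp
      thus ?thesis using False by (simp add: qbinom_gt)
    qed
    have "?t (Suc n) (Suc k) = (- 1) ^ Suc k * fps_X ^ (Suc k * k div 2) * qbinom n (Suc k) * B ^ Suc k * A ^ (n - k)
      + (- 1) ^ Suc k * fps_X ^ (Suc k * k div 2) * (fps_X ^ (n - k) * qbinom n k) * B ^ Suc k * A ^ (n - k)"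
      by (simp only: qbinom.simps diff_Suc_1 diff_Suc_Suc) (simp only: distrib_left distrib_right mult.assoc)
    thus ?thesis unfolding 1 2 by simp
  qed
  have "(\<Sum>k\<le>Suc n. ?t (Suc n) k) = A * ?t n 0 + (\<Sum>k\<le>n. ?t (Suc n) (Suc k))"
    by (subst sum.atMost_Suc_shift) simp
  also have "(\<Sum>k\<le>n. ?t (Suc n) (Suc k)) = (\<Sum>k\<le>n. if k < n then A * ?t n (Suc k) else 0) - fps_X ^ n * B * (\<Sum>k\<le>n. ?t n k)"
    unfolding sum_distrib_left sum_subtractf [symmetric] by (rule sum.cong) (use s in auto)
  also have "(\<Sum>k\<le>n. if k < n then A * ?t n (Suc k) else 0) = (\<Sum>k<n. A * ?t n (Suc k))"
    by (subst sum.inter_filter [symmetric]) (auto intro!: sum.cong)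
  also have "A * ?t n 0 + ((\<Sum>k<n. A * ?t n (Suc k)) - fps_X ^ n * B * (\<Sum>k\<le>n. ?t n k)) =
     A * (\<Sum>k\<le>n. ?t n k) - fps_X ^ n * B * (\<Sum>k\<le>n. ?t n k)"
    by (simp only: sum.atMost_shift sum_distrib_left distrib_left) (simp only: algebra_simps)
  finally show ?case using Suc.IH by (simp add: algebra_simps)
qed auto

text \<open>\<open>T\<^sup>M - T\<^sup>m z\<close> for \<open>m \<le> 2 M\<close> are, up to units and powers of \<open>T\<close>, the factors of the product side.\<close>

lemma finite_triple_product:
  fixes z :: "'k :: field"
  assumes z: "z \<noteq> 0"
  shows "(1 - fps_const z) * (\<Prod>j=1..M. (1 - fps_const z * fps_X ^ j) * (1 - fps_const (inverse z) * fps_X ^ j)) =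
    (\<Sum>l\<in>{- int M..int M + 1}. fps_const (of_int (psgn l) * z powi l) * fps_X ^ tri l * qbinom (2 * M + 1) (nat (int M + l)))"
proof -
  \<comment> \<open>The power of \<open>T\<close> to be cancelled: \<open>m\<close> from each factor
    with \<open>m < M\<close>, and \<open>M\<close> from each of the other \<open>M + 1\<close>
    factors.\<close>
  define C where "C = (\<Sum>m<M. m) + M * (M + 1)"
  have C2: "2 * C = 3 * M * M + M"
  proof -
    have "2 * (\<Sum>m<M. m) + M = M * M" by (induction M) auto
    thus ?thesis by (simp add: C_def algebra_simps)
  qed
  let ?z = "fps_const z"
  have "(\<Prod>m<2 * M + 1. fps_X ^ M - fps_X ^ m * ?z) =
    (\<Prod>m<M. fps_X ^ M - fps_X ^ m * ?z) * (\<Prod>m=M..<2 * M + 1. fps_X ^ M - fps_X ^ m * ?z)"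
    unfolding lessThan_atLeast0 by (rule prod.atLeastLessThan_concat [symmetric]) auto
  also have "(\<Prod>m<M. fps_X ^ M - fps_X ^ m * ?z) = (\<Prod>m<M. fps_X ^ m * (- ?z * (1 - fps_const (inverse z) * fps_X ^ (M - m))))"
  proof (rule prod.cong[OF refl])
    fix m assume "m \<in> {..<M}"
    hence "fps_X ^ M = (fps_X ^ m * fps_X ^ (M - m) :: 'k fps)" by (simp add: power_add [symmetric])
    moreover have "?z * fps_const (inverse z) = 1" using z by simp
    moreover have "p - a * b = a * (- b * (1 - c * d))" if "p = a * d" "b * c = 1" for a b c d p :: "'k fps"
    proof -
      have "a * (- b * (1 - c * d)) = a * d * (b * c) - a * b" by (simp add: algebra_simps)
      with that show ?thesis by simp
    qed
    ultimately show "fps_X ^ M - fps_X ^ m * ?z = fps_X ^ m * (- ?z * (1 - fps_const (inverse z) * fps_X ^ (M - m)))"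
      by blast
  qed
  also have "\<dots> = fps_X ^ (\<Sum>m<M. m) * (- ?z) ^ M * (\<Prod>m<M. 1 - fps_const (inverse z) * fps_X ^ (M - m))"
    by (simp add: prod.distrib power_sum mult_ac)
  also have "(\<Prod>m<M. 1 - fps_const (inverse z) * fps_X ^ (M - m)) = (\<Prod>j=1..M. 1 - fps_const (inverse z) * fps_X ^ j)"
    by (rule prod.reindex_bij_witness[of _ "\<lambda>j. M - j" "\<lambda>m. M - m"]) auto
  also have "(\<Prod>m=M..<2 * M + 1. fps_X ^ M - fps_X ^ m * ?z) = (\<Prod>j=0..M. fps_X ^ M * (1 - ?z * fps_X ^ j))"
    by (rule prod.reindex_bij_witness[of _ "\<lambda>j. M + j" "\<lambda>m. m - M"])
       (auto simp: algebra_simps power_add [symmetric])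
  also have "\<dots> = fps_X ^ (M * (M + 1)) * ((1 - ?z) * (\<Prod>j=1..M. 1 - ?z * fps_X ^ j))"
  proof -
    have "(\<Prod>j=0..M. 1 - ?z * fps_X ^ j) = (1 - ?z) * (\<Prod>j=1..M. 1 - ?z * fps_X ^ j)"
      by (subst prod.atLeast_Suc_atMost) auto
    moreover have "(\<Prod>j=0..M. fps_X ^ M :: 'k fps) = fps_X ^ (M * (M + 1))"
      by (simp add: power_mult [symmetric] power_add)
    ultimately show ?thesis unfolding prod.distrib by (simp only:)
  qed
  finally have L: "(\<Prod>m<2 * M + 1. fps_X ^ M - fps_X ^ m * ?z) = fps_X ^ C * (- ?z) ^ M *
     ((1 - ?z) * (\<Prod>j=1..M. (1 - ?z * fps_X ^ j) * (1 - fps_const (inverse z) * fps_X ^ j)))"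
    by (simp only: C_def power_add prod.distrib mult_ac)
  have R: "(\<Prod>m<2 * M + 1. fps_X ^ M - fps_X ^ m * ?z) = fps_X ^ C * (- ?z) ^ M *
    (\<Sum>l\<in>{- int M..int M + 1}. fps_const (of_int (psgn l) * z powi l) * fps_X ^ tri l * qbinom (2 * M + 1) (nat (int M + l)))"
    unfolding q_binomial_theorem sum_distrib_left
  proof (rule sum.reindex_bij_witness[of _ "\<lambda>l. nat (int M + l)" "\<lambda>k. int k - int M"])
    fix k assume k: "k \<in> {..2 * M + 1}"
    define l where "l = int k - int M"
    have kl: "nat (int M + l) = k" by (simp add: l_def)
    have ex: "k * (k - 1) div 2 + M * (2 * M + 1 - k) = C + tri l"
    proof -
      have "int (2 * (k * (k - 1) div 2)) = int k * (int k - 1)"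
        by (cases k) (auto simp: algebra_simps)
      moreover have "int (M * (2 * M + 1 - k)) = int M * (2 * int M + 1 - int k)"
        using k by (simp add: of_nat_diff)
      moreover have "2 * int (a + b) = int (2 * a) + 2 * int b" for a b by simp
      ultimately have "2 * int (k * (k - 1) div 2 + M * (2 * M + 1 - k)) = int k * (int k - 1) + 2 * (int M * (2 * int M + 1 - int k))"
        by metis
      also have "\<dots> = int (2 * C) + 2 * int (tri l)"
        unfolding C2 int_tri by (simp add: l_def algebra_simps)
      finally have fin: "2 * int (k * (k - 1) div 2 + M * (2 * M + 1 - k)) = int (2 * C) + 2 * int (tri l)" .
      have gen: "x = c + t" if "2 * int x = int (2 * c) + 2 * int t" for x c t
        using that by simp
      show ?thesis by (rule gen[OF fin])
    qed
    have sg: "(- 1) ^ k * ?z ^ k = (- ?z) ^ M * fps_const (of_int (psgn l) * z powi l)"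
    proof -
      have "(- z) ^ k = (- z) ^ M * (- z) powi l"
      proof -
        have "(- z) powi (int M + l) = (- z) powi int M * (- z) powi l"
          using z by (intro power_int_add) simp
        thus ?thesis by (simp add: l_def)
      qed
      moreover have "(- z) powi l = of_int (psgn l) * z powi l"
        by (simp add: psgn_def power_int_minus_left)
      ultimately have "(- z) ^ k = (- z) ^ M * (of_int (psgn l) * z powi l)" by simp
      hence "(- ?z) ^ k = (- ?z) ^ M * fps_const (of_int (psgn l) * z powi l)"
        by (simp add: fps_const_power)
      moreover have "(- 1) ^ k * ?z ^ k = (- ?z) ^ k"
        unfolding power_mult_distrib [symmetric] by simp
      ultimately show ?thesis by (simp only:)
    qed
    have "(- 1) ^ k * fps_X ^ (k * (k - 1) div 2) * qbinom (2 * M + 1) k * ?z ^ k * (fps_X ^ M) ^ (2 * M + 1 - k) =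
      ((- 1) ^ k * ?z ^ k) * fps_X ^ (k * (k - 1) div 2 + M * (2 * M + 1 - k)) * qbinom (2 * M + 1) k"
      by (simp only: power_add power_mult mult_ac)
    also have "\<dots> = fps_X ^ C * (- ?z) ^ M * (fps_const (of_int (psgn l) * z powi l) * fps_X ^ tri l * qbinom (2 * M + 1) (nat (int M + l)))"
      unfolding sg ex kl by (simp only: power_add mult_ac)
    finally show "fps_X ^ C * (- ?z) ^ M * (fps_const (of_int (psgn (int k - int M)) * z powi (int k - int M)) *
        fps_X ^ tri (int k - int M) * qbinom (2 * M + 1) (nat (int M + (int k - int M)))) =
      (- 1) ^ k * fps_X ^ (k * (k - 1) div 2) * qbinom (2 * M + 1) k * ?z ^ k * (fps_X ^ M) ^ (2 * M + 1 - k)"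
      unfolding l_def by (rule sym)
  qed auto
  have nz: "fps_X ^ C * (- ?z) ^ M \<noteq> 0" using z by simp
  show ?thesis by (rule mult_left_cancel[OF nz, THEN iffD1]) (rule trans[OF L[symmetric] R])
qed

definition agree :: "nat \<Rightarrow> 'k :: comm_ring_1 fps \<Rightarrow> 'k fps \<Rightarrow> bool" where
  "agree K f g \<longleftrightarrow> (\<forall>i\<le>K. fps_nth f i = fps_nth g i)"

lemma agree_mult: "agree K f g \<Longrightarrow> agree K f' g' \<Longrightarrow> agree K (f * f') (g * g')"
  by (auto simp: agree_def fps_mult_nth)

lemma agree_refl [simp]: "agree K f f" by (simp add: agree_def)

lemma agree_trans: "agree K f g \<Longrightarrow> agree K g h \<Longrightarrow> agree K f h" by (simp add: agree_def)
lemma agree_sym: "agree K f g \<Longrightarrow> agree K g f" by (simp add: agree_def)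

lemma qfact_agree: "K \<le> j \<Longrightarrow> agree K (qfact j) (qfact K)"
proof (induction j rule: dec_induct)
  case (step j)
  have "agree K (1 - fps_X ^ Suc j) (1 :: 'a fps)"
    using step by (auto simp: agree_def)
  from agree_mult[OF step.IH this] show ?case by (simp add: qfact_Suc)
qed simp

lemma qfact_0: "fps_nth (qfact k) 0 = 1"
  by (induction k) (simp_all add: qfact_def)

text \<open>The product is \<open>qfact M * qfact (2 * M + 1)\<close> over the \<open>qfact\<close>
  of \<open>M + l\<close> and of \<open>M + 1 - l\<close>. All four indices are at least
  \<open>K\<close>, so up to order \<open>K\<close> all four series agree with
  \<open>qfact K\<close> and cancel.\<close>

lemma qbinom_agree:
  assumes "nat \<bar>l\<bar> \<le> M" "- int M \<le> l" "l \<le> int M + 1" "K = M - nat \<bar>l\<bar>"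
  shows "agree K (qfact M * qbinom (2 * M + 1) (nat (int M + l))) (1 :: 'k :: field fps)"
proof -
  define a where "a = nat (int M + l)"
  define b where "b = 2 * M + 1 - a"
  have "int a = int M + l" using assms(2) by (simp add: a_def)
  moreover have "int K = int M - \<bar>l\<bar>" using assms(1,4) by (simp add: of_nat_diff)
  moreover from calculation have "int b = 2 * int M + 1 - int a" using assms(3) by (simp add: b_def of_nat_diff)
  ultimately have ab: "K \<le> a" "K \<le> b" "a \<le> 2 * M + 1" using assms(3) by linarith+
  let ?f = "qfact M * qbinom (2 * M + 1) a :: 'k fps"
  let ?u = "qfact K * qfact K :: 'k fps"
  have "?f * (qfact a * qfact b) = qfact M * qfact (2 * M + 1)"
    using qbinom_qfact[OF ab(3), where 'k = 'k] by (simp add: b_def mult_ac)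
  moreover have "agree K (?f * ?u) (?f * (qfact a * qfact b))"
    using ab by (intro agree_mult agree_refl agree_sym[OF qfact_agree]) auto
  moreover have "agree K (qfact M * qfact (2 * M + 1)) ?u"
    using assms(4) by (intro agree_mult qfact_agree) auto
  ultimately have "agree K (?f * ?u) ?u" by (metis agree_trans)
  hence "agree K (?f * ?u * inverse ?u) (?u * inverse ?u)"
    by (rule agree_mult[OF _ agree_refl])
  moreover have "?u * inverse ?u = 1"
    using inverse_mult_eq_1[of ?u] by (simp add: qfact_0 mult.commute)
  ultimately show ?thesis by (simp add: mult.assoc a_def)
qed

definition triple_prod :: "'k :: field \<Rightarrow> nat \<Rightarrow> 'k fps" where
  "triple_prod z M = (1 - fps_const z) * (\<Prod>j=1..M. (1 - fps_const z * fps_X ^ j) *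
     (1 - fps_const (inverse z) * fps_X ^ j) * (1 - fps_X ^ j))"

text \<open>The term of index \<open>l\<close> starts at \<open>T ^ tri l\<close>, and its cofactor
  is 1 up to order \<open>M - \<bar>l\<bar>\<close>. As
  \<open>\<bar>l\<bar> \<le> tri l + 1\<close>, this reaches the order \<open>N - tri l\<close>
  whenever \<open>N < M\<close>, so finite products suffice.\<close>

lemma jacobi_triple_product:
  fixes z :: "'k :: field"
  assumes z: "z \<noteq> 0" and N: "N < M"
  shows "fps_nth (theta z) N = fps_nth (triple_prod z M) N"
proof -
  let ?I = "{- int M..int M + 1}"
  let ?t = "\<lambda>l. of_int (psgn l) * z powi l"
  have "triple_prod z M = qfact M * ((1 - fps_const z) * (\<Prod>j=1..M. (1 - fps_const z * fps_X ^ j) * (1 - fps_const (inverse z) * fps_X ^ j)))"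
    by (simp add: triple_prod_def qfact_def prod.distrib mult_ac)
  also have "\<dots> = (\<Sum>l\<in>?I. fps_const (?t l) * (fps_X ^ tri l * (qfact M * qbinom (2 * M + 1) (nat (int M + l)))))"
    unfolding finite_triple_product[OF z] sum_distrib_left by (simp only: mult_ac)
  finally have "fps_nth (triple_prod z M) N =
     (\<Sum>l\<in>?I. ?t l * (if N < tri l then 0 else fps_nth (qfact M * qbinom (2 * M + 1) (nat (int M + l))) (N - tri l)))"
    by (simp only: fps_sum_nth fps_mult_left_const_nth fps_X_power_mult_nth)
  also have "\<dots> = (\<Sum>l\<in>?I. if tri l = N then ?t l else 0)"
  proof (rule sum.cong[OF refl])
    fix l assume l: "l \<in> ?I"
    show "?t l * (if N < tri l then 0 else fps_nth (qfact M * qbinom (2 * M + 1) (nat (int M + l))) (N - tri l)) =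
        (if tri l = N then ?t l else 0)"
    proof (cases "N < tri l")
      case False
      have le: "\<bar>l\<bar> \<le> int (tri l) + 1" by (rule tri_ge)
      hence b: "nat \<bar>l\<bar> \<le> M" "N - tri l \<le> M - nat \<bar>l\<bar>" using False N by linarith+
      from qbinom_agree[OF b(1) _ _ refl, where 'k = 'k] l b(2)
      have "fps_nth (qfact M * qbinom (2 * M + 1) (nat (int M + l))) (N - tri l) = fps_nth (1 :: 'k fps) (N - tri l)"
        unfolding agree_def by auto
      thus ?thesis using False by auto
    qed auto
  qed
  also have "\<dots> = (\<Sum>l | l \<in> ?I \<and> tri l = N. ?t l)"
    by (subst sum.inter_filter) auto
  also have "{l. l \<in> ?I \<and> tri l = N} = {l. l \<in> UNIV \<and> tri l = N}"
  proof -
    have "l \<in> ?I" if "tri l = N" for l using tri_ge[of l] that N by auto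
    thus ?thesis by auto
  qed
  finally show ?thesis by (simp add: theta_def gser_nth)
qed

text \<open>\<open>T\<close> times the logarithmic derivative of
  \<open>\<Prod>j\<ge>1. (1 - c * T^j)\<close>.\<close>

definition Lsum :: "'k :: field \<Rightarrow> 'k fps" where
  "Lsum c = Abs_fps (\<lambda>N. if N = 0 then 0 else - (\<Sum>d | d dvd N. of_nat (N div d) * c ^ d))"

text \<open>The logarithmic derivative \<open>g = T f' / f\<close>, stated multiplicatively since \<open>f\<close> need not be a unit.\<close>

definition logd :: "'k :: comm_ring_1 fps \<Rightarrow> 'k fps \<Rightarrow> bool" where
  "logd f g \<longleftrightarrow> fps_X * fps_deriv f = g * f"

lemma logd_mult: "logd f a \<Longrightarrow> logd g b \<Longrightarrow> logd (f * g) (a + b)"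
proof -
  assume *: "logd f a" "logd g b"
  have "fps_X * fps_deriv (f * g) = f * (fps_X * fps_deriv g) + (fps_X * fps_deriv f) * g"
    by (simp add: algebra_simps)
  also have "\<dots> = (a + b) * (f * g)"
    using * unfolding logd_def by (simp only: algebra_simps)
  finally show ?thesis by (simp add: logd_def)
qed

lemma logd_const: "logd (fps_const c) 0"
  by (simp add: logd_def)

lemma logd_prod: "(\<And>i. i \<in> A \<Longrightarrow> logd (f i) (g i)) \<Longrightarrow> logd (\<Prod>i\<in>A. f i) (\<Sum>i\<in>A. g i)"
proof (induction A rule: infinite_finite_induct)
  case (insert x A)
  thus ?case by (simp add: logd_mult)
qed (use logd_const[of 1] in simp_all)

lemma fps_X_deriv_nth: "fps_nth (fps_X * fps_deriv f) N = of_nat N * fps_nth f N"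
  by (cases N) auto

lemma logd_iff: "logd f g \<longleftrightarrow> (\<forall>N. of_nat N * fps_nth f N = (\<Sum>i=0..N. fps_nth g i * fps_nth f (N - i)))"
  unfolding logd_def fps_eq_iff fps_X_deriv_nth by (simp add: fps_mult_nth)

definition Lfac :: "'k :: comm_ring_1 \<Rightarrow> nat \<Rightarrow> 'k fps" where
  "Lfac c j = Abs_fps (\<lambda>N. if N > 0 \<and> j dvd N then - of_nat j * c ^ (N div j) else 0)"

lemma logd_factor:
  assumes j: "j > 0"
  shows "logd (1 - fps_const c * fps_X ^ j) (Lfac c j)"
proof -
  have 1: "fps_X * fps_deriv (1 - fps_const c * fps_X ^ j) = fps_const (- of_nat j * c) * fps_X ^ j"
    by (rule fps_ext) (simp only: fps_X_deriv_nth, simp add: fps_X_power_nth)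
  have "Lfac c j * (1 - fps_const c * fps_X ^ j) = fps_const (- of_nat j * c) * fps_X ^ j"
  proof (rule fps_ext)
    fix N
    have "fps_nth (Lfac c j * (1 - fps_const c * fps_X ^ j)) N = fps_nth (Lfac c j) N - (if N < j then 0 else c * fps_nth (Lfac c j) (N - j))"
      by (simp add: right_diff_distrib mult.commute[of "Lfac c j"] mult.assoc fps_X_power_mult_nth)
    also have "\<dots> = fps_nth (fps_const (- of_nat j * c) * fps_X ^ j) N"
    proof (cases "N < j")
      case True
      hence "\<not> (N > 0 \<and> j dvd N)" by (auto dest: dvd_imp_le)
      thus ?thesis using True by (auto simp: Lfac_def)
    next
      case False
      show ?thesis
      proof (cases "N = j")
        case True
        thus ?thesis using j by (simp add: Lfac_def)
      next
        case F2: False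
        with False have N: "N > j" by simp
        have "j dvd N - j \<longleftrightarrow> j dvd N" using N by (simp add: dvd_minus_self)
        moreover have "c ^ (N div j) = c * c ^ ((N - j) div j)" if "j dvd N"
        proof -
          obtain d where d: "N = j * d" using \<open>j dvd N\<close> by (elim dvdE)
          with N obtain d' where "d = Suc d'" by (cases d) auto
          with d j show ?thesis by simp
        qed
        ultimately show ?thesis using N by (simp add: Lfac_def)
      qed
    qed
    finally show "fps_nth (Lfac c j * (1 - fps_const c * fps_X ^ j)) N = fps_nth (fps_const (- of_nat j * c) * fps_X ^ j) N" .
  qed
  with 1 show ?thesis by (simp add: logd_def)
qed

lemma Lfac_sum:
  assumes "N \<le> M"
  shows "fps_nth (\<Sum>j=1..M. Lfac c j) N = fps_nth (Lsum c) N"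
proof (cases "N = 0")
  case False
  have "fps_nth (\<Sum>j=1..M. Lfac c j) N = (\<Sum>j\<in>{1..M}. if j dvd N then - of_nat j * c ^ (N div j) else 0)"
    using False by (simp add: fps_sum_nth Lfac_def)
  also have "\<dots> = (\<Sum>j | j \<in> {1..M} \<and> j dvd N. - of_nat j * c ^ (N div j))"
    by (subst sum.inter_filter) auto
  also have "{j. j \<in> {1..M} \<and> j dvd N} = {j. j dvd N}"
    using False assms by (auto dest: dvd_imp_le intro!: Suc_leI Nat.gr0I)
  also have "(\<Sum>j | j dvd N. - of_nat j * c ^ (N div j)) = (\<Sum>d | d dvd N. - (of_nat (N div d) * c ^ d))"
    by (rule sum.reindex_bij_witness[of _ "\<lambda>d. N div d" "\<lambda>d. N div d"]) (use False in \<open>auto elim!: dvdE\<close>)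
  finally show ?thesis using False by (simp add: Lsum_def sum_negf)
qed (simp add: Lsum_def fps_sum_nth Lfac_def)

lemma logd_theta:
  fixes z :: "'k :: field"
  assumes z: "z \<noteq> 0"
  shows "logd (theta z) (Lsum z + Lsum (inverse z) + Lsum 1)"
  unfolding logd_iff
proof
  fix N
  \<comment> \<open>The recursion at \<open>N\<close> involves only coefficients up to
    \<open>N\<close>, for which this finite product may stand in for \<open>theta\<close>.\<close>
  define M where "M = Suc N"
  let ?g = "\<Sum>j=1..M. Lfac z j + Lfac (inverse z) j + Lfac 1 j"
  have "logd (triple_prod z M) (0 + ?g)"
    unfolding triple_prod_def
  proof (rule logd_mult)
    show "logd (1 - fps_const z) 0" using logd_const[of "1 - z"] by (simp add: fps_const_sub [symmetric] del: fps_const_sub)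
    show "logd (\<Prod>j=1..M. (1 - fps_const z * fps_X ^ j) * (1 - fps_const (inverse z) * fps_X ^ j) * (1 - fps_X ^ j)) ?g"
    proof (rule logd_prod)
      fix j assume "j \<in> {1..M}"
      hence j: "j > 0" by simp
      show "logd ((1 - fps_const z * fps_X ^ j) * (1 - fps_const (inverse z) * fps_X ^ j) * (1 - fps_X ^ j))
          (Lfac z j + Lfac (inverse z) j + Lfac 1 j)"
        using logd_factor[OF j, of "1 :: 'k"] by (intro logd_mult logd_factor j) simp
    qed
  qed
  hence "of_nat N * fps_nth (triple_prod z M) N = (\<Sum>i=0..N. fps_nth ?g i * fps_nth (triple_prod z M) (N - i))"
    by (simp add: logd_iff)
  moreover have "fps_nth (triple_prod z M) i = fps_nth (theta z) i" if "i \<le> N" for i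
    using jacobi_triple_product[OF z, of i M] that by (simp add: M_def)
  moreover have "fps_nth ?g i = fps_nth (Lsum z + Lsum (inverse z) + Lsum 1) i" if "i \<le> N" for i
  proof -
    have "?g = (\<Sum>j=1..M. Lfac z j) + (\<Sum>j=1..M. Lfac (inverse z) j) + (\<Sum>j=1..M. Lfac 1 j)"
      by (simp add: sum.distrib)
    moreover have "i \<le> M" using that by (simp add: M_def)
    ultimately show ?thesis by (simp only: fps_add_nth Lfac_sum)
  qed
  ultimately show "of_nat N * fps_nth (theta z) N =
     (\<Sum>i=0..N. fps_nth (Lsum z + Lsum (inverse z) + Lsum 1) i * fps_nth (theta z) (N - i))"
    by simp
qed

text \<open>The solution of \<open>T f' = g f\<close> with constant coefficient 1; the values of \<open>iv\<close> are the inverses of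
  the positive integers, since the coefficients need not lie in a field.\<close>

function logsol :: "(nat \<Rightarrow> 'r :: comm_ring_1) \<Rightarrow> (nat \<Rightarrow> 'r) \<Rightarrow> nat \<Rightarrow> 'r" where
  "logsol iv g N = (if N = 0 then 1 else iv N * (\<Sum>i=1..N. g i * logsol iv g (N - i)))"
  by auto
termination by (relation "measure (\<lambda>(_, _, N). N)") auto

declare logsol.simps [simp del]

lemma logsol_0 [simp]: "logsol iv g 0 = 1"
  by (subst logsol.simps) simp

lemma logsol_rec:
  assumes "\<And>N. N > 0 \<Longrightarrow> iv N * of_nat N = 1"
  shows "of_nat N * logsol iv g N = (\<Sum>i=1..N. g i * logsol iv g (N - i))"
proof (cases "N = 0")
  case False
  hence "of_nat N * iv N = 1" using assms[of N] by (simp add: mult.commute)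
  thus ?thesis using False by (subst logsol.simps) (simp add: mult.assoc [symmetric])
qed simp

lemma logsol_cong:
  assumes "\<And>i. i > 0 \<Longrightarrow> g i = g' i"
  shows "logsol iv g N = logsol iv g' N"
proof (induction N rule: less_induct)
  case (less N)
  show ?case
  proof (cases "N = 0")
    case False
    have "(\<Sum>i=1..N. g i * logsol iv g (N - i)) = (\<Sum>i=1..N. g' i * logsol iv g' (N - i))"
      using less assms False by (intro sum.cong) auto
    thus ?thesis using False by (subst (1 2) logsol.simps) simp
  qed simp
qed

lemma logsol_scale: "logsol iv (\<lambda>k. u ^ k * g k) N = u ^ N * logsol iv g N"
proof (induction N rule: less_induct)
  case (less N)
  show ?case
  proof (cases "N = 0")
    case False
    have "(\<Sum>i=1..N. u ^ i * g i * logsol iv (\<lambda>k. u ^ k * g k) (N - i)) = (\<Sum>i=1..N. u ^ N * (g i * logsol iv g (N - i)))"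
    proof (rule sum.cong[OF refl])
      fix i assume i: "i \<in> {1..N}"
      hence "logsol iv (\<lambda>k. u ^ k * g k) (N - i) = u ^ (N - i) * logsol iv g (N - i)" using False by (intro less) auto
      moreover have "u ^ N = u ^ i * u ^ (N - i)" using i by (simp add: power_add [symmetric])
      ultimately show "u ^ i * g i * logsol iv (\<lambda>k. u ^ k * g k) (N - i) = u ^ N * (g i * logsol iv g (N - i))"
        by (simp add: mult_ac)
    qed
    hence "iv N * (\<Sum>i=1..N. u ^ i * g i * logsol iv (\<lambda>k. u ^ k * g k) (N - i)) = u ^ N * (iv N * (\<Sum>i=1..N. g i * logsol iv g (N - i)))"
      by (simp add: sum_distrib_left mult.left_commute)
    thus ?thesis using False unfolding logsol.simps[of iv _ N] by simp
  qed simp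
qed

lemma logd_logsol:
  assumes iv: "\<And>N. N > 0 \<Longrightarrow> iv N * of_nat N = 1" and g: "fps_nth g 0 = 0"
  shows "logd (Abs_fps (logsol iv (fps_nth g))) g"
  unfolding logd_iff
proof
  fix N
  have A: "(\<Sum>i=0..N. fps_nth g i * logsol iv (fps_nth g) (N - i)) = (\<Sum>i=1..N. fps_nth g i * logsol iv (fps_nth g) (N - i))"
    unfolding sum.atLeast_Suc_atMost[OF le0] g by simp
  show "of_nat N * fps_nth (Abs_fps (logsol iv (fps_nth g))) N =
      (\<Sum>i=0..N. fps_nth g i * fps_nth (Abs_fps (logsol iv (fps_nth g))) (N - i))"
    unfolding fps_nth_Abs_fps A by (rule logsol_rec[OF iv])
qed

lemma logd_unique:
  assumes iv: "\<And>N. N > 0 \<Longrightarrow> iv N * of_nat N = 1" and g: "fps_nth g 0 = 0" and f: "logd f g"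
  shows "f = fps_const (fps_nth f 0) * Abs_fps (logsol iv (fps_nth g))"
proof (rule fps_ext)
  fix N
  have "fps_nth f N = fps_nth f 0 * logsol iv (fps_nth g) N"
  proof (induction N rule: less_induct)
    case (less N)
    show ?case
    proof (cases "N = 0")
      case False
      have "of_nat N * fps_nth f N = (\<Sum>i=0..N. fps_nth g i * fps_nth f (N - i))"
        by (rule f[unfolded logd_iff, rule_format])
      also have "\<dots> = (\<Sum>i=1..N. fps_nth g i * fps_nth f (N - i))"
        unfolding sum.atLeast_Suc_atMost[OF le0] g by simp
      also have "\<dots> = (\<Sum>i=1..N. fps_nth f 0 * (fps_nth g i * logsol iv (fps_nth g) (N - i)))"
      proof (rule sum.cong[OF refl])
        fix i assume "i \<in> {1..N}"
        hence "fps_nth f (N - i) = fps_nth f 0 * logsol iv (fps_nth g) (N - i)" using False by (intro less) auto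
        thus "fps_nth g i * fps_nth f (N - i) = fps_nth f 0 * (fps_nth g i * logsol iv (fps_nth g) (N - i))"
          by (simp only: mult.left_commute)
      qed
      also have "\<dots> = fps_nth f 0 * (of_nat N * logsol iv (fps_nth g) N)"
      proof -
        have "of_nat N * logsol iv (fps_nth g) N = (\<Sum>i=1..N. fps_nth g i * logsol iv (fps_nth g) (N - i))"
          by (rule logsol_rec) (rule iv)
        thus ?thesis by (simp only: sum_distrib_left)
      qed
      finally have "iv N * (of_nat N * fps_nth f N) = iv N * (of_nat N * (fps_nth f 0 * logsol iv (fps_nth g) N))"
        by (simp add: mult_ac)
      thus ?thesis unfolding mult.assoc [symmetric] using iv[of N] False by simp
    qed simp
  qed
  thus "fps_nth f N = fps_nth (fps_const (fps_nth f 0) * Abs_fps (logsol iv (fps_nth g))) N" by simp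
qed

text \<open>\<open>U\<^sup>k\<close> times the \<open>k\<close>-th coefficient of the logarithmic derivative of the product side.\<close>

definition lcoef :: "'r :: comm_ring_1 \<Rightarrow> 'r \<Rightarrow> (nat \<Rightarrow> 'r) \<Rightarrow> nat \<Rightarrow> 'r" where
  "lcoef x U D k = - (\<Sum>d | d dvd k. of_nat (k div d) *
     (U ^ (k - d) * ((1 - U ^ d * x ^ d) * (1 - U ^ d * x ^ (2 * d))) * (D d * D (2 * d))))"

lemma sum_split_sym:
  fixes h :: "nat \<Rightarrow> 'k :: comm_ring_1"
  shows "(\<Sum>l<n. h (n + l + 1) + h (n - l)) = (\<Sum>i=1..2 * n. h i)"
proof -
  have "(\<Sum>i=1..2 * n. h i) = (\<Sum>i=1..n. h i) + (\<Sum>i=n + 1..2 * n. h i)"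
    using sum.ub_add_nat[of 1 n h n] by (simp add: mult_2)
  moreover have "(\<Sum>i=1..n. h i) = (\<Sum>l<n. h (n - l))"
    by (rule sum.reindex_bij_witness[of _ "\<lambda>l. n - l" "\<lambda>i. n - i"]) auto
  moreover have "(\<Sum>i=n + 1..2 * n. h i) = (\<Sum>l<n. h (n + l + 1))"
    by (rule sum.reindex_bij_witness[of _ "\<lambda>l. n + l + 1" "\<lambda>i. i - n - 1"]) auto
  ultimately show ?thesis by (simp add: sum.distrib)
qed

text \<open>The left factor is the character of the adjoint representation of \<open>C\<^sub>n\<close> at the principal
  element, summed over the roots by height.\<close>

lemma adjoint_character:
  fixes X J :: "'k :: comm_ring_1"
  assumes XJ: "X * J = 1"
  defines "h \<equiv> \<lambda>i. X ^ i + J ^ i"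
  shows "((\<Sum>j<n. h (2 * j + 1)) + (\<Sum>j<n. \<Sum>l<j. h (j + l + 1) + h (j - l)) + of_nat n) * ((1 - X) * (1 - X\<^sup>2)) =
     X ^ (2 * n + 2) - X - X\<^sup>2 + X * J ^ (2 * n)"
proof (induction n)
  case 0
  show ?case by (simp add: power2_eq_square)
next
  case (Suc n)
  let ?S = "\<lambda>n. (\<Sum>j<n. h (2 * j + 1)) + (\<Sum>j<n. \<Sum>l<j. h (j + l + 1) + h (j - l)) + of_nat n"
  \<comment> \<open>The left factor is the character of the \<open>2 * m + 1\<close>-dimensional
    representation of SL(2). From \<open>n\<close> to \<open>n + 1\<close> the one with
    \<open>m = 2 * n + 1\<close> is added, the new exponent of the root system.\<close>
  have geo: "(1 + (\<Sum>i=1..m. h i)) * (1 - X) = J ^ m - X ^ Suc m" for m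
  proof (induction m)
    case (Suc m)
    have "J ^ Suc m * X = (X * J) * J ^ m" by (simp add: mult_ac)
    hence "J ^ Suc m * X = J ^ m" using XJ by simp
    with Suc show ?case by (simp add: h_def algebra_simps)
  qed simp
  have "?S (Suc n) = ?S n + (1 + (\<Sum>i=1..Suc (2 * n). h i))"
    using sum_split_sym[of h n] by (simp add: algebra_simps)
  hence "?S (Suc n) * ((1 - X) * (1 - X\<^sup>2)) = ?S n * ((1 - X) * (1 - X\<^sup>2)) + ((1 + (\<Sum>i=1..Suc (2 * n). h i)) * (1 - X)) * (1 - X\<^sup>2)"
    by (simp only: algebra_simps)
  also have "\<dots> = X ^ (2 * n + 2) - X - X\<^sup>2 + X * J ^ (2 * n) + (J ^ Suc (2 * n) - X ^ Suc (Suc (2 * n))) * (1 - X\<^sup>2)"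
    unfolding geo Suc.IH ..
  also have "\<dots> = X ^ (2 * Suc n + 2) - X - X\<^sup>2 + X * J ^ (2 * Suc n)"
  proof -
    have "J ^ Suc (2 * n) * X\<^sup>2 = (X * J) * (X * J ^ (2 * n))" "X * J ^ (2 * Suc n) = (X * J) * J ^ Suc (2 * n)"
      by (simp_all add: power2_eq_square mult_ac)
    hence 1: "J ^ Suc (2 * n) * X\<^sup>2 = X * J ^ (2 * n)" "X * J ^ (2 * Suc n) = J ^ Suc (2 * n)"
      unfolding XJ by simp_all
    have "(J ^ Suc (2 * n) - X ^ Suc (Suc (2 * n))) * (1 - X\<^sup>2) = J ^ Suc (2 * n) - J ^ Suc (2 * n) * X\<^sup>2 - X ^ (2 * n + 2) + X ^ (2 * Suc n + 2)"
      by (simp add: algebra_simps power2_eq_square)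
    thus ?thesis unfolding 1 by (simp add: algebra_simps)
  qed
  finally show ?case .
qed

context generic_q begin

definition Rser :: "(nat \<Rightarrow> 'k) \<Rightarrow> nat \<Rightarrow> 'k fps" where
  "Rser iv n = Abs_fps (\<lambda>N. inverse (q powi (- 4 * (int n + 1))) ^ N *
     logsol iv (lcoef (q\<^sup>2) (q powi (- 4 * (int n + 1))) (\<lambda>y. inverse (1 - q\<^sup>2 ^ y))) N)"

lemma qpow_neq1: "i > 0 \<Longrightarrow> q ^ i \<noteq> 1"
  using q_generic[of "int i"] by simp

lemma theta_0: "fps_nth (theta (q ^ (2 * i))) 0 = 1 - q ^ (2 * i)"
proof -
  have "tri k = 0 \<longleftrightarrow> k = 0 \<or> k = 1" for k
  proof -
    have "tri k = 0 \<longleftrightarrow> k * (k - 1) = 0" using int_tri[of k] by linarith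
    thus ?thesis by simp
  qed
  hence "{k. k \<in> UNIV \<and> tri k = 0} = {0, 1}" by auto
  thus ?thesis by (simp add: theta_def gser_nth psgn_def)
qed

lemma Fser_0: "fps_nth (Fser n) 0 = 1"
proof -
  have "{S. S \<in> pos_sets \<and> \<Sum>S = 0} = {{}}"
    by (auto simp: pos_sets_def)
  thus ?thesis by (simp add: Fser_def gser_nth)
qed

text \<open>For each divisor \<open>d\<close>, \<open>adjoint_character\<close> at
  \<open>X = q ^ (2 * d)\<close> gives the numerator in \<open>lcoef\<close>, because
  \<open>U ^ d\<close> is \<open>X\<close> to the power \<open>- (2 * n + 2)\<close>. The
  \<open>n * n\<close> theta functions each bring one \<open>Lsum 1\<close>, but the character has
  only \<open>n\<close> zero weights; the surplus is free of \<open>q\<close>.\<close>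

lemma Lsum_total:
  fixes n :: nat
  defines "\<Lambda> \<equiv> \<lambda>i. Lsum (q ^ (2 * i)) + Lsum (inverse (q ^ (2 * i))) + Lsum 1"
  defines "U \<equiv> q powi (- 4 * (int n + 1))"
  shows "(\<Sum>j<n. \<Lambda> (2 * j + 1)) + (\<Sum>j<n. \<Sum>l<j. \<Lambda> (j + l + 1) + \<Lambda> (j - l)) =
    Abs_fps (\<lambda>k. if k = 0 then 0 else inverse U ^ k * lcoef (q\<^sup>2) U (\<lambda>y. inverse (1 - q\<^sup>2 ^ y)) k) +
    fps_const (of_nat (n * n) - of_nat n) * Lsum 1"
proof (rule fps_ext)
  fix N
  show "fps_nth ((\<Sum>j<n. \<Lambda> (2 * j + 1)) + (\<Sum>j<n. \<Sum>l<j. \<Lambda> (j + l + 1) + \<Lambda> (j - l))) N =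
    fps_nth (Abs_fps (\<lambda>k. if k = 0 then 0 else inverse U ^ k * lcoef (q\<^sup>2) U (\<lambda>y. inverse (1 - q\<^sup>2 ^ y)) k) +
    fps_const (of_nat (n * n) - of_nat n) * Lsum 1) N"
  proof (cases "N = 0")
    case True
    thus ?thesis by (simp add: \<Lambda>_def Lsum_def fps_sum_nth)
  next
    case False
    have U0: "U \<noteq> 0" using q0 by (simp add: U_def power_int_eq_0_iff)
    define h where "h d i = (q ^ (2 * d)) ^ i + inverse (q ^ (2 * d)) ^ i" for d i :: nat
    have \<Lambda>: "fps_nth (\<Lambda> i) N = - (\<Sum>d | d dvd N. of_nat (N div d) * (h d i + 1))" for i
    proof -
      have "(q ^ (2 * i)) ^ d = (q ^ (2 * d)) ^ i" "inverse (q ^ (2 * i)) ^ d = inverse (q ^ (2 * d)) ^ i" for d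
        by (simp_all add: power_mult [symmetric] power_inverse [symmetric] mult_ac)
      thus ?thesis using False
        by (simp add: \<Lambda>_def Lsum_def h_def sum.distrib [symmetric] sum_negf [symmetric] algebra_simps)
    qed
    have cnt: "of_nat n + (\<Sum>j<n. \<Sum>l<j. (2 :: 'k)) = of_nat (n * n)"
      by (induction n) (simp_all add: algebra_simps)
    have "fps_nth ((\<Sum>j<n. \<Lambda> (2 * j + 1)) + (\<Sum>j<n. \<Sum>l<j. \<Lambda> (j + l + 1) + \<Lambda> (j - l))) N =
      - (\<Sum>d | d dvd N. of_nat (N div d) * ((\<Sum>j<n. h d (2 * j + 1) + 1) + (\<Sum>j<n. \<Sum>l<j. (h d (j + l + 1) + 1) + (h d (j - l) + 1))))"
    proof -
      have sw: "(\<Sum>i\<in>A. - (\<Sum>d | d dvd N. of_nat (N div d) * f d i)) = - (\<Sum>d | d dvd N. of_nat (N div d) * (\<Sum>i\<in>A. f d i))"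
        for A :: "nat set" and f :: "nat \<Rightarrow> nat \<Rightarrow> 'k"
        unfolding sum_negf sum_distrib_left by (subst sum.swap) (rule refl)
      have ad: "- (\<Sum>d | d dvd N. of_nat (N div d) * f d) + - (\<Sum>d | d dvd N. of_nat (N div d) * g d) =
          - (\<Sum>d | d dvd N. of_nat (N div d) * (f d + g d))" for f g :: "nat \<Rightarrow> 'k"
        by (simp add: sum.distrib distrib_left)
      show ?thesis by (simp only: fps_add_nth fps_sum_nth \<Lambda> ad sw)
    qed
    also have "\<dots> = - (\<Sum>d | d dvd N. of_nat (N div d) *
        (inverse U ^ d * ((1 - U ^ d * (q\<^sup>2) ^ d) * (1 - U ^ d * (q\<^sup>2) ^ (2 * d))) * (inverse (1 - (q\<^sup>2) ^ d) * inverse (1 - (q\<^sup>2) ^ (2 * d)))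
          + (of_nat (n * n) - of_nat n)))"
    proof (intro arg_cong[where f = uminus] sum.cong refl arg_cong2[where f = "(*)"])
      fix d assume "d \<in> {d. d dvd N}"
      hence d: "d > 0" using False by (auto intro!: Nat.gr0I)
      define X where "X = q ^ (2 * d)"
      define J where "J = inverse X"
      have "X\<^sup>2 = q ^ (2 * d * 2)" by (simp only: X_def power_mult)
      hence X: "X\<^sup>2 \<noteq> 1" "X \<noteq> 0" "X \<noteq> 1" "X * J = 1"
        using d q0 qpow_neq1[of "2 * d"] qpow_neq1[of "2 * d * 2"] by (simp_all add: X_def J_def)
      let ?S = "(\<Sum>j<n. h d (2 * j + 1)) + (\<Sum>j<n. \<Sum>l<j. h d (j + l + 1) + h d (j - l))"
      have a1: "(\<Sum>j<n. h d (2 * j + 1) + 1) + (\<Sum>j<n. \<Sum>l<j. (h d (j + l + 1) + 1) + (h d (j - l) + 1)) = ?S + of_nat (n * n)"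
        unfolding cnt [symmetric] by (simp add: sum.distrib algebra_simps)
      have a2: "(?S + of_nat n) * ((1 - X) * (1 - X\<^sup>2)) = X ^ (2 * n + 2) - X - X\<^sup>2 + X * J ^ (2 * n)"
        using adjoint_character[OF X(4), of n] by (simp add: h_def X_def J_def)
      have a3: "(1 - X) * (1 - X\<^sup>2) \<noteq> 0" using X by simp
      have gen: "a = w / m + (c - e)" if "a = S + c" "(S + e) * m = w" "m \<noteq> 0" for a S c e m w :: 'k
        using that by (simp add: field_simps)
      have 1: "(\<Sum>j<n. h d (2 * j + 1) + 1) + (\<Sum>j<n. \<Sum>l<j. (h d (j + l + 1) + 1) + (h d (j - l) + 1)) =
        (X ^ (2 * n + 2) - X - X\<^sup>2 + X * J ^ (2 * n)) / ((1 - X) * (1 - X\<^sup>2)) + (of_nat (n * n) - of_nat n)"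
        by (rule gen[OF a1 a2 a3])
      have Ud: "U ^ d = J ^ (2 * n + 2)"
      proof -
        have "U ^ d = q powi (- 4 * (int n + 1) * int d)"
          unfolding U_def by (simp only: power_int_mult power_int_of_nat)
        also have "- 4 * (int n + 1) * int d = - int (2 * d * (2 * n + 2))" by (simp add: algebra_simps)
        also have "q powi \<dots> = inverse (q ^ (2 * d * (2 * n + 2)))" by (simp only: power_int_minus power_int_of_nat)
        finally show ?thesis unfolding J_def X_def by (simp only: power_mult power_inverse)
      qed
      have iU: "inverse U ^ d = X ^ (2 * n + 2)"
        using Ud by (simp add: J_def power_inverse)
      have q2: "(q\<^sup>2) ^ d = X" "(q\<^sup>2) ^ (2 * d) = X\<^sup>2"
        by (simp_all add: X_def power_mult [symmetric] mult_ac)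
      have J1: "X ^ m * J ^ m = 1" for m using X(4) by (simp add: power_mult_distrib [symmetric])
      have "X ^ (2 * n + 2) * ((1 - J ^ (2 * n + 2) * X) * (1 - J ^ (2 * n + 2) * X\<^sup>2)) =
         X ^ (2 * n + 2) - X ^ (2 * n + 2) * J ^ (2 * n + 2) * X - X ^ (2 * n + 2) * J ^ (2 * n + 2) * X\<^sup>2
         + X ^ (2 * n + 2) * J ^ (2 * n + 2) * (J ^ (2 * n) * (X * J) * (X * J) * X)"
        by (simp add: algebra_simps power2_eq_square)
      hence 2: "X ^ (2 * n + 2) * ((1 - J ^ (2 * n + 2) * X) * (1 - J ^ (2 * n + 2) * X\<^sup>2)) =
          X ^ (2 * n + 2) - X - X\<^sup>2 + X * J ^ (2 * n)"
        unfolding J1 X(4) by (simp add: mult_ac)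
      show "(\<Sum>j<n. h d (2 * j + 1) + 1) + (\<Sum>j<n. \<Sum>l<j. (h d (j + l + 1) + 1) + (h d (j - l) + 1)) =
        inverse U ^ d * ((1 - U ^ d * (q\<^sup>2) ^ d) * (1 - U ^ d * (q\<^sup>2) ^ (2 * d))) * (inverse (1 - (q\<^sup>2) ^ d) * inverse (1 - (q\<^sup>2) ^ (2 * d)))
          + (of_nat (n * n) - of_nat n)"
        unfolding 1 iU Ud q2 2 by (simp add: divide_inverse)
    qed
    also have "\<dots> = inverse U ^ N * lcoef (q\<^sup>2) U (\<lambda>y. inverse (1 - q\<^sup>2 ^ y)) N +
        (of_nat (n * n) - of_nat n) * fps_nth (Lsum 1) N"
    proof -
      have "inverse U ^ N * (of_nat (N div d) * (U ^ (N - d) * A * B)) = of_nat (N div d) * (inverse U ^ d * A * B)" if "d dvd N" for d A B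
      proof -
        have "d \<le> N" using that False by (auto dest: dvd_imp_le)
        hence "inverse U ^ N = inverse U ^ d * inverse U ^ (N - d)" by (simp add: power_add [symmetric])
        moreover have "inverse U ^ (N - d) * U ^ (N - d) = 1" using U0 by (simp add: power_mult_distrib [symmetric])
        ultimately have "inverse U ^ N * U ^ (N - d) = inverse U ^ d" by (simp add: mult.assoc)
        moreover have "inverse U ^ N * (of_nat (N div d) * (U ^ (N - d) * A * B)) = of_nat (N div d) * ((inverse U ^ N * U ^ (N - d)) * A * B)"
          by (simp only: mult_ac)
        ultimately show ?thesis by (simp only:)
      qed
      hence "inverse U ^ N * lcoef (q\<^sup>2) U (\<lambda>y. inverse (1 - q\<^sup>2 ^ y)) N =
        - (\<Sum>d | d dvd N. of_nat (N div d) *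
        (inverse U ^ d * ((1 - U ^ d * (q\<^sup>2) ^ d) * (1 - U ^ d * (q\<^sup>2) ^ (2 * d))) * (inverse (1 - (q\<^sup>2) ^ d) * inverse (1 - (q\<^sup>2) ^ (2 * d)))))"
        unfolding lcoef_def mult_minus_right sum_distrib_left
        by (intro arg_cong[where f = uminus] sum.cong refl) auto
      moreover have "(of_nat (n * n) - of_nat n) * fps_nth (Lsum 1) N = - (\<Sum>d | d dvd N. of_nat (N div d) * (of_nat (n * n) - of_nat n :: 'k))"
        using False by (simp add: Lsum_def sum_distrib_left mult_ac)
      ultimately show ?thesis by (simp add: distrib_left sum.distrib)
    qed
    finally show ?thesis using False by simp
  qed
qed

text \<open>Equal logarithmic derivatives determine a series up to its constant coefficient. The
  latter is nonzero because that of the theta product consists of powers of \<open>q\<close> and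
  factors \<open>1 - q ^ (2 * i)\<close> with \<open>i > 0\<close>.\<close>

lemma Fser_Mdet:
  assumes n: "n > 0" and iv: "\<And>N. N > 0 \<Longrightarrow> iv N * of_nat N = (1 :: 'k)"
  shows "Mdet n * Fser n = Rser iv n *
    (Abs_fps (logsol iv (fps_nth (fps_const (of_nat (n * n) - of_nat n) * Lsum 1))) * fps_const (fps_nth (Mdet n) 0))"
    and "fps_nth (Mdet n) 0 \<noteq> 0"
proof -
  define V where "V = vdet n (\<lambda>j. int j + 1)"
  define U where "U = q powi (- 4 * (int n + 1))"
  define W where "W = (\<Prod>j<n. fps_const (inverse (q ^ (2 * j + 1))) * theta (q ^ (2 * (2 * j + 1)))) *
    (\<Prod>j<n. \<Prod>l<j. fps_const (inverse (q ^ (2 * j + 1))) * (theta (q ^ (2 * (j + l + 1))) * theta (q ^ (2 * (j - l)))))"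
  define \<kappa> where "\<kappa> = fps_const (of_nat (n * n) - of_nat n) * (Lsum 1 :: 'k fps)"
  define L where "L = Abs_fps (\<lambda>k. if k = 0 then 0 else inverse U ^ k * lcoef (q\<^sup>2) U (\<lambda>y. inverse (1 - q\<^sup>2 ^ y)) k)"
  have W: "Mdet n * (fps_const V * Fser n) = W" unfolding V_def W_def by (rule macdonald_identity_C[OF n])
  define \<Lambda> where "\<Lambda> i = Lsum (q ^ (2 * i)) + Lsum (inverse (q ^ (2 * i))) + Lsum 1" for i
  have th: "logd (theta (q ^ (2 * i))) (\<Lambda> i)" for i
    unfolding \<Lambda>_def by (rule logd_theta) (use q0 in simp)
  have cth: "logd (fps_const c * f) g" if "logd f g" for c f g
    using logd_mult[OF logd_const[of c] that] by simp
  have "logd W ((\<Sum>j<n. \<Lambda> (2 * j + 1)) + (\<Sum>j<n. \<Sum>l<j. \<Lambda> (j + l + 1) + \<Lambda> (j - l)))"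
    unfolding W_def by (intro logd_mult logd_prod cth th)
  hence logW: "logd W (L + \<kappa>)"
    unfolding \<Lambda>_def Lsum_total L_def U_def \<kappa>_def .
  have L0: "fps_nth L 0 = 0" "fps_nth \<kappa> 0 = 0" by (simp_all add: L_def \<kappa>_def Lsum_def)
  have R: "Rser iv n = Abs_fps (logsol iv (fps_nth L))"
  proof -
    have "logsol iv (fps_nth L) N = logsol iv (\<lambda>k. inverse U ^ k * lcoef (q\<^sup>2) U (\<lambda>y. inverse (1 - q\<^sup>2 ^ y)) k) N" for N
      by (rule logsol_cong) (simp add: L_def)
    thus ?thesis by (simp add: Rser_def logsol_scale U_def fps_eq_iff)
  qed
  let ?C = "Abs_fps (logsol iv (fps_nth \<kappa>))"
  have "logd (Rser iv n * ?C) (L + \<kappa>)"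
    unfolding R by (intro logd_mult logd_logsol iv L0)
  from logd_unique[OF iv _ this] have RC: "Rser iv n * ?C = Abs_fps (logsol iv (fps_nth (L + \<kappa>)))"
    using L0 by (simp add: R)
  have W': "W = fps_const (fps_nth W 0) * (Rser iv n * ?C)"
    using logd_unique[OF iv _ logW] L0 unfolding RC by simp
  have W0: "fps_nth W 0 = V * fps_nth (Mdet n) 0" unfolding W [symmetric] by (simp add: Fser_0)
  have V: "V \<noteq> 0" unfolding V_def by (rule vdet_rho_nz)
  have nz: "fps_const V \<noteq> 0" using V by simp
  have "fps_const V * (Mdet n * Fser n) = W" unfolding W [symmetric] by (rule mult.left_commute)
  also have "\<dots> = fps_const (V * fps_nth (Mdet n) 0) * (Rser iv n * ?C)" by (rule W'[unfolded W0])
  also have "\<dots> = fps_const V * (Rser iv n * (?C * fps_const (fps_nth (Mdet n) 0)))"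
    unfolding fps_const_mult [symmetric] by (simp only: mult_ac)
  finally have "Mdet n * Fser n = Rser iv n * (?C * fps_const (fps_nth (Mdet n) 0))"
    by (rule mult_left_cancel[OF nz, THEN iffD1])
  thus "Mdet n * Fser n = Rser iv n *
    (Abs_fps (logsol iv (fps_nth (fps_const (of_nat (n * n) - of_nat n) * Lsum 1))) * fps_const (fps_nth (Mdet n) 0))"
    unfolding \<kappa>_def .
  have p0: "fps_nth (\<Prod>i\<in>A. f i) 0 = (\<Prod>i\<in>A. fps_nth (f i) 0)" for f :: "nat \<Rightarrow> 'k fps" and A
    by (induction A rule: infinite_finite_induct) auto
  have "fps_nth W 0 \<noteq> 0"
  proof -
    have pnz: "(\<Prod>i<k. f i) \<noteq> 0" if "\<And>i. i < k \<Longrightarrow> f i \<noteq> 0" for f :: "nat \<Rightarrow> 'k" and k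
      using that by simp
    have nz: "1 - q ^ (2 * i) \<noteq> 0" if "i > 0" for i
      using qpow_neq1[of "2 * i"] that by auto
    have iz: "inverse (q ^ i) \<noteq> 0" for i using q0 by simp
    show ?thesis
      unfolding W_def fps_mult_nth_0 p0 theta_0 fps_nth_fps_const
      by (intro no_zero_divisors pnz nz iz) (use q0 in auto)
  qed
  thus "fps_nth (Mdet n) 0 \<noteq> 0" unfolding W0 by auto
qed

end

section \<open>From special values to polynomials\<close>

lemma fls_X_powi: "(fls_X :: 'a :: field fls) powi y = fls_shift (- y) 1"
proof (cases "y \<ge> 0")
  case True
  then obtain n where "y = int n" using nonneg_int_cases by blast
  thus ?thesis by (simp add: fls_X_power_conv_shift_1)
next
  case False
  then obtain n where "y = - int n" by (metis int_cases2 not_le of_nat_0_le_iff)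
  moreover have "fls_X ^ n * fls_shift (int n) 1 = (1 :: 'a fls)"
    using fls_X_intpow_times_fls_X_intpow[of "int n" "- int n", where 'a = 'a] by (simp add: fls_X_power_conv_shift_1)
  ultimately show ?thesis by (simp add: power_int_minus inverse_unique)
qed

interpretation fls: generic_q "fls_X :: 'a :: field_char_0 fls"
proof
  fix y :: int assume "y \<noteq> 0"
  hence "fls_nth (fls_X powi y :: 'a fls) 0 = 0" unfolding fls_X_powi by simp
  thus "(fls_X powi y :: 'a fls) \<noteq> 1" by (metis fls_one_nth zero_neq_one)
qed simp

text \<open>Here the parameters \<open>D\<close> and \<open>iv\<close> pay off: a ring homomorphism
  need not commute with \<open>inverse\<close>, but it commutes with polynomial expressions in
  inverses that are supplied as data.\<close>

lemma (in comm_ring_hom) hom_wt: "hom (wt x U D S) = wt (hom x) (hom U) (\<lambda>y. hom (D y)) S"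
  by (simp add: wt_def wfac_def hom_distribs)

lemma (in comm_ring_hom) hom_lcoef: "hom (lcoef x U D k) = lcoef (hom x) (hom U) (\<lambda>y. hom (D y)) k"
  by (simp add: lcoef_def hom_distribs)

lemma (in comm_ring_hom) hom_logsol: "hom (logsol iv g N) = logsol (\<lambda>n. hom (iv n)) (\<lambda>n. hom (g n)) N"
proof (induction N rule: less_induct)
  case (less N)
  show ?case
  proof (cases "N = 0")
    case False
    have "hom (\<Sum>i=1..N. g i * logsol iv g (N - i)) = (\<Sum>i=1..N. hom (g i) * logsol (\<lambda>n. hom (iv n)) (\<lambda>n. hom (g n)) (N - i))"
      unfolding hom_sum using False less by (intro sum.cong) (auto simp: hom_distribs)
    thus ?thesis using False unfolding logsol.simps[of _ _ N] by (simp only: if_False hom_mult)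
  qed simp
qed

text \<open>Used with two readings of the variables: here for series in \<open>T\<close> that are
  free of \<open>q\<close>, later (\<open>evq\<close>) for series in \<open>q\<close> that are free
  of \<open>u\<close>.\<close>

definition cmap :: "'a :: field_char_0 fps \<Rightarrow> 'a fls fps" where
  "cmap g = Abs_fps (\<lambda>N. fls_const (fps_nth g N))"

lemma fls_nth_sum: "fls_nth (sum f A) n = (\<Sum>x\<in>A. fls_nth (f x) n)"
  by (induction A rule: infinite_finite_induct) auto

lemma fls_const_add: "fls_const (a + b) = fls_const a + fls_const b"
  by (rule fls_eqI) simp

lemma fls_const_sum: "fls_const (sum f A) = (\<Sum>x\<in>A. fls_const (f x))"
  by (induction A rule: infinite_finite_induct) (auto simp: fls_const_add)

interpretation fls_const_hom: comm_ring_hom "fls_const :: 'a :: field_char_0 \<Rightarrow> 'a fls"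
  by unfold_locales (auto simp: fls_const_add)

interpretation cmap_hom: comm_ring_hom "cmap :: 'a :: field_char_0 fps \<Rightarrow> 'a fls fps"
  by unfold_locales (auto simp: cmap_def fps_eq_iff fps_mult_nth fls_const_add fls_const_sum)

lemma cmap_const: "cmap (fps_const c) = fps_const (fls_const c)"
  by (auto simp: cmap_def fps_eq_iff)

lemma fls_const_of_int: "of_int k = fls_const (of_int k :: 'a :: field_char_0)"
  by (simp add: hom_distribs)

lemma fls_const_inverse: "fls_const (inverse c) = inverse (fls_const c)" for c :: "'a :: field_char_0"
proof (cases "c = 0")
  case False
  hence "fls_const c * fls_const (inverse c) = 1" by simp
  thus ?thesis by (metis inverse_unique)
qed simp

text \<open>\<open>Mdet\<close> and the surplus from \<open>Lsum_total\<close> both come from series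
  under \<open>cmap\<close>, and the one for \<open>Mdet\<close> can be inverted before
  \<open>cmap\<close> is applied.\<close>

lemma Fser_factor:
  assumes n: "n > 0"
  obtains G :: "'a :: field_char_0 fps" where
    "fls.Fser n = fls.Rser (\<lambda>N. inverse (of_nat N)) n * cmap G"
proof -
  let ?iv = "\<lambda>N. inverse (of_nat N) :: 'a" and ?iv' = "\<lambda>N. inverse (of_nat N) :: 'a fls"
  define Md :: "'a fps" where "Md = det (mat n n (\<lambda>(a, i). Abs_fps (\<lambda>N. of_int (pcoeff n a (int i + 1) (int N)))))"
  have Md: "fls.Mdet n = cmap Md"
  proof -
    have "map_mat cmap (mat n n (\<lambda>(a, i). Abs_fps (\<lambda>N. of_int (pcoeff n a (int i + 1) (int N))))) =
       (mat n n (\<lambda>(a, i). Abs_fps (\<lambda>N. of_int (pcoeff n a (int i + 1) (int N)))) :: 'a fls fps mat)"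
      by (rule eq_matI) (auto simp: cmap_def fps_eq_iff fls_const_of_int)
    thus ?thesis unfolding fls.Mdet_def Md_def by (metis cmap_hom.hom_det)
  qed
  define \<kappa> :: "'a fps" where "\<kappa> = fps_const (of_nat (n * n) - of_nat n) * Lsum 1"
  have L: "Lsum 1 = cmap (Lsum 1 :: 'a fps)"
    by (auto simp: cmap_def fps_eq_iff Lsum_def fls_const_sum hom_distribs)
  have \<kappa>: "fps_const (of_nat (n * n) - of_nat n) * Lsum 1 = cmap \<kappa>"
    unfolding \<kappa>_def cmap_hom.hom_mult L cmap_const by (simp add: hom_distribs)
  have C: "Abs_fps (logsol ?iv' (fps_nth (cmap \<kappa>))) = cmap (Abs_fps (logsol ?iv (fps_nth \<kappa>)))"
  proof (rule fps_ext)
    fix N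
    have "fps_nth (cmap \<kappa>) = (\<lambda>N. fls_const (fps_nth \<kappa> N))" by (simp add: cmap_def fun_eq_iff)
    thus "fps_nth (Abs_fps (logsol ?iv' (fps_nth (cmap \<kappa>)))) N = fps_nth (cmap (Abs_fps (logsol ?iv (fps_nth \<kappa>)))) N"
      by (simp add: cmap_def fls_const_hom.hom_logsol fls_const_inverse hom_distribs)
  qed
  have iv: "?iv' N * of_nat N = 1" if "N > 0" for N using that by simp
  note main = fls.Fser_Mdet(1)[OF n, of ?iv', OF iv] fls.Fser_Mdet(2)[OF n, of ?iv', OF iv]
  have Md0: "fps_nth Md 0 \<noteq> 0" using main(2) unfolding Md by (auto simp: cmap_def)
  have inv: "cmap Md * cmap (inverse Md) = 1"
    unfolding cmap_hom.hom_mult [symmetric] using inverse_mult_eq_1[OF Md0] by (simp add: mult.commute)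
  have "cmap Md * fls.Fser n = fls.Rser ?iv' n * (cmap (Abs_fps (logsol ?iv (fps_nth \<kappa>))) * cmap (fps_const (fps_nth Md 0)))"
    using main(1) unfolding \<kappa> C Md by (simp add: cmap_const) (simp add: cmap_def)
  hence "(cmap Md * cmap (inverse Md)) * fls.Fser n =
      fls.Rser ?iv' n * (cmap (Abs_fps (logsol ?iv (fps_nth \<kappa>))) * cmap (fps_const (fps_nth Md 0)) * cmap (inverse Md))"
    by (metis (no_types, lifting) mult.assoc mult.commute)
  hence "fls.Fser n = fls.Rser ?iv' n * cmap (Abs_fps (logsol ?iv (fps_nth \<kappa>)) * fps_const (fps_nth Md 0) * inverse Md)"
    unfolding inv by (simp only: cmap_hom.hom_mult mult_1)
  thus ?thesis by (rule that)
qed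

interpretation fps_to_fls_hom: comm_ring_hom "fps_to_fls :: 'a :: field_char_0 fps \<Rightarrow> 'a fls"
  by unfold_locales (auto simp: fls_times_fps_to_fls)

text \<open>The coefficients are power series in \<open>q\<close>, but values are taken in Laurent
  series, so that negative powers of \<open>q\<close> can be put for the variable.\<close>

definition ev :: "'a :: field_char_0 fls \<Rightarrow> 'a fps poly \<Rightarrow> 'a fls" where
  "ev U p = poly (map_poly fps_to_fls p) U"

interpretation ev_hom: comm_ring_hom "ev U"
proof -
  interpret map_poly_comm_ring_hom "fps_to_fls :: 'a :: field_char_0 fps \<Rightarrow> 'a fls" ..
  show "comm_ring_hom (ev (U :: 'a fls))"
    by unfold_locales (auto simp: ev_def hom_distribs)
qed

lemma ev_const: "ev U [:c:] = fps_to_fls c"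
  by (cases "c = 0") (simp_all add: ev_def map_poly_pCons)

lemma ev_U: "ev U [:0, 1:] = U"
  by (simp add: ev_def map_poly_pCons)

lemma ev_sum: "ev U p = (\<Sum>i\<le>degree p. fps_to_fls (coeff p i) * U ^ i)"
proof -
  have "degree (map_poly fps_to_fls p) = degree p" by (rule degree_map_poly) auto
  thus ?thesis by (simp add: ev_def poly_altdef coeff_map_poly)
qed

lemma ev_nth:
  "fls_nth (fls_X powi (int s * int N) * ev (fls_X powi (- int s)) p) m =
     (\<Sum>i\<le>degree p. if m - int s * (int N - int i) \<ge> 0 then fps_nth (coeff p i) (nat (m - int s * (int N - int i))) else 0)"
proof -
  have "fls_X powi (int s * int N) * (fps_to_fls g * (fls_X powi (- int s)) ^ i) = fls_X powi (int s * (int N - int i)) * fps_to_fls g"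
    for i and g :: "'a fps"
  proof -
    have "(fls_X powi (- int s)) ^ i = (fls_X powi (- int s * int i) :: 'a fls)"
      by (simp only: power_int_mult power_int_of_nat)
    hence "fls_X powi (int s * int N) * (fls_X powi (- int s)) ^ i = (fls_X powi (int s * (int N - int i)) :: 'a fls)"
    proof -
      have "fls_X powi (int s * int N) * fls_X powi (- int s * int i) = (fls_X powi (int s * int N + - int s * int i) :: 'a fls)"
        by (rule power_int_add [symmetric]) simp
      also have "int s * int N + - int s * int i = int s * (int N - int i)" by (simp add: algebra_simps)
      finally show ?thesis unfolding \<open>(fls_X powi (- int s)) ^ i = _\<close> .
    qed
    hence "fls_X powi (int s * int N) * (fls_X powi (- int s)) ^ i * fps_to_fls g = fls_X powi (int s * (int N - int i)) * fps_to_fls g"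
      by (rule arg_cong)
    thus ?thesis by (simp only: mult_ac)
  qed
  hence "fls_X powi (int s * int N) * ev (fls_X powi (- int s)) p = (\<Sum>i\<le>degree p. fls_X powi (int s * (int N - int i)) * fps_to_fls (coeff p i))"
    by (simp only: ev_sum sum_distrib_left)
  thus ?thesis
    unfolding fls_X_powi by (auto simp add: fls_nth_sum fls_X_intpow_times_conv_shift intro!: sum.cong)
qed

text \<open>The values at \<open>q\<^sup>-\<^sup>s\<close>, as \<open>s\<close> grows, separate the coefficients by their order in \<open>q\<close>.\<close>

lemma constant_values_imp_monom:
  fixes p :: "'a :: field_char_0 fps poly"
  assumes "\<And>n. n > 0 \<Longrightarrow> \<exists>c. fls_X powi (int (4 * (n + 1)) * int N) * ev (fls_X powi (- int (4 * (n + 1)))) p = fls_const c"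
  shows "\<exists>c. p = monom (fps_const c) N"
proof -
  have nth0: "(\<Sum>i\<le>degree p. if m - int (4 * (n + 1)) * (int N - int i) \<ge> 0
      then fps_nth (coeff p i) (nat (m - int (4 * (n + 1)) * (int N - int i))) else 0) = 0" if "m \<noteq> 0" "n > 0" for m n
  proof -
    from assms[OF that(2)] obtain c where
      "fls_X powi (int (4 * (n + 1)) * int N) * ev (fls_X powi (- int (4 * (n + 1)))) p = fls_const c" by blast
    with ev_nth[of "4 * (n + 1)" N p m] that(1) show ?thesis by simp
  qed
  \<comment> \<open>The value shifts the coefficient \<open>p i\<close> by
    \<open>4 * (n + 1) * (N - i)\<close> in the order of \<open>q\<close>. If no other coefficient
    interferes at the order where the \<open>k\<close>-th term of \<open>p j\<close> appears, and
    this order is not 0, then that term is 0, because the value is constant.\<close>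
  have single: "fps_nth (coeff p j) k = 0"
    if j: "j \<le> degree p" and n: "n > 0" and kn: "int k - int (4 * (n + 1)) * (int j - int N) \<noteq> 0"
      and oth: "\<And>i. i \<le> degree p \<Longrightarrow> i \<noteq> j \<Longrightarrow> int k - int (4 * (n + 1)) * (int j - int i) \<ge> 0 \<Longrightarrow>
         fps_nth (coeff p i) (nat (int k - int (4 * (n + 1)) * (int j - int i))) = 0" for j k n
  proof -
    define m where "m = int k - int (4 * (n + 1)) * (int j - int N)"
    let ?t = "\<lambda>i. if m - int (4 * (n + 1)) * (int N - int i) \<ge> 0
      then fps_nth (coeff p i) (nat (m - int (4 * (n + 1)) * (int N - int i))) else 0"
    have e: "m - int (4 * (n + 1)) * (int N - int i) = int k - int (4 * (n + 1)) * (int j - int i)" for i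
      by (simp add: m_def algebra_simps)
    have "(\<Sum>i\<le>degree p. ?t i) = (\<Sum>i\<in>{j}. ?t i)"
    proof (rule sum.mono_neutral_right)
      show "\<forall>i\<in>{..degree p} - {j}. ?t i = 0"
      proof
        fix i assume "i \<in> {..degree p} - {j}"
        with oth[of i] show "?t i = 0" unfolding e by auto
      qed
    qed (use j in auto)
    also have "\<dots> = fps_nth (coeff p j) k" unfolding e by simp
    finally show ?thesis using nth0[OF _ n, of m] kn by (simp add: m_def)
  qed
  \<comment> \<open>With \<open>n = Suc k\<close> the shift exceeds the subdegree \<open>k\<close>,
    so the lowest term of the leading coefficient lies below everything that comes from smaller
    degrees.\<close>
  have deg: "degree p \<le> N"
  proof (rule ccontr)
    assume D: "\<not> degree p \<le> N"
    hence p: "coeff p (degree p) \<noteq> 0" by auto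
    define k where "k = subdegree (coeff p (degree p))"
    define s where "s = int (4 * (Suc k + 1))"
    have s: "s > int k" by (simp add: s_def)
    have far: "int k - s * d < 0" if "d \<ge> 1" for d
    proof -
      from mult_left_mono[of 1 d s] show ?thesis using that s by linarith
    qed
    have "fps_nth (coeff p (degree p)) k = 0"
    proof (rule single[of _ "Suc k"])
      show "int k - int (4 * (Suc k + 1)) * (int (degree p) - int N) \<noteq> 0"
        using far[of "int (degree p) - int N"] D unfolding s_def by linarith
      fix i assume i: "i \<le> degree p" "i \<noteq> degree p" "int k - int (4 * (Suc k + 1)) * (int (degree p) - int i) \<ge> 0"
      with far[of "int (degree p) - int i"] show "fps_nth (coeff p i) (nat (int k - int (4 * (Suc k + 1)) * (int (degree p) - int i))) = 0"
        unfolding s_def by linarith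
    qed simp_all
    thus False using p unfolding k_def by simp
  qed
  have top: "fps_nth (coeff p N) k = 0" if "k > 0" for k
  proof (cases "N \<le> degree p")
    case True
    with deg have N: "N = degree p" by simp
    define s where "s = int (4 * (Suc k + 1))"
    have s: "s > int k" by (simp add: s_def)
    have far: "int k - s * d < 0" if "d \<ge> 1" for d
    proof -
      from mult_left_mono[of 1 d s] show ?thesis using that s by linarith
    qed
    show ?thesis
    proof (rule single[of _ "Suc k"])
      fix i assume i: "i \<le> degree p" "i \<noteq> N" "int k - int (4 * (Suc k + 1)) * (int N - int i) \<ge> 0"
      with far[of "int N - int i"] N show "fps_nth (coeff p i) (nat (int k - int (4 * (Suc k + 1)) * (int N - int i))) = 0"
        unfolding s_def by linarith
    qed (use True that in simp_all)
  next
    case False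
    thus ?thesis by (simp add: coeff_eq_0)
  qed
  \<comment> \<open>Descending from \<open>N\<close>: the coefficients strictly between
    \<open>j\<close> and \<open>N\<close> are already 0, the one at \<open>N\<close> has only its
    constant term, and those below \<open>j\<close> begin at higher orders.\<close>
  have low: "coeff p j = 0" if "j < N" for j
    using that
  proof (induction "N - j" arbitrary: j rule: less_induct)
    case less
    have IH: "coeff p i = 0" if "j < i" "i < N" for i using less.hyps[of i] that less.prems by simp
    show ?case
    proof (rule ccontr)
      assume nz: "coeff p j \<noteq> 0"
      define k where "k = subdegree (coeff p j)"
      define s where "s = int (4 * (Suc k + 1))"
      have s: "s > int k" by (simp add: s_def)
      have far: "int k - s * d < 0" if "d \<ge> 1" for d
      proof -
        from mult_left_mono[of 1 d s] show ?thesis using that s by linarith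
      qed
      have far': "int k - s * d > 0" if "d \<le> - 1" for d
      proof -
        from mult_left_mono[of d "- 1" s] show ?thesis using that s by linarith
      qed
      have "fps_nth (coeff p j) k = 0"
      proof (rule single[of _ "Suc k"])
        show "j \<le> degree p" using nz by (rule le_degree)
        show "int k - int (4 * (Suc k + 1)) * (int j - int N) \<noteq> 0"
          using far'[of "int j - int N"] less.prems unfolding s_def by linarith
        fix i assume i: "i \<le> degree p" "i \<noteq> j" "int k - int (4 * (Suc k + 1)) * (int j - int i) \<ge> 0"
        have "\<not> i < j"
        proof
          assume "i < j"
          hence "int k - s * (int j - int i) < 0" by (intro far) simp
          thus False using i(3) unfolding s_def by linarith
        qed
        with i have "j < i" "i \<le> N" using deg by auto
        show "fps_nth (coeff p i) (nat (int k - int (4 * (Suc k + 1)) * (int j - int i))) = 0"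
        proof (cases "i = N")
          case True
          have "int k - s * (int j - int i) > 0" using \<open>j < i\<close> by (intro far') simp
          thus ?thesis unfolding True s_def by (intro top) simp
        next
          case False
          thus ?thesis using IH[of i] \<open>j < i\<close> \<open>i \<le> N\<close> by simp
        qed
      qed simp
      thus False using nz unfolding k_def by simp
    qed
  qed
  have "p = monom (fps_const (fps_nth (coeff p N) 0)) N"
  proof (rule poly_eqI)
    fix i
    consider "i < N" | "i = N" | "i > N" by linarith
    thus "coeff p i = coeff (monom (fps_const (fps_nth (coeff p N) 0)) N) i"
    proof cases
      case 2
      have "coeff p N = fps_const (fps_nth (coeff p N) 0)"
        by (rule fps_ext) (use top in auto)
      thus ?thesis using 2 by simp
    qed (use low deg in \<open>auto intro: coeff_eq_0\<close>)
  qed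
  thus ?thesis by blast
qed

section \<open>Both sides as polynomials in \<open>U\<close>, and their equality\<close>

definition xP :: "'a :: field_char_0 fps poly" where "xP = [:fps_X ^ 2:]"
definition UP :: "'a :: field_char_0 fps poly" where "UP = [:0, 1:]"
definition DP :: "nat \<Rightarrow> 'a :: field_char_0 fps poly" where "DP y = [:inverse (1 - (fps_X ^ 2) ^ y):]"
definition ivP :: "nat \<Rightarrow> 'a :: field_char_0 fps poly" where "ivP N = [:fps_const (inverse (of_nat N)):]"

definition weight_poly :: "nat \<Rightarrow> 'a :: field_char_0 fps poly" where
  "weight_poly N = (\<Sum>S | S \<in> pos_sets \<and> \<Sum>S = N. wt xP UP DP S)"

definition logsol_poly :: "nat \<Rightarrow> 'a :: field_char_0 fps poly" where
  "logsol_poly N = logsol ivP (lcoef xP UP DP) N"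

lemma fps_to_fls_inverse:
  fixes f :: "'a :: field_char_0 fps"
  assumes "f = 0 \<or> fps_nth f 0 \<noteq> 0"
  shows "fps_to_fls (inverse f) = inverse (fps_to_fls f)"
proof (cases "f = 0")
  case False
  hence "inverse f * f = 1" using assms by (intro inverse_mult_eq_1) auto
  hence "fps_to_fls (inverse f) * fps_to_fls f = 1" by (metis fls_times_fps_to_fls fps_one_to_fls)
  thus ?thesis by (metis inverse_unique mult.commute)
qed simp

lemma ev_data: "ev U xP = fls_X ^ 2" "ev U UP = U" "ev U (DP y) = inverse (1 - (fls_X ^ 2) ^ y)"
  "ev U (ivP N) = inverse (of_nat N)"
proof -
  have X: "fps_to_fls ((fps_X ^ 2) ^ y) = ((fls_X ^ 2) ^ y :: 'a fls)" for y
    by (simp add: fps_to_fls_power)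
  show "ev U xP = fls_X ^ 2" by (simp add: xP_def ev_const fps_to_fls_power)
  show "ev U UP = U" by (simp add: UP_def ev_U)
  \<comment> \<open>For \<open>y = 0\<close> both sides are \<open>inverse 0 = 0\<close>.\<close>
  have "1 - (fps_X ^ 2) ^ y = (0 :: 'a fps) \<or> fps_nth (1 - (fps_X ^ 2) ^ y :: 'a fps) 0 \<noteq> 0"
    by (cases y) (auto simp: power_mult [symmetric] fps_X_power_nth simp del: power_Suc)
  thus "ev U (DP y) = inverse (1 - (fls_X ^ 2) ^ y)"
    by (simp add: DP_def ev_const fps_to_fls_inverse X del: power_Suc)
  show "ev U (ivP N) = inverse (of_nat N)"
    by (simp add: ivP_def ev_const fls_of_nat fls_const_inverse)
qed

lemma ev_weight_poly: "ev U (weight_poly N) = (\<Sum>S | S \<in> pos_sets \<and> \<Sum>S = N. wt (fls_X ^ 2) U (\<lambda>y. inverse (1 - (fls_X ^ 2) ^ y)) S)"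
  by (simp only: weight_poly_def ev_hom.hom_sum ev_hom.hom_wt ev_data)

lemma ev_logsol_poly: "ev U (logsol_poly N) = logsol (\<lambda>N. inverse (of_nat N)) (lcoef (fls_X ^ 2) U (\<lambda>y. inverse (1 - (fls_X ^ 2) ^ y))) N"
  by (simp only: logsol_poly_def ev_hom.hom_logsol ev_hom.hom_lcoef ev_data)

lemma ev_weight_poly_special: "fls_X powi (int (4 * (n + 1)) * int N) * ev (fls_X powi (- int (4 * (n + 1)))) (weight_poly N) = fps_nth (fls.Fser n) N"
proof -
  have "- int (4 * (n + 1)) = - 4 * (int n + 1)" "int (4 * (n + 1)) = 4 * (int n + 1)" by simp_all
  thus ?thesis unfolding ev_weight_poly fls.Fser_def gser_nth sum_distrib_left
    unfolding \<open>- int (4 * (n + 1)) = _\<close> unfolding \<open>int (4 * (n + 1)) = _\<close>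
    by (intro sum.cong refl) (elim CollectE conjE, simp only:)
qed

lemma ev_logsol_poly_special: "fls_X powi (int (4 * (n + 1)) * int N) * ev (fls_X powi (- int (4 * (n + 1)))) (logsol_poly N) =
  fps_nth (fls.Rser (\<lambda>N. inverse (of_nat N)) n) N"
proof -
  have 1: "- int (4 * (n + 1)) = - 4 * (int n + 1)" "int (4 * (n + 1)) = 4 * (int n + 1)" by simp_all
  have "inverse (fls_X powi (- 4 * (int n + 1))) ^ N = (fls_X powi (4 * (int n + 1) * int N) :: 'a fls)"
  proof -
    have "inverse (fls_X powi (- 4 * (int n + 1))) = (fls_X powi (4 * (int n + 1)) :: 'a fls)"
      unfolding mult_minus_left power_int_minus inverse_inverse_eq ..
    thus ?thesis by (simp only: power_int_mult power_int_of_nat)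
  qed
  thus ?thesis unfolding ev_logsol_poly fls.Rser_def fps_nth_Abs_fps 1(1) unfolding 1(2) by (simp only:)
qed

lemma UX: "(fls_X powi (- 2) :: 'a :: field_char_0 fls) * fls_X ^ 2 = 1"
  by (simp add: power_int_minus)

text \<open>When \<open>U * x = 1\<close>, a hook of length 1 annihilates the weight, and the least
  element \<open>m\<close> of a nonempty \<open>S\<close> has one, from the gap
  \<open>m - 1\<close>.\<close>

lemma ev_weight_poly_trivial:
  assumes "N > 0"
  shows "ev (fls_X powi (- 2)) (weight_poly N) = 0"
  unfolding ev_weight_poly
proof (rule sum.neutral, rule ballI)
  fix S assume "S \<in> {S. S \<in> pos_sets \<and> \<Sum>S = N}"
  hence S: "finite S" "0 \<notin> S" "S \<noteq> {}" using assms by (auto simp: pos_sets_def)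
  define m where "m = Min S"
  have m: "m \<in> S" "m > 0" using S Min_in[of S] by (auto simp: m_def intro!: Nat.gr0I)
  have "m - 1 \<notin> S"
  proof
    assume "m - 1 \<in> S"
    hence "m \<le> m - 1" unfolding m_def by (rule Min_le[OF S(1)])
    thus False using m by simp
  qed
  hence h: "hk S m (m - 1) = 1" using m by (simp add: hk_def)
  have "(\<Prod>l=0..m. (1 - fls_X powi (- 2) * (fls_X ^ 2) ^ hk S m l) * inverse (1 - (fls_X ^ 2) ^ hk S m l)) = (0 :: 'a fls)"
    by (rule prod_zero) (use h UX in \<open>auto intro!: bexI[of _ "m - 1"]\<close>)
  hence "wfac (fls_X ^ 2) (fls_X powi (- 2)) (\<lambda>y. inverse (1 - (fls_X ^ 2) ^ y)) S m = (0 :: 'a fls)"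
    by (simp only: wfac_def mult_zero_left neg_equal_0_iff_equal)
  thus "wt (fls_X ^ 2) (fls_X powi (- 2)) (\<lambda>y. inverse (1 - (fls_X ^ 2) ^ y)) S = (0 :: 'a fls)"
    unfolding wt_def using S(1) m(1) by (intro prod_zero) auto
qed

lemma ev_logsol_poly_trivial:
  assumes "N > 0"
  shows "ev (fls_X powi (- 2)) (logsol_poly N) = 0"
proof -
  have "(fls_X powi (- 2)) ^ d * (fls_X ^ 2) ^ d = (1 :: 'a fls)" for d
    unfolding power_mult_distrib [symmetric] UX by simp
  hence "lcoef (fls_X ^ 2) (fls_X powi (- 2)) (\<lambda>y. inverse (1 - (fls_X ^ 2) ^ y)) k = (0 :: 'a fls)" for k
    unfolding lcoef_def by (simp only: diff_self mult_zero_left mult_zero_right sum.neutral_const neg_equal_0_iff_equal)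
  thus ?thesis unfolding ev_logsol_poly using assms by (subst logsol.simps) simp
qed

theorem weight_poly_eq_logsol_poly: "weight_poly N = (logsol_poly N :: 'a :: field_char_0 fps poly)"
proof (induction N rule: less_induct)
  case (less N)
  show ?case
  proof (cases "N = 0")
    case True
    have "{S. S \<in> pos_sets \<and> \<Sum>S = 0} = {{}}" by (auto simp: pos_sets_def)
    thus ?thesis using True by (simp add: weight_poly_def logsol_poly_def)
  next
    case False
    have "\<exists>c. weight_poly N - logsol_poly N = monom (fps_const c :: 'a fps) N"
    proof (rule constant_values_imp_monom)
      fix n :: nat assume n: "n > 0"
      let ?F = "fls.Fser n :: 'a fls fps" and ?R = "fls.Rser (\<lambda>N. inverse (of_nat N)) n :: 'a fls fps"
      obtain G :: "'a fps" where G: "?F = ?R * cmap G" by (rule Fser_factor[OF n])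
      have FR: "fps_nth ?F j = fps_nth ?R j" if "j < N" for j
        unfolding ev_weight_poly_special [symmetric] ev_logsol_poly_special [symmetric] less.IH[OF that] ..
      have R0: "fps_nth ?R 0 = 1" by (simp add: fls.Rser_def)
      have F0: "fps_nth ?F 0 = 1" by (rule fls.Fser_0)
      have G0: "fps_nth G 0 = 1"
      proof -
        have "fps_nth ?F 0 = fps_nth ?R 0 * fls_const (fps_nth G 0)"
          unfolding G by (simp add: cmap_def)
        thus ?thesis unfolding R0 F0 by simp
      qed
      \<comment> \<open>Both series start with 1, so the first nontrivial coefficient of
        \<open>G\<close> is exactly the difference of the coefficients.\<close>
      have conv: "fps_nth ?F j = fls_const (fps_nth G j) + fps_nth ?R j"
        if "j > 0" "\<And>i. 0 < i \<Longrightarrow> i < j \<Longrightarrow> fps_nth G i = 0" for j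
      proof -
        have "fps_nth ?F j = (\<Sum>i=0..j. fps_nth ?R i * fls_const (fps_nth G (j - i)))"
          unfolding G by (simp add: fps_mult_nth cmap_def)
        also have "\<dots> = (\<Sum>i\<in>{0, j}. fps_nth ?R i * fls_const (fps_nth G (j - i)))"
          by (rule sum.mono_neutral_right) (use that in auto)
        also have "\<dots> = fls_const (fps_nth G j) + fps_nth ?R j"
          using that(1) by (simp add: R0 G0)
        finally show ?thesis .
      qed
      have Gz: "fps_nth G j = 0" if "0 < j" "j < N" for j
        using that
      proof (induction j rule: less_induct)
        case (less j)
        have "fps_nth ?F j = fls_const (fps_nth G j) + fps_nth ?R j"
          using less by (intro conv) auto
        thus ?case using FR[of j] less.prems by simp
      qed
      have "fps_nth ?F N = fls_const (fps_nth G N) + fps_nth ?R N"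
        using False Gz by (intro conv) auto
      hence "fls_X powi (int (4 * (n + 1)) * int N) * ev (fls_X powi (- int (4 * (n + 1)))) (weight_poly N - logsol_poly N) = fls_const (fps_nth G N)"
        unfolding ev_hom.hom_minus right_diff_distrib ev_weight_poly_special ev_logsol_poly_special by simp
      thus "\<exists>c. fls_X powi (int (4 * (n + 1)) * int N) * ev (fls_X powi (- int (4 * (n + 1)))) (weight_poly N - logsol_poly N) = fls_const (c :: 'a)"
        by (rule exI)
    qed
    have N: "N > 0" using False by simp
    from \<open>\<exists>c. _\<close> obtain c :: 'a where c: "weight_poly N - logsol_poly N = monom (fps_const c) N" by blast
    have "ev (fls_X powi (- 2)) (monom (fps_const c) N) = 0"
      unfolding c [symmetric] ev_hom.hom_minus ev_weight_poly_trivial[OF N] ev_logsol_poly_trivial[OF N] by simp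
    moreover have "ev (fls_X powi (- 2)) (monom (fps_const c) N) = fls_const c * (fls_X powi (- 2)) ^ N"
      by (simp add: ev_def map_poly_monom poly_monom fps_const_to_fls)
    moreover have "(fls_X powi (- 2) :: 'a fls) ^ N \<noteq> 0"
      unfolding power_eq_0_iff power_int_eq_0_iff by simp
    ultimately have "c = 0" by (simp only: mult_eq_0_iff fls_const_eq_0_iff simp_thms)
    with c show ?thesis by simp
  qed
qed

section \<open>The partitions in DD'\<close>

lemma partition_part_antimono:
  assumes "l \<in> partitions" "1 \<le> i" "i \<le> j"
  shows "part l j \<le> part l i"
proof (cases "j \<le> length l")
  case True
  show ?thesis
  proof (cases "i = j")
    case False
    with assms True have "l ! (i - 1) \<ge> l ! (j - 1)"
      unfolding partitions_def by (auto simp: sorted_wrt_iff_nth_less)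
    thus ?thesis using assms True by (simp add: part_def)
  qed auto
qed (simp add: part_def)

lemma diagram_iff: "(i, j) \<in> diagram l \<longleftrightarrow> 1 \<le> i \<and> 1 \<le> j \<and> j \<le> part l i"
  by (auto simp: diagram_def part_def)

lemma finite_diagram: "finite (diagram l)"
proof -
  have "diagram l \<subseteq> (SIGMA i:{1..length l}. {1..part l i})"
    by (auto simp: diagram_def)
  thus ?thesis by (rule finite_subset) auto
qed

lemma down_closed_iff_card:
  fixes A :: "nat set"
  assumes "finite A" "0 \<notin> A" "\<And>i. i + 1 \<in> A \<Longrightarrow> i \<ge> 1 \<Longrightarrow> i \<in> A" "i \<ge> 1"
  shows "i \<in> A \<longleftrightarrow> i \<le> card A"
proof -
  have down: "j \<in> A" if "i \<in> A" "1 \<le> j" "j \<le> i" for i j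
    using that(3,1,2)
  proof (induction rule: inc_induct)
    case (step k)
    thus ?case using assms(3)[of k] by auto
  qed
  show ?thesis
  proof
    assume "i \<in> A"
    hence "{1..i} \<subseteq> A" using down by auto
    from card_mono[OF assms(1) this] show "i \<le> card A" by simp
  next
    assume i: "i \<le> card A"
    show "i \<in> A"
    proof (rule ccontr)
      assume "i \<notin> A"
      hence "A \<subseteq> {1..<i}" using down[of _ i] assms(2,4)
        by (auto simp: not_less intro!: Suc_leI Nat.gr0I) (metis not_le_imp_less)
      from card_mono[OF _ this] i assms(4) show False by simp
    qed
  qed
qed

lemma length_conjugate: "length (Defs.conjugate l) = part l 1"
  by (simp add: Defs.conjugate_def)

lemma part_conjugate:
  assumes l: "l \<in> partitions" and j: "j \<ge> 1"
  shows "part (Defs.conjugate l) j = card {i. (i, j) \<in> diagram l}"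
proof (cases "j \<le> part l 1")
  case True
  have "Defs.conjugate l ! (j - 1) = card {i. (i, j) \<in> diagram l}"
    unfolding Defs.conjugate_def using True j by (subst nth_map) (auto simp del: upt_Suc)
  thus ?thesis using True j by (simp add: part_def[of "Defs.conjugate l"] length_conjugate)
next
  case False
  have "(i, j) \<notin> diagram l" for i
    using partition_part_antimono[OF l, of 1 i] False by (auto simp: diagram_iff)
  moreover have "part (Defs.conjugate l) j = 0" using False by (simp add: part_def[of "Defs.conjugate l"] length_conjugate)
  ultimately show ?thesis by simp
qed

lemma finite_column: "finite {i. (i, j) \<in> diagram l}"
  by (rule finite_subset[of _ "fst ` diagram l"]) (force, simp add: finite_diagram)

lemma diagram_iff_conjugate:
  assumes l: "l \<in> partitions" and "i \<ge> 1" "j \<ge> 1"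
  shows "(i, j) \<in> diagram l \<longleftrightarrow> i \<le> part (Defs.conjugate l) j"
proof -
  have "i \<in> {i. (i, j) \<in> diagram l} \<longleftrightarrow> i \<le> card {i. (i, j) \<in> diagram l}"
  proof (rule down_closed_iff_card)
    fix k assume "k + 1 \<in> {i. (i, j) \<in> diagram l}" "k \<ge> 1"
    thus "k \<in> {i. (i, j) \<in> diagram l}"
      using partition_part_antimono[OF l, of k "k + 1"] by (auto simp: diagram_iff)
  next
    show "finite {i. (i, j) \<in> diagram l}" by (rule finite_column)
    show "0 \<notin> {i. (i, j) \<in> diagram l}" by (simp add: diagram_iff)
    show "i \<ge> 1" by (rule assms)
  qed
  thus ?thesis using part_conjugate[OF l assms(3)] by simp
qed

lemma galois:
  assumes "l \<in> partitions" "i \<ge> 1" "j \<ge> 1"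
  shows "j \<le> part l i \<longleftrightarrow> i \<le> part (Defs.conjugate l) j"
  using diagram_iff_conjugate[OF assms] assms by (simp add: diagram_iff)

lemma part_pos:
  assumes "l \<in> partitions" "1 \<le> i" "i \<le> length l"
  shows "part l i \<ge> 1"
proof -
  have "l ! (i - 1) \<in> set l" using assms by simp
  hence "l ! (i - 1) \<noteq> 0" using assms(1) unfolding partitions_def by (metis (mono_tags, lifting) mem_Collect_eq)
  with assms show ?thesis by (simp add: part_def)
qed

lemma partitionsI:
  assumes "\<And>i. 1 \<le> i \<Longrightarrow> i + 1 \<le> length l \<Longrightarrow> part l (i + 1) \<le> part l i"
    and "\<And>i. 1 \<le> i \<Longrightarrow> i \<le> length l \<Longrightarrow> part l i \<ge> 1"
  shows "l \<in> partitions"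
proof -
  have "0 \<notin> set l"
  proof
    assume "0 \<in> set l"
    then obtain i where "i < length l" "l ! i = 0" by (metis in_set_conv_nth)
    with assms(2)[of "i + 1"] show False by (simp add: part_def)
  qed
  moreover have "sorted_wrt (\<ge>) l"
  proof (rule sorted_wrt_iff_nth_less[THEN iffD2], intro allI impI)
    fix i j assume ij: "i < j" "j < length l"
    have "part l (j + 1) \<le> part l (i + 1)"
      using ij
    proof (induction j rule: less_Suc_induct)
      case (1 k)
      thus ?case using assms(1)[of "k + 1"] by simp
    next
      case (2 i j k)
      thus ?case by simp
    qed
    thus "l ! i \<ge> l ! j" using ij by (simp add: part_def)
  qed
  ultimately show ?thesis by (simp add: partitions_def)
qed

lemma conjugate_partitions:
  assumes l: "l \<in> partitions"
  shows "Defs.conjugate l \<in> partitions"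
proof (rule partitionsI)
  fix j assume j: "1 \<le> j" "j + 1 \<le> length (Defs.conjugate l)"
  show "part (Defs.conjugate l) (j + 1) \<le> part (Defs.conjugate l) j"
    unfolding part_conjugate[OF l j(1)] part_conjugate[OF l le_add2]
    by (rule card_mono[OF finite_column]) (use j in \<open>auto simp: diagram_iff\<close>)
next
  fix j assume j: "1 \<le> j" "j \<le> length (Defs.conjugate l)"
  thus "part (Defs.conjugate l) j \<ge> 1" using galois[OF l _ j(1), of 1] by (simp add: length_conjugate)
qed

lemma diagram_conjugate: "l \<in> partitions \<Longrightarrow> (i, j) \<in> diagram (Defs.conjugate l) \<longleftrightarrow> (j, i) \<in> diagram l"
  using galois[of l j i] by (auto simp: diagram_iff)

lemma le_iff_eqI: "(\<And>j. j \<ge> 1 \<Longrightarrow> j \<le> a \<longleftrightarrow> j \<le> b) \<Longrightarrow> a = (b :: nat)"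
  by (metis One_nat_def le_antisym less_eq_Suc_le linorder_not_less order_refl zero_order(1) not_gr_zero)

lemma partition_eqI:
  assumes "l \<in> partitions" "k \<in> partitions" "diagram l = diagram k"
  shows "l = k"
proof -
  have p: "part l i = part k i" if "i \<ge> 1" for i
  proof (rule le_iff_eqI)
    fix j :: nat assume "j \<ge> 1"
    with assms(3) that show "j \<le> part l i \<longleftrightarrow> j \<le> part k i" by (metis diagram_iff)
  qed
  have len: "i \<le> length m \<longleftrightarrow> part m i \<ge> 1" if "m \<in> partitions" "i \<ge> 1" for m i
    using part_pos[OF that(1,2)] that(2) by (auto simp: part_def split: if_splits)
  have "length l = length k"
    by (rule le_iff_eqI) (use len assms p in auto)
  thus ?thesis
  proof (rule nth_equalityI)
    fix i assume "i < length l"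
    thus "l ! i = k ! i" using p[of "i + 1"] \<open>length l = length k\<close> by (simp add: part_def)
  qed
qed

lemma conjugate_conjugate: "l \<in> partitions \<Longrightarrow> Defs.conjugate (Defs.conjugate l) = l"
proof (rule partition_eqI)
  assume l: "l \<in> partitions"
  show "diagram (Defs.conjugate (Defs.conjugate l)) = diagram l"
    using diagram_conjugate[OF conjugate_partitions[OF l]] diagram_conjugate[OF l] by auto
qed (auto intro: conjugate_partitions)

lemma durfee_iff:
  assumes l: "l \<in> partitions" and i: "i \<ge> 1"
  shows "i \<le> durfee l \<longleftrightarrow> i \<le> part l i"
proof -
  let ?A = "{s. 1 \<le> s \<and> s \<le> length l \<and> part l s \<ge> s}"
  have fin: "finite (insert 0 ?A)" by (rule finite_subset[of _ "{..length l}"]) auto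
  have mem: "s \<in> ?A \<longleftrightarrow> 1 \<le> s \<and> s \<le> part l s" for s by (auto simp: part_def split: if_splits)
  show ?thesis
  proof
    assume le: "i \<le> durfee l"
    hence "durfee l \<noteq> 0" using i by simp
    moreover have "durfee l \<in> insert 0 ?A" unfolding durfee_def by (rule Max_in[OF fin]) simp
    ultimately have "durfee l \<in> ?A" by simp
    hence "durfee l \<le> part l (durfee l)" by simp
    also have "\<dots> \<le> part l i" by (rule partition_part_antimono[OF l i le])
    finally show "i \<le> part l i" using le by simp
  next
    assume "i \<le> part l i"
    hence "i \<in> insert 0 ?A" using mem[of i] i by simp
    thus "i \<le> durfee l" unfolding durfee_def using fin by (rule Max_ge[rotated])
  qed
qed

lemma durfee_conjugate: "l \<in> partitions \<Longrightarrow> durfee (Defs.conjugate l) = durfee l"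
  by (rule le_iff_eqI) (simp add: durfee_iff conjugate_partitions galois)

lemma DD'_iff: "l \<in> DD' \<longleftrightarrow> l \<in> partitions \<and> (\<forall>i. 1 \<le> i \<and> i \<le> durfee l \<longrightarrow> part (Defs.conjugate l) i = part l i + 1)"
proof
  assume "l \<in> DD'"
  then obtain k where "k \<in> DD" "l = Defs.conjugate k" by (auto simp: DD'_def)
  thus "l \<in> partitions \<and> (\<forall>i. 1 \<le> i \<and> i \<le> durfee l \<longrightarrow> part (Defs.conjugate l) i = part l i + 1)"
    by (auto simp: DD_def conjugate_partitions conjugate_conjugate durfee_conjugate)
next
  assume *: "l \<in> partitions \<and> (\<forall>i. 1 \<le> i \<and> i \<le> durfee l \<longrightarrow> part (Defs.conjugate l) i = part l i + 1)"
  hence "Defs.conjugate l \<in> DD"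
    by (auto simp: DD_def conjugate_partitions conjugate_conjugate durfee_conjugate)
  thus "l \<in> DD'" unfolding DD'_def using * by (metis conjugate_conjugate imageI)
qed

text \<open>The leg lengths of the boxes on the main diagonal; the arm lengths are smaller by one.\<close>

definition legs :: "nat list \<Rightarrow> nat set" where
  "legs l = (\<lambda>i. part (Defs.conjugate l) i - i) ` {1..durfee l}"

text \<open>Row lengths \<open>a\<close>, column lengths \<open>b\<close> and Durfee size
  \<open>d\<close> of a partition in \<open>DD'\<close>. The equivalence \<open>gal\<close> is all
  that is used about conjugation.\<close>

locale doubled =
  fixes a b :: "nat \<Rightarrow> nat" and d :: nat
  assumes gal: "\<And>i j. i \<ge> 1 \<Longrightarrow> j \<ge> 1 \<Longrightarrow> j \<le> a i \<longleftrightarrow> i \<le> b j"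
    and dur: "\<And>i. i \<ge> 1 \<Longrightarrow> i \<le> d \<longleftrightarrow> i \<le> a i"
    and dd: "\<And>i. 1 \<le> i \<Longrightarrow> i \<le> d \<Longrightarrow> b i = a i + 1"
begin

lemma a_mono: assumes "1 \<le> i" "i \<le> j" shows "a j \<le> a i"
proof (cases "a j = 0")
  case False
  hence "j \<le> b (a j)" using gal[of j "a j"] assms by auto
  thus ?thesis using gal[of i "a j"] assms False by auto
qed auto

lemma b_mono: assumes "1 \<le> i" "i \<le> j" shows "b j \<le> b i"
proof (cases "b j = 0")
  case False
  hence "j \<le> a (b j)" using gal[of "b j" j] assms by auto
  thus ?thesis using gal[of "b j" i] assms False by auto
qed auto

text \<open>A box at \<open>(i, j)\<close> makes \<open>a i + b j\<close> at least
  \<open>i + j\<close>, its absence at most \<open>i + j - 2\<close>. The skipped value separates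
  the legs from the gaps in \<open>notin_col\<close> and \<open>notin_row\<close>.\<close>

lemma excl: "i \<ge> 1 \<Longrightarrow> j \<ge> 1 \<Longrightarrow> a i + b j + 1 \<noteq> i + j"
  using gal[of i j] by linarith

lemma a_ge: "1 \<le> i \<Longrightarrow> i \<le> d \<Longrightarrow> i \<le> a i" using dur by blast
lemma a_lt: "d < i \<Longrightarrow> a i < i" using dur[of i] by linarith
lemma b_lt: "d < i \<Longrightarrow> b i < i" using dur[of i] gal[of i i] by linarith

definition S where "S = (\<lambda>i. b i - i) ` {1..d}"

lemma leg_strict: assumes "1 \<le> i" "i < j" "j \<le> d" shows "b j - j < b i - i"
  using b_mono[of i j] dd[of i] dd[of j] a_ge[of i] a_ge[of j] assms by auto

lemma inj_legs: "inj_on (\<lambda>i. b i - i) {1..d}"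
proof (rule linorder_inj_onI)
  fix i j assume "i < j" "i \<in> {1..d}" "j \<in> {1..d}"
  thus "b i - i \<noteq> b j - j" using leg_strict[of i j] by auto
qed auto

lemma S_pos: "S \<in> pos_sets"
proof -
  have "b i - i \<noteq> 0" if "1 \<le> i" "i \<le> d" for i using dd[OF that] a_ge[OF that] by simp
  thus ?thesis by (auto simp: S_def pos_sets_def image_iff)
qed

lemma notin_col: assumes "d < i" shows "i - 1 - a i \<notin> S"
proof
  assume "i - 1 - a i \<in> S"
  then obtain j where j: "1 \<le> j" "j \<le> d" "i - 1 - a i = b j - j" by (auto simp: S_def)
  with excl[of i j] a_lt[OF assms] dd[of j] a_ge[of j] show False by auto
qed

lemma notin_row: assumes "d < j" shows "j - b j \<notin> S"
proof
  assume "j - b j \<in> S"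
  then obtain i where i: "1 \<le> i" "i \<le> d" "j - b j = b i - i" by (auto simp: S_def)
  with excl[of i j] b_lt[OF assms] dd[of i] a_ge[of i] show False by auto
qed

text \<open>With \<open>m = b k - k\<close>, a row \<open>i \<le> d\<close> has the hook
  \<open>m + l\<close> for the leg \<open>l = b i - i\<close>, and a row \<open>i > d\<close> has
  \<open>m - l\<close> for the gap \<open>l = i - 1 - a i\<close>. The \<open>m + 1\<close> rows
  yield distinct \<open>l\<close> between 0 and \<open>m\<close>, hence each of them once.\<close>

lemma column:
  assumes k: "1 \<le> k" "k \<le> d"
  shows "(\<Prod>i=k..b k. F ((a i - k) + (b k - i) + 1)) = (\<Prod>l=0..b k - k. F (hk S (b k - k) l) :: 'r :: comm_monoid_mult)"
proof -
  define g where "g i = (if i \<le> d then b i - i else i - 1 - a i)" for i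
  have bk: "b k = a k + 1" "k \<le> a k" using dd[OF k] a_ge[OF k] by auto
  have ai: "k \<le> a i" if "i \<in> {k..b k}" for i using gal[of i k] that k by auto
  have hook: "(a i - k) + (b k - i) + 1 = hk S (b k - k) (g i) \<and> g i \<in> {0..b k - k}" if i: "i \<in> {k..b k}" for i
  proof (cases "i \<le> d")
    case True
    hence "b i - i \<in> S" using i k by (auto simp: S_def)
    moreover have "b i = a i + 1" "i \<le> a i" using True i k dd[of i] a_ge[of i] by auto
    moreover have "b i - i \<le> b k - k" using b_mono[of k i] i k by auto
    ultimately show ?thesis using True i ai[OF i] bk by (auto simp: hk_def g_def)
  next
    case False
    thus ?thesis using notin_col[of i] a_lt[of i] ai[OF i] i by (auto simp: hk_def g_def)
  qed
  have inj: "inj_on g {k..b k}"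
  proof (rule linorder_inj_onI)
    fix i j assume ij: "i < j" "i \<in> {k..b k}" "j \<in> {k..b k}"
    consider "j \<le> d" | "i \<le> d" "d < j" | "d < i" using ij by linarith
    thus "g i \<noteq> g j"
    proof cases
      case 1
      thus ?thesis using leg_strict[of i j] ij k by (auto simp: g_def)
    next
      case 2
      hence "g i \<in> S" using ij k by (auto simp: g_def S_def)
      moreover have "g j \<notin> S" using 2 notin_col[of j] by (simp add: g_def)
      ultimately show ?thesis by auto
    next
      case 3
      thus ?thesis using a_mono[of i j] a_lt[of i] a_lt[of j] ij k by (auto simp: g_def)
    qed
  qed auto
  have "g ` {k..b k} = {0..b k - k}"
  proof (rule card_subset_eq)
    show "g ` {k..b k} \<subseteq> {0..b k - k}" using hook by blast
    show "card (g ` {k..b k}) = card {0..b k - k}" using card_image[OF inj] bk by simp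
  qed simp
  with inj have "bij_betw g {k..b k} {0..b k - k}" by (simp add: bij_betw_def)
  from prod.reindex_bij_betw[OF this, of "\<lambda>l. F (hk S (b k - k) l)"]
  show ?thesis by (subst prod.cong[OF refl arg_cong[of _ _ F, OF conjunct1[OF hook]]])
qed

text \<open>As in \<open>column\<close>, with the gap \<open>l = j - b j\<close> for
  \<open>j > d\<close>. The diagonal box is counted in the column, and the \<open>m - 1\<close>
  remaining boxes avoid \<open>l = 0\<close> and \<open>l = m\<close>.\<close>

lemma row:
  assumes k: "1 \<le> k" "k \<le> d"
  shows "(\<Prod>j=k + 1..a k. F ((a k - j) + (b j - k) + 1)) = (\<Prod>l=1..<b k - k. F (hk S (b k - k) l) :: 'r :: comm_monoid_mult)"
proof -
  define g where "g j = (if j \<le> d then b j - j else j - b j)" for j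
  have bk: "b k = a k + 1" "k \<le> a k" using dd[OF k] a_ge[OF k] by auto
  have bj: "k \<le> b j" if "j \<in> {k + 1..a k}" for j using gal[of k j] that k by auto
  have hook: "(a k - j) + (b j - k) + 1 = hk S (b k - k) (g j) \<and> g j \<in> {1..<b k - k}" if j: "j \<in> {k + 1..a k}" for j
  proof (cases "j \<le> d")
    case True
    hence "b j - j \<in> S" using j k by (auto simp: S_def)
    moreover have "b j = a j + 1" "j \<le> a j" using True j k dd[of j] a_ge[of j] by auto
    moreover have "b j - j < b k - k" using leg_strict[of k j] True j k by auto
    ultimately show ?thesis using True j bj[OF j] bk by (auto simp: hk_def g_def)
  next
    case False
    thus ?thesis using notin_row[of j] b_lt[of j] bj[OF j] j bk by (auto simp: hk_def g_def)
  qed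
  have inj: "inj_on g {k + 1..a k}"
  proof (rule linorder_inj_onI)
    fix i j assume ij: "i < j" "i \<in> {k + 1..a k}" "j \<in> {k + 1..a k}"
    consider "j \<le> d" | "i \<le> d" "d < j" | "d < i" using ij by linarith
    thus "g i \<noteq> g j"
    proof cases
      case 1
      thus ?thesis using leg_strict[of i j] ij k by (auto simp: g_def)
    next
      case 2
      hence "g i \<in> S" using ij k by (auto simp: g_def S_def)
      moreover have "g j \<notin> S" using 2 notin_row[of j] by (simp add: g_def)
      ultimately show ?thesis by auto
    next
      case 3
      thus ?thesis using b_mono[of i j] b_lt[of i] b_lt[of j] ij k by (auto simp: g_def)
    qed
  qed auto
  have "g ` {k + 1..a k} = {1..<b k - k}"
  proof (rule card_subset_eq)
    show "g ` {k + 1..a k} \<subseteq> {1..<b k - k}" using hook by blast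
    show "card (g ` {k + 1..a k}) = card {1..<b k - k}" using card_image[OF inj] bk by simp
  qed simp
  with inj have "bij_betw g {k + 1..a k} {1..<b k - k}" by (simp add: bij_betw_def)
  from prod.reindex_bij_betw[OF this, of "\<lambda>l. F (hk S (b k - k) l)"]
  show ?thesis by (subst prod.cong[OF refl arg_cong[of _ _ F, OF conjunct1[OF hook]]])
qed

text \<open>The diagram is cut into principal hooks, numbered by \<open>min i j\<close>. The corner
  joins the column because \<open>eps'\<close> is \<open>- 1\<close> on the diagonal.\<close>

lemma prod_boxes:
  fixes F :: "nat \<times> nat \<Rightarrow> 'r :: comm_monoid_mult"
  assumes "finite X" and X: "\<And>i j. (i, j) \<in> X \<longleftrightarrow> 1 \<le> i \<and> 1 \<le> j \<and> j \<le> a i"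
  shows "(\<Prod>s\<in>X. F s) = (\<Prod>k=1..d. (\<Prod>i=k..b k. F (i, k)) * (\<Prod>j=k + 1..a k. F (k, j)))"
proof -
  let ?g = "\<lambda>(i, j). min i j :: nat"
  have "?g ` X \<subseteq> {1..d}"
  proof
    fix k assume "k \<in> ?g ` X"
    then obtain i j where ij: "(i, j) \<in> X" "k = min i j" by auto
    have "k \<le> a k"
    proof (cases "i \<le> j")
      case True
      thus ?thesis using ij X[of i j] by auto
    next
      case False
      hence "k = j" "1 \<le> j" "j \<le> a i" using ij X[of i j] by auto
      thus ?thesis using a_mono[of j i] False by auto
    qed
    thus "k \<in> {1..d}" using ij X[of i j] dur[of k] by auto
  qed
  hence "(\<Prod>s\<in>X. F s) = (\<Prod>k=1..d. \<Prod>s | s \<in> X \<and> ?g s = k. F s)"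
    using assms(1) by (intro prod.group [symmetric]) auto
  also have "\<dots> = (\<Prod>k=1..d. (\<Prod>i=k..b k. F (i, k)) * (\<Prod>j=k + 1..a k. F (k, j)))"
  proof (rule prod.cong[OF refl])
    fix k assume "k \<in> {1..d}"
    hence k: "1 \<le> k" "k \<le> d" by auto
    have "{s. s \<in> X \<and> ?g s = k} = (\<lambda>i. (i, k)) ` {k..b k} \<union> (\<lambda>j. (k, j)) ` {k + 1..a k}"
    proof (intro Set.set_eqI iffI)
      fix s assume s: "s \<in> {s. s \<in> X \<and> ?g s = k}"
      obtain i j where ij: "s = (i, j)" by (cases s)
      show "s \<in> (\<lambda>i. (i, k)) ` {k..b k} \<union> (\<lambda>j. (k, j)) ` {k + 1..a k}"
      proof (cases "j \<le> i")
        case True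
        thus ?thesis using s ij X[of i j] gal[of i j] by auto
      next
        case False
        thus ?thesis using s ij X[of i j] by auto
      qed
    next
      fix s assume "s \<in> (\<lambda>i. (i, k)) ` {k..b k} \<union> (\<lambda>j. (k, j)) ` {k + 1..a k}"
      thus "s \<in> {s. s \<in> X \<and> ?g s = k}"
        using k X gal[of _ k] by auto
    qed
    moreover have "(\<lambda>i. (i, k)) ` {k..b k} \<inter> (\<lambda>j. (k, j)) ` {k + 1..a k} = {}" by auto
    ultimately show "(\<Prod>s | s \<in> X \<and> ?g s = k. F s) = (\<Prod>i=k..b k. F (i, k)) * (\<Prod>j=k + 1..a k. F (k, j))"
      by (simp add: prod.union_disjoint prod.reindex inj_on_def)
  qed
  finally show ?thesis .
qed

lemma prod_hooks:
  fixes F :: "int \<Rightarrow> nat \<Rightarrow> 'r :: comm_monoid_mult"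
  assumes "finite X" and X: "\<And>i j. (i, j) \<in> X \<longleftrightarrow> 1 \<le> i \<and> 1 \<le> j \<and> j \<le> a i"
  shows "(\<Prod>(i, j)\<in>X. F (eps' (i, j)) ((a i - j) + (b j - i) + 1)) =
    (\<Prod>m\<in>S. (\<Prod>l=0..m. F (- 1) (hk S m l)) * (\<Prod>l=1..<m. F 1 (hk S m l)))"
proof -
  have "(\<Prod>(i, j)\<in>X. F (eps' (i, j)) ((a i - j) + (b j - i) + 1)) =
    (\<Prod>k=1..d. (\<Prod>i=k..b k. F (- 1) ((a i - k) + (b k - i) + 1)) * (\<Prod>j=k + 1..a k. F 1 ((a k - j) + (b j - k) + 1)))"
    unfolding prod_boxes[OF assms]
    by (intro prod.cong refl arg_cong2[where f = "(*)"]) (auto simp: eps'_def)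
  also have "\<dots> = (\<Prod>k=1..d. (\<Prod>l=0..b k - k. F (- 1) (hk S (b k - k) l)) * (\<Prod>l=1..<b k - k. F 1 (hk S (b k - k) l)))"
    by (intro prod.cong refl arg_cong2[where f = "(*)"] column row) auto
  also have "\<dots> = (\<Prod>m\<in>S. (\<Prod>l=0..m. F (- 1) (hk S m l)) * (\<Prod>l=1..<m. F 1 (hk S m l)))"
    unfolding S_def by (subst prod.reindex[OF inj_legs]) simp
  finally show ?thesis .
qed

lemma card_boxes:
  assumes "finite X" and X: "\<And>i j. (i, j) \<in> X \<longleftrightarrow> 1 \<le> i \<and> 1 \<le> j \<and> j \<le> a i"
  shows "card X = 2 * \<Sum>S"
proof -
  \<comment> \<open>Taking every factor to be 2 reduces counting to
    \<open>prod_boxes\<close>.\<close>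
  have "(2 :: nat) ^ card X = (\<Prod>s\<in>X. 2)" by simp
  also have "\<dots> = (\<Prod>k=1..d. 2 ^ (2 * (b k - k)))"
    unfolding prod_boxes[OF assms]
  proof (rule prod.cong[OF refl])
    fix k assume "k \<in> {1..d}"
    hence "b k = a k + 1" "k \<le> a k" using dd[of k] a_ge[of k] by auto
    thus "(\<Prod>i=k..b k. 2) * (\<Prod>j=k + 1..a k. 2) = (2 :: nat) ^ (2 * (b k - k))"
      by (simp add: power_add [symmetric] mult_2)
  qed
  also have "\<dots> = 2 ^ (2 * \<Sum>S)"
    unfolding S_def sum.reindex[OF inj_legs] by (simp add: power_sum sum_distrib_left)
  finally show ?thesis by simp
qed

lemma le_count_iff:
  assumes "1 \<le> i" "1 \<le> t"
  shows "i \<le> card {m \<in> S. t \<le> m} \<longleftrightarrow> i \<le> d \<and> t \<le> b i - i"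
proof -
  let ?A = "{i \<in> {1..d}. t \<le> b i - i}"
  have "{m \<in> S. t \<le> m} = (\<lambda>i. b i - i) ` ?A" by (auto simp: S_def)
  hence "card {m \<in> S. t \<le> m} = card ?A"
  proof -
    have sub: "?A \<subseteq> {1..d}" by auto
    show ?thesis unfolding \<open>{m \<in> S. t \<le> m} = _\<close> by (rule card_image[OF inj_on_subset[OF inj_legs sub]])
  qed
  moreover have "i \<in> ?A \<longleftrightarrow> i \<le> card ?A"
  proof (rule down_closed_iff_card)
    fix k assume "k + 1 \<in> ?A" "k \<ge> 1"
    thus "k \<in> ?A" using leg_strict[of k "k + 1"] by auto
  qed (use assms in auto)
  ultimately show ?thesis using assms by auto
qed

text \<open>Legs decrease along the diagonal, so a box of the \<open>i\<close>-th principal hook is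
  present iff at least \<open>i\<close> legs are long enough. This recovers the diagram from the set
  of legs.\<close>

lemma box_iff_count:
  assumes "1 \<le> i" "1 \<le> j"
  shows "j \<le> a i \<longleftrightarrow> (if i \<le> j then i \<le> card {m \<in> S. j - i + 1 \<le> m} else j \<le> card {m \<in> S. i - j \<le> m})"
proof (cases "i \<le> j")
  case True
  have "j \<le> a i \<longleftrightarrow> i \<le> d \<and> j - i + 1 \<le> b i - i"
  proof (cases "i \<le> d")
    case d: True
    show ?thesis using d True dd[OF assms(1) d] a_ge[OF assms(1) d] by auto
  next
    case False
    thus ?thesis using a_lt[of i] True by auto
  qed
  thus ?thesis using True le_count_iff[OF assms(1), of "j - i + 1"] by simp
next
  case False
  have "j \<le> a i \<longleftrightarrow> j \<le> d \<and> i - j \<le> b j - j"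
  proof (cases "j \<le> d")
    case d: True
    show ?thesis using d False gal[OF assms] dd[OF assms(2) d] a_ge[OF assms(2) d] by auto
  next
    case f: False
    thus ?thesis using b_lt[of j] False gal[OF assms] by auto
  qed
  thus ?thesis using False le_count_iff[OF assms(2), of "i - j"] by simp
qed

end

lemma doubled_DD':
  assumes "l \<in> DD'"
  shows "doubled (part l) (part (Defs.conjugate l)) (durfee l)"
  using assms unfolding DD'_iff by unfold_locales (auto simp: galois durfee_iff)

lemma legs_eq: "l \<in> DD' \<Longrightarrow> legs l = doubled.S (part (Defs.conjugate l)) (durfee l)"
  by (simp add: legs_def doubled.S_def[OF doubled_DD'])

lemma sum_list_eq_card_diagram: "sum_list l = card (diagram l)"
proof -
  have "diagram l = (SIGMA i:{1..length l}. {1..part l i})"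
    by (auto simp: diagram_def)
  hence "card (diagram l) = (\<Sum>i=1..length l. part l i)" by simp
  also have "\<dots> = (\<Sum>i<length l. l ! i)"
    by (rule sum.reindex_bij_witness[of _ "\<lambda>i. i + 1" "\<lambda>i. i - 1"]) (auto simp: part_def)
  also have "\<dots> = sum_list l" by (simp add: sum_list_sum_nth lessThan_atLeast0)
  finally show ?thesis by simp
qed

lemma DD'_legs_data:
  assumes l: "l \<in> DD'"
  shows "durfee l = card (legs l)" "sum_list l = 2 * \<Sum>(legs l)" "legs l \<in> pos_sets"
    and "(\<Prod>s\<in>diagram l. F (eps' s) (hook l s)) =
      (\<Prod>m\<in>legs l. (\<Prod>k=0..m. F (- 1) (hk (legs l) m k)) * (\<Prod>k=1..<m. F 1 (hk (legs l) m k)) :: 'r :: comm_monoid_mult)"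
proof -
  interpret doubled "part l" "part (Defs.conjugate l)" "durfee l" by (rule doubled_DD'[OF l])
  note S = legs_eq[OF l]
  show "durfee l = card (legs l)" unfolding S S_def card_image[OF inj_legs] by simp
  show "sum_list l = 2 * \<Sum>(legs l)"
    unfolding S sum_list_eq_card_diagram by (rule card_boxes[OF finite_diagram]) (simp add: diagram_iff)
  show "legs l \<in> pos_sets" unfolding S by (rule S_pos)
  have "(\<Prod>s\<in>diagram l. F (eps' s) (hook l s)) =
     (\<Prod>(i, j)\<in>diagram l. F (eps' (i, j)) ((part l i - j) + (part (Defs.conjugate l) j - i) + 1))"
    by (intro prod.cong) (auto simp: hook_def)
  also have "\<dots> = (\<Prod>m\<in>S. (\<Prod>k=0..m. F (- 1) (hk S m k)) * (\<Prod>k=1..<m. F 1 (hk S m k)))"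
    by (rule prod_hooks[OF finite_diagram]) (simp add: diagram_iff)
  finally show "(\<Prod>s\<in>diagram l. F (eps' s) (hook l s)) =
      (\<Prod>m\<in>legs l. (\<Prod>k=0..m. F (- 1) (hk (legs l) m k)) * (\<Prod>k=1..<m. F 1 (hk (legs l) m k)))"
    unfolding S .
qed

lemma legs_inj: "inj_on legs DD'"
proof (rule inj_onI)
  fix l k assume *: "l \<in> DD'" "k \<in> DD'" "legs l = legs k"
  have "(i, j) \<in> diagram l \<longleftrightarrow> (i, j) \<in> diagram k" for i j
    using doubled.box_iff_count[OF doubled_DD'[OF *(1)], of i j] doubled.box_iff_count[OF doubled_DD'[OF *(2)], of i j] *(3)
    unfolding legs_eq[OF *(1)] legs_eq[OF *(2)] diagram_iff by auto
  hence "diagram l = diagram k" by auto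
  thus "l = k" using * by (intro partition_eqI) (auto simp: DD'_iff)
qed

lemma partition_of_diagram:
  assumes fin: "finite X" and pos: "\<And>i j. (i, j) \<in> X \<Longrightarrow> 1 \<le> i \<and> 1 \<le> j"
    and down1: "\<And>i j. (i + 1, j) \<in> X \<Longrightarrow> 1 \<le> i \<Longrightarrow> (i, j) \<in> X"
    and down2: "\<And>i j. (i, j + 1) \<in> X \<Longrightarrow> 1 \<le> j \<Longrightarrow> (i, j) \<in> X"
  obtains l where "l \<in> partitions" "diagram l = X"
proof -
  have finr: "finite {j. (i, j) \<in> X}" for i
  proof (rule finite_subset)
    show "{j. (i, j) \<in> X} \<subseteq> snd ` X"
    proof
      fix j assume "j \<in> {j. (i, j) \<in> X}"
      thus "j \<in> snd ` X" by (intro image_eqI[of _ _ "(i, j)"]) simp_all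
    qed
  qed (use fin in simp)
  have finc: "finite {i. (i, j) \<in> X}" for j
  proof (rule finite_subset)
    show "{i. (i, j) \<in> X} \<subseteq> fst ` X"
    proof
      fix i assume "i \<in> {i. (i, j) \<in> X}"
      thus "i \<in> fst ` X" by (intro image_eqI[of _ _ "(i, j)"]) simp_all
    qed
  qed (use fin in simp)
  have row: "(i, j) \<in> X \<longleftrightarrow> j \<le> card {j. (i, j) \<in> X}" if "j \<ge> 1" for i j
  proof -
    have "j \<in> {j. (i, j) \<in> X} \<longleftrightarrow> j \<le> card {j. (i, j) \<in> X}"
    proof (rule down_closed_iff_card[OF finr _ _ that])
      show "0 \<notin> {j. (i, j) \<in> X}" using pos[of i 0] by auto
      fix k assume "k + 1 \<in> {j. (i, j) \<in> X}" "k \<ge> 1"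
      thus "k \<in> {j. (i, j) \<in> X}" using down2[of i k] by simp
    qed
    thus ?thesis by simp
  qed
  have col: "(i, j) \<in> X \<longleftrightarrow> i \<le> card {i. (i, j) \<in> X}" if "i \<ge> 1" for i j
  proof -
    have "i \<in> {i. (i, j) \<in> X} \<longleftrightarrow> i \<le> card {i. (i, j) \<in> X}"
    proof (rule down_closed_iff_card[OF finc _ _ that])
      show "0 \<notin> {i. (i, j) \<in> X}" using pos[of 0 j] by auto
      fix k assume "k + 1 \<in> {i. (i, j) \<in> X}" "k \<ge> 1"
      thus "k \<in> {i. (i, j) \<in> X}" using down1[of k j] by simp
    qed
    thus ?thesis by simp
  qed
  define L where "L = card {i. (i, 1) \<in> X}"
  define l where "l = map (\<lambda>i. card {j. (i, j) \<in> X}) [1..<Suc L]"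
  have len: "length l = L" by (simp add: l_def)
  have part: "part l i = card {j. (i, j) \<in> X}" if i: "i \<ge> 1" for i
  proof (cases "i \<le> L")
    case True
    moreover have "[Suc 0..<Suc L] ! (i - Suc 0) = i"
      using i True nth_upt[of "Suc 0" "i - Suc 0" "Suc L"] by (simp del: upt_Suc)
    ultimately show ?thesis using i True by (simp add: part_def l_def del: upt_Suc)
  next
    case False
    hence "(i, 1) \<notin> X" using col[OF i, of 1] by (simp add: L_def)
    hence "\<not> 1 \<le> card {j. (i, j) \<in> X}" using row[of 1 i] by simp
    thus ?thesis using False by (simp add: part_def len)
  qed
  have "l \<in> partitions"
  proof (rule partitionsI)
    fix i assume i: "1 \<le> i" "i + 1 \<le> length l"
    show "part l (i + 1) \<le> part l i"
      unfolding part[OF i(1)] part[OF le_add2]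
      by (rule card_mono[OF finr]) (use down1 i in auto)
  next
    fix i assume i: "1 \<le> i" "i \<le> length l"
    hence "(i, 1) \<in> X" using col[OF i(1), of 1] by (simp add: len L_def)
    thus "part l i \<ge> 1" using row[of 1 i] part[OF i(1)] by simp
  qed
  moreover have "diagram l = X"
  proof -
    have "(i, j) \<in> diagram l \<longleftrightarrow> (i, j) \<in> X" for i j
    proof (cases "1 \<le> i \<and> 1 \<le> j")
      case True
      thus ?thesis using row[of j i] part[of i] by (simp add: diagram_iff)
    next
      case False
      thus ?thesis using pos[of i j] by (auto simp: diagram_iff)
    qed
    thus ?thesis by auto
  qed
  ultimately show ?thesis using that by blast
qed

lemma legs_surj:
  assumes S: "S \<in> pos_sets"
  obtains l where "l \<in> DD'" "legs l = S"
proof -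
  define c where "c t = card {m \<in> S. t \<le> m}" for t
  have fin: "finite S" "0 \<notin> S" using S by (auto simp: pos_sets_def)
  have fint: "finite {m \<in> S. t \<le> m}" for t using fin by simp
  have c_mono: "c t \<ge> c t'" if "t \<le> t'" for t t'
    unfolding c_def by (rule card_mono[OF fint]) (use that in auto)
  have c_step: "c t = (if t \<in> S then c (t + 1) + 1 else c (t + 1))" for t
  proof -
    have "{m \<in> S. t \<le> m} = (if t \<in> S then insert t {m \<in> S. t + 1 \<le> m} else {m \<in> S. t + 1 \<le> m})"
      by (auto simp: le_less Suc_le_eq)
    moreover have "card (insert t {m \<in> S. t + 1 \<le> m}) = c (t + 1) + 1"
      unfolding c_def by (subst card_insert_disjoint[OF fint]) auto
    ultimately show ?thesis by (simp add: c_def)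
  qed
  have c_big: "c t = 0" if "t > \<Sum>S" for t
  proof -
    have "m \<le> \<Sum>S" if "m \<in> S" for m using member_le_sum[OF that, of id] fin by simp
    hence "{m \<in> S. t \<le> m} = {}" using that by force
    thus ?thesis unfolding c_def by (simp only: card.empty)
  qed
  \<comment> \<open>The only possible diagram, dictated by \<open>box_iff_count\<close>.\<close>
  define X where "X = {(i, j). 1 \<le> i \<and> 1 \<le> j \<and> (if i \<le> j then i \<le> c (j - i + 1) else j \<le> c (i - j))}"
  have X: "(i, j) \<in> X \<longleftrightarrow> 1 \<le> i \<and> 1 \<le> j \<and> (if i \<le> j then i \<le> c (j - i + 1) else j \<le> c (i - j))" for i j
    by (simp add: X_def)
  have c_le: "c t \<le> card S" for t unfolding c_def by (rule card_mono[OF fin(1)]) auto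
  have "finite X"
  proof (rule finite_subset)
    show "X \<subseteq> {..card S + \<Sum>S} \<times> {..card S + \<Sum>S}"
    proof
      fix s assume s: "s \<in> X"
      obtain i j where ij: "s = (i, j)" by (cases s)
      show "s \<in> {..card S + \<Sum>S} \<times> {..card S + \<Sum>S}"
      proof (cases "i \<le> j")
        case True
        hence "1 \<le> i" "i \<le> c (j - i + 1)" using s X[of i j] ij by auto
        hence "j - i + 1 \<le> \<Sum>S" using c_big[of "j - i + 1"] by (cases "j - i + 1 \<le> \<Sum>S") auto
        moreover have "i \<le> card S" using \<open>i \<le> c _\<close> c_le[of "j - i + 1"] by simp
        ultimately show ?thesis using ij True by auto
      next
        case False
        hence "1 \<le> j" "j \<le> c (i - j)" using s X[of i j] ij by auto
        hence "i - j \<le> \<Sum>S" using c_big[of "i - j"] by (cases "i - j \<le> \<Sum>S") auto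
        moreover have "j \<le> card S" using \<open>j \<le> c _\<close> c_le[of "i - j"] by simp
        ultimately show ?thesis using ij False by auto
      qed
    qed
  qed simp
  moreover have "(i, j) \<in> X" if "(i + 1, j) \<in> X" "1 \<le> i" for i j
  proof -
    consider "i + 1 \<le> j" | "i = j" | "j < i" by linarith
    thus ?thesis
    proof cases
      case 1
      have "j - (i + 1) + 1 = j - i" using 1 by simp
      hence "i + 1 \<le> c (j - i)" using 1 that X[of "i + 1" j] by metis
      moreover have "c (j - i) \<le> c (j - i + 1) + 1" using c_step[of "j - i"] by simp
      ultimately show ?thesis using 1 that by (simp add: X)
    next
      case 2
      thus ?thesis using that X[of "i + 1" j] X[of i j] by auto
    next
      case 3
      hence "j \<le> c (i + 1 - j)" using that X[of "i + 1" j] by auto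
      also have "\<dots> \<le> c (i - j)" by (rule c_mono) simp
      finally show ?thesis using 3 that X[of i j] X[of "i + 1" j] by auto
    qed
  qed
  moreover have "(i, j) \<in> X" if "(i, j + 1) \<in> X" "1 \<le> j" for i j
  proof -
    consider "i \<le> j" | "i = j + 1" | "j + 1 < i" by linarith
    thus ?thesis
    proof cases
      case 1
      hence "i \<le> c (j + 1 - i + 1)" using that X[of i "j + 1"] by auto
      also have "\<dots> \<le> c (j - i + 1)" by (rule c_mono) simp
      finally show ?thesis using 1 that X[of i j] X[of i "j + 1"] by auto
    next
      case 2
      thus ?thesis using that X[of i "j + 1"] X[of i j] by auto
    next
      case 3
      hence "j + 1 \<le> c (i - (j + 1))" using that X[of i "j + 1"] by auto
      moreover have "c (i - (j + 1)) \<le> c (i - (j + 1) + 1) + 1" using c_step[of "i - (j + 1)"] by simp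
      moreover have "i - (j + 1) + 1 = i - j" using 3 by simp
      ultimately show ?thesis using 3 that X[of i j] by auto
    qed
  qed
  ultimately obtain l where l: "l \<in> partitions" "diagram l = X"
    using partition_of_diagram[of X] X by blast
  let ?a = "part l" and ?b = "part (Defs.conjugate l)"
  have row: "j \<le> ?a i \<longleftrightarrow> i \<le> c (j - i + 1)" if "1 \<le> i" "i \<le> j" for i j
    using X[of i j] that unfolding l(2) [symmetric] diagram_iff by auto
  have col: "i \<le> ?b j \<longleftrightarrow> j \<le> c (i - j)" if "1 \<le> j" "j < i" for i j
    using X[of i j] that diagram_iff_conjugate[OF l(1), of i j] unfolding l(2) [symmetric] by auto
  have dur: "i \<le> durfee l \<longleftrightarrow> i \<le> c 1" if "1 \<le> i" for i
    using row[OF that order_refl] durfee_iff[OF l(1) that] by simp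
  have eq: "j \<le> ?a i \<longleftrightarrow> j + 1 \<le> ?b i" if "1 \<le> i" "i \<le> j" for i j
    using row[OF that] col[of i "j + 1"] that by (simp add: Suc_diff_le)
  have bi: "?b i = ?a i + 1" if i: "1 \<le> i" "i \<le> durfee l" for i
  proof -
    have ai: "i \<le> ?a i" using durfee_iff[OF l(1) i(1)] i by simp
    have "?a i + 1 \<le> ?b i" using eq[OF i(1) ai] by simp
    moreover have "?b i - 1 \<le> ?a i" using eq[OF i(1), of "?b i - 1"] ai \<open>?a i + 1 \<le> ?b i\<close> by simp
    ultimately show ?thesis by simp
  qed
  have "l \<in> DD'" unfolding DD'_iff using l(1) bi by blast
  moreover have "legs l = S"
  proof (intro Set.set_eqI iffI)
    fix t assume "t \<in> legs l"
    then obtain i where i: "1 \<le> i" "i \<le> durfee l" "t = ?b i - i" by (auto simp: legs_def)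
    have "?b i = ?a i + 1" "i \<le> ?a i" using bi[OF i(1,2)] durfee_iff[OF l(1) i(1)] i by auto
    hence t: "?b i = i + t" "t \<ge> 1" using i(3) by auto
    have "i \<le> c t" using col[OF i(1), of "i + t"] t by simp
    moreover have "\<not> i \<le> c (t + 1)" using col[OF i(1), of "i + t + 1"] t by simp
    ultimately show "t \<in> S" using c_step[of t] by (auto split: if_splits)
  next
    fix t assume t: "t \<in> S"
    hence t1: "t \<ge> 1" using fin(2) by (cases t) auto
    define i where "i = c t"
    have ct: "c t = c (t + 1) + 1" using c_step[of t] t by simp
    have i: "1 \<le> i" using ct by (simp add: i_def)
    have "i \<le> durfee l" using dur[OF i] c_mono[OF t1] by (simp add: i_def)
    moreover have "i + t \<le> ?b i" using col[OF i, of "i + t"] t1 by (simp add: i_def)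
    moreover have "\<not> i + t + 1 \<le> ?b i" using col[OF i, of "i + t + 1"] ct by (simp add: i_def)
    ultimately show "t \<in> legs l" unfolding legs_def using i by (intro image_eqI[of _ _ i]) auto
  qed
  ultimately show ?thesis using that by blast
qed

lemma legs_bij: "bij_betw legs DD' pos_sets"
  unfolding bij_betw_def using legs_inj DD'_legs_data(3) legs_surj by blast

section \<open>The formal identity\<close>

lemma has_sum_gser:
  assumes "finite_fibres E I"
  shows "((\<lambda>p. fps_const (t p) * fps_X ^ E p) has_sum gser E t I) I"
  unfolding has_sum_def
proof (rule tendsto_fpsI)
  fix N
  show "eventually (\<lambda>F. fps_nth (\<Sum>p\<in>F. fps_const (t p) * fps_X ^ E p) N = fps_nth (gser E t I) N) (finite_subsets_at_top I)"
    unfolding eventually_finite_subsets_at_top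
  proof (intro exI[of _ "{p \<in> I. E p = N}"] conjI allI impI)
    fix F assume F: "finite F \<and> {p \<in> I. E p = N} \<subseteq> F \<and> F \<subseteq> I"
    have "fps_nth (\<Sum>p\<in>F. fps_const (t p) * fps_X ^ E p) N = (\<Sum>p\<in>F. if E p = N then t p else 0)"
      unfolding fps_sum_nth by (intro sum.cong refl) (simp add: fps_X_power_nth)
    also have "\<dots> = (\<Sum>p | p \<in> F \<and> E p = N. t p)"
      using F by (simp add: sum.inter_filter)
    also have "{p. p \<in> F \<and> E p = N} = {p \<in> I. E p = N}" using F by blast
    finally show "fps_nth (\<Sum>p\<in>F. fps_const (t p) * fps_X ^ E p) N = fps_nth (gser E t I) N"
      by (simp add: gser_nth)
  qed (use finite_fibresD[OF assms] in auto)
qed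

lemma has_sum_reindex_bij:
  assumes "bij_betw \<phi> J I" "(f has_sum S) I" "\<And>p. p \<in> J \<Longrightarrow> f' p = f (\<phi> p)"
  shows "(f' has_sum S) J"
proof -
  have "(f has_sum S) I \<longleftrightarrow> ((\<lambda>p. f (\<phi> p)) has_sum S) J"
    using has_sum_reindex_bij_betw[OF assms(1), of f S] by simp
  moreover have "((\<lambda>p. f (\<phi> p)) has_sum S) J \<longleftrightarrow> (f' has_sum S) J"
    by (rule has_sum_cong) (simp add: assms(3))
  ultimately show ?thesis using assms(2) by simp
qed

text \<open>The evaluation used for the result: coefficients remain power series in \<open>q\<close>
  but are extended by Laurent series in \<open>u\<close>, so that the variable can become the square
  of \<open>u\<close>.\<close>

definition evq :: "'a :: field_char_0 fls fps \<Rightarrow> 'a fps poly \<Rightarrow> 'a fls fps" where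
  "evq U p = poly (map_poly cmap p) U"

interpretation evq_hom: comm_ring_hom "evq U"
proof -
  interpret map_poly_comm_ring_hom "cmap :: 'a :: field_char_0 fps \<Rightarrow> 'a fls fps" ..
  show "comm_ring_hom (evq (U :: 'a fls fps))"
    by unfold_locales (auto simp: evq_def hom_distribs)
qed

lemma evq_const: "evq U [:c:] = cmap c"
  by (cases "c = 0") (simp_all add: evq_def map_poly_pCons)

lemma evq_U: "evq U [:0, 1:] = U"
  by (simp add: evq_def map_poly_pCons)

abbreviation xq :: "'a :: field_char_0 fls fps" where "xq \<equiv> fps_X\<^sup>2"

text \<open>The inverse is taken before \<open>cmap\<close> is applied, which makes
  \<open>Dq\<close> the image of \<open>DP\<close> under \<open>evq\<close>.\<close>

definition Dq :: "nat \<Rightarrow> 'a :: field_char_0 fls fps" where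
  "Dq y = cmap (inverse (1 - (fps_X\<^sup>2) ^ y))"

definition ivq :: "nat \<Rightarrow> 'a :: field_char_0 fls fps" where
  "ivq N = cmap (fps_const (inverse (of_nat N)))"

lemma cmap_X: "cmap fps_X = fps_X"
  by (auto simp: cmap_def fps_eq_iff fps_X_nth)

lemma Dq: assumes "y > 0" shows "(1 - xq ^ y) * Dq y = 1"
proof -
  have "fps_nth (1 - (fps_X\<^sup>2) ^ y :: 'a fps) 0 = 1"
    using assms by (simp add: fps_power_zeroth)
  hence "(1 - (fps_X\<^sup>2) ^ y) * inverse (1 - (fps_X\<^sup>2) ^ y :: 'a fps) = 1"
    by (subst mult.commute) (rule inverse_mult_eq_1, simp only: one_neq_zero not_False_eq_True)
  hence "cmap ((1 - (fps_X\<^sup>2) ^ y) * inverse (1 - (fps_X\<^sup>2) ^ y :: 'a fps)) = 1" by simp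
  thus ?thesis by (simp add: Dq_def hom_distribs cmap_X)
qed

lemma ivq: assumes "N > 0" shows "ivq N * of_nat N = 1"
proof -
  have "fps_const (inverse (of_nat N)) * of_nat N = (1 :: 'a fps)"
    unfolding fps_of_nat [symmetric] fps_const_mult using assms by simp
  hence "cmap (fps_const (inverse (of_nat N)) * of_nat N :: 'a fps) = 1" by simp
  thus ?thesis by (simp add: ivq_def hom_distribs)
qed

lemma wt_sum_eq_logsol:
  "(\<Sum>S | S \<in> pos_sets \<and> \<Sum>S = N. wt xq U Dq S) = logsol ivq (lcoef xq U Dq) N"
proof -
  have *: "evq U xP = xq" "evq U UP = U" "(\<lambda>y. evq U (DP y)) = Dq" "(\<lambda>n. evq U (ivP n)) = ivq"
    by (simp_all add: xP_def UP_def DP_def ivP_def evq_const evq_U Dq_def ivq_def fun_eq_iff hom_distribs cmap_X)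
  have "evq U (weight_poly N) = evq U (logsol_poly N)" by (simp only: weight_poly_eq_logsol_poly)
  thus ?thesis
    by (simp only: weight_poly_def logsol_poly_def evq_hom.hom_sum evq_hom.hom_wt evq_hom.hom_logsol evq_hom.hom_lcoef *)
qed

abbreviation Wq :: "'a :: field_char_0 fls fps" where "Wq \<equiv> fps_const (fls_X\<^sup>2)"
abbreviation Vq :: "'a :: field_char_0 fls fps" where "Vq \<equiv> fps_const (inverse (fls_X\<^sup>2))"

lemma VW: "Vq * Wq = 1"
  by (simp del: fps_const_power)

text \<open>\<open>lcoef\<close> divided by \<open>U ^ k\<close> and multiplied out, so that the
  four terms correspond to the four powers in \<open>prod_factor\<close>.\<close>

definition total_logd :: "nat \<Rightarrow> 'a :: field_char_0 fls fps" where
  "total_logd k = - (\<Sum>d | d dvd k. of_nat (k div d) *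
     ((Vq ^ d - xq ^ d - xq ^ (2 * d) + Wq ^ d * xq ^ (3 * d)) * (Dq d * Dq (2 * d))))"

lemma total_logd_eq: assumes "k > 0" shows "total_logd k = Vq ^ k * lcoef xq Wq Dq k"
proof -
  have VWd: "Vq ^ d * (Wq ^ d * z) = z" for d and z :: "'a fls fps"
    unfolding mult.assoc [symmetric] power_mult_distrib [symmetric] VW by simp
  have "of_nat (k div d) * ((Vq ^ d - xq ^ d - xq ^ (2 * d) + Wq ^ d * xq ^ (3 * d)) * (Dq d * Dq (2 * d))) =
      Vq ^ k * (of_nat (k div d) * (Wq ^ (k - d) * ((1 - Wq ^ d * xq ^ d) * (1 - Wq ^ d * xq ^ (2 * d))) * (Dq d * Dq (2 * d)) :: 'a fls fps))"
    if d: "d dvd k" for d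
  proof -
    have "k = d + (k - d)" using dvd_imp_le[OF d assms] by simp
    hence Vk: "Vq ^ k = Vq ^ d * (Vq ^ (k - d) :: 'a fls fps)" by (metis power_add)
    have "Vq ^ k * (Wq ^ (k - d) * ((1 - Wq ^ d * xq ^ d) * (1 - Wq ^ d * xq ^ (2 * d)))) =
        Vq ^ d * ((1 - Wq ^ d * xq ^ d) * (1 - Wq ^ d * xq ^ (2 * d)) :: 'a fls fps)"
      unfolding Vk mult.assoc VWd ..
    also have "\<dots> = Vq ^ d - Vq ^ d * (Wq ^ d * xq ^ d) - Vq ^ d * (Wq ^ d * xq ^ (2 * d)) + Vq ^ d * (Wq ^ d * (Wq ^ d * (xq ^ d * xq ^ (2 * d))))"
      by (simp only: algebra_simps mult_1 mult_1_right)
    also have "\<dots> = Vq ^ d - xq ^ d - xq ^ (2 * d) + Wq ^ d * xq ^ (3 * d)"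
      unfolding VWd by (simp only: power_add [symmetric]) simp
    finally have *: "Vq ^ k * (Wq ^ (k - d) * ((1 - Wq ^ d * xq ^ d) * (1 - Wq ^ d * xq ^ (2 * d)))) =
      (Vq ^ d - xq ^ d - xq ^ (2 * d) + Wq ^ d * xq ^ (3 * d) :: 'a fls fps)" .
    show ?thesis unfolding * [symmetric] by (simp only: mult_ac)
  qed
  thus ?thesis unfolding total_logd_def lcoef_def mult_minus_right sum_distrib_left
    by (intro arg_cong[where f = uminus] sum.cong refl) auto
qed

definition weight_series :: "'a :: field_char_0 fls fps fps" where
  "weight_series = gser (\<lambda>S. \<Sum>S) (\<lambda>S. Vq ^ \<Sum>S * wt xq Wq Dq S) pos_sets"

lemma weight_series_nth: "fps_nth weight_series N = logsol ivq total_logd N"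
proof -
  have "fps_nth weight_series N = (\<Sum>S | S \<in> pos_sets \<and> \<Sum>S = N. Vq ^ N * (wt xq Wq Dq S :: 'a fls fps))"
    unfolding weight_series_def gser_nth by (rule sum.cong) auto
  also have "\<dots> = Vq ^ N * logsol ivq (lcoef xq Wq Dq) N"
    unfolding sum_distrib_left [symmetric] wt_sum_eq_logsol ..
  also have "\<dots> = logsol ivq total_logd N"
    unfolding logsol_scale [symmetric] by (rule logsol_cong) (simp add: total_logd_eq)
  finally show ?thesis .
qed

lemma quotient_eqI:
  fixes f g h :: "'a :: field_char_0 fls fps fps"
  assumes "fps_nth (fps_nth g 0) 0 = 1" "g * h = f"
  shows "f / g = h"
proof -
  have "g \<noteq> 0" using assms(1) by auto
  moreover have "g * (f / g) = g * h" using fps_mult_divide_cancel[OF assms(1)] assms(2) by simp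
  ultimately show ?thesis by simp
qed

lemma fps_u_powi:
  "fps_u powi (- 2) = fps_const (Vq :: 'a :: field_char_0 fls fps)" "fps_u powi 2 = fps_const (Wq :: 'a fls fps)"
proof -
  have a: "fps_u\<^sup>2 = fps_const (Wq :: 'a fls fps)" by (simp add: fps_u_def)
  thus "fps_u powi 2 = fps_const (Wq :: 'a fls fps)" by simp
  have "fps_u\<^sup>2 * (inverse fps_u)\<^sup>2 = (1 :: 'a fls fps fps)"
    unfolding power_mult_distrib [symmetric] fps_u_mult_inverse by simp
  hence "fps_const (Vq * Wq) * (inverse fps_u)\<^sup>2 = fps_const (Vq :: 'a fls fps)"
    unfolding fps_const_mult [symmetric] mult.assoc a by simp
  hence "(inverse fps_u)\<^sup>2 = fps_const (Vq :: 'a fls fps)" unfolding VW by simp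
  thus "fps_u powi (- 2) = fps_const (Vq :: 'a fls fps)" by (simp add: power_int_def)
qed

lemma fps_q_power: "fps_q ^ (2 * h) = fps_const (xq ^ h)"
  by (simp add: fps_q_def power_mult)

lemma Vq_wfac:
  assumes "m > 0"
  shows "Vq ^ m * wfac xq Wq Dq S m =
    - Vq * ((\<Prod>l=0..m. (1 - Wq * xq ^ hk S m l) * Dq (hk S m l)) * (\<Prod>l=1..<m. (1 - Vq * xq ^ hk S m l) * Dq (hk S m l)))"
proof -
  have V: "Vq * ((Wq - z) * y) = (1 - Vq * z) * y" for y z :: "'a fls fps"
    unfolding mult.assoc [symmetric] right_diff_distrib VW ..
  have "(\<Prod>l=1..<m. (1 - Vq * xq ^ hk S m l) * Dq (hk S m l)) =
      (\<Prod>l=1..<m. Vq * ((Wq - xq ^ hk S m l) * Dq (hk S m l)) :: 'a fls fps)"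
    unfolding V ..
  also have "\<dots> = Vq ^ (m - 1) * (\<Prod>l=1..<m. (Wq - xq ^ hk S m l) * Dq (hk S m l))"
    unfolding prod.distrib[of "\<lambda>_. Vq"] by simp
  finally have *: "(\<Prod>l=1..<m. (1 - Vq * xq ^ hk S m l) * Dq (hk S m l)) =
    (Vq ^ (m - 1) * (\<Prod>l=1..<m. (Wq - xq ^ hk S m l) * Dq (hk S m l)) :: 'a fls fps)" .
  have "Vq ^ m = Vq * (Vq ^ (m - 1) :: 'a fls fps)" using assms by (cases m) simp_all
  thus ?thesis unfolding * wfac_def by (simp only: mult_minus_left mult_minus_right mult_ac)
qed

lemma partition_term_eq:
  assumes l: "l \<in> DD'"
  shows "(- (fps_u powi (- 2) :: 'a :: field_char_0 fls fps fps)) ^ durfee l * fps_T ^ (sum_list l div 2) *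
      (\<Prod>s\<in>diagram l. (1 - fps_u powi (- 2 * eps' s) * fps_q ^ (2 * hook l s)) / (1 - fps_q ^ (2 * hook l s))) =
    fps_const (Vq ^ \<Sum>(legs l) * wt xq Wq Dq (legs l)) * fps_X ^ \<Sum>(legs l)"
proof -
  define S where "S = legs l"
  note data = DD'_legs_data[OF l, folded S_def]
  define G :: "int \<Rightarrow> nat \<Rightarrow> 'a fls fps" where "G e h = (1 - (if e = 1 then Vq else Wq) * xq ^ h) * Dq h" for e h
  have box: "(1 - fps_u powi (- 2 * eps' s) * fps_q ^ (2 * hook l s)) / (1 - fps_q ^ (2 * hook l s)) = fps_const (G (eps' s) (hook l s))"
    for s :: "nat \<times> nat"
  proof -
    have h: "hook l s > 0" by (simp add: hook_def split: prod.split)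
    have e: "eps' s = 1 \<or> eps' s = - 1" by (simp add: eps'_def split: prod.split)
    have u: "fps_u powi (- 2 * eps' s) = fps_const (if eps' s = 1 then Vq else Wq :: 'a fls fps)"
      using e fps_u_powi[where 'a = 'a] by auto
    show ?thesis
    proof (rule quotient_eqI)
      show "fps_nth (fps_nth (1 - fps_q ^ (2 * hook l s) :: 'a fls fps fps) 0) 0 = 1"
        using h by (simp add: fps_q_power fps_X_power_nth flip: power_mult)
      have "(1 - xq ^ hook l s) * G (eps' s) (hook l s) = (1 - (if eps' s = 1 then Vq else Wq) * xq ^ hook l s :: 'a fls fps)"
        unfolding G_def using Dq[OF h, where 'a = 'a] by (simp only: mult.left_commute[of _ "_ - _"] mult_1_right)
      thus "(1 - fps_q ^ (2 * hook l s)) * fps_const (G (eps' s) (hook l s)) = 1 - fps_u powi (- 2 * eps' s) * fps_q ^ (2 * hook l s)"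
        unfolding u fps_q_power fps_const_mult fps_const_1_eq_1 [symmetric] fps_const_sub by (simp only:)
    qed
  qed
  have cprod: "(\<Prod>s\<in>A. fps_const (f s)) = fps_const (\<Prod>s\<in>A. f s)" for A and f :: "nat \<times> nat \<Rightarrow> 'a fls fps"
    by (induction A rule: infinite_finite_induct) auto
  have S: "finite S" "0 \<notin> S" using data(3) by (auto simp: pos_sets_def)
  have "Vq ^ \<Sum>S * wt xq Wq Dq S = (\<Prod>m\<in>S. Vq ^ m * wfac xq Wq Dq S m :: 'a fls fps)"
    unfolding wt_def prod.distrib power_sum ..
  also have "\<dots> = (\<Prod>m\<in>S. - Vq * ((\<Prod>k=0..m. G (- 1) (hk S m k)) * (\<Prod>k=1..<m. G 1 (hk S m k))))"
  proof (rule prod.cong[OF refl])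
    fix m assume "m \<in> S"
    hence "m > 0" using S(2) by (cases m) auto
    from Vq_wfac[OF this, of S]
    show "Vq ^ m * wfac xq Wq Dq S m = - Vq * ((\<Prod>k=0..m. G (- 1) (hk S m k)) * (\<Prod>k=1..<m. G 1 (hk S m k)))"
      by (simp add: G_def)
  qed
  also have "\<dots> = (- Vq) ^ durfee l * (\<Prod>s\<in>diagram l. G (eps' s) (hook l s))"
    unfolding prod.distrib[of "\<lambda>_. - Vq"] data(4) data(1) by simp
  finally have *: "Vq ^ \<Sum>S * wt xq Wq Dq S = (- Vq) ^ durfee l * (\<Prod>s\<in>diagram l. G (eps' s) (hook l s))" .
  have cpow: "(- fps_const v) ^ n = fps_const ((- v) ^ n)" for v :: "'a fls fps" and n
    by simp
  have len: "sum_list l div 2 = \<Sum>S" unfolding data(2) by simp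
  show ?thesis unfolding S_def [symmetric] * box cprod fps_u_powi cpow len fps_T_def fps_const_mult [symmetric]
    by (simp only: mult_ac)
qed

lemma has_sum_weights:
  "((\<lambda>l. (- (fps_u powi (- 2))) ^ durfee l * fps_T ^ (sum_list l div 2) *
      (\<Prod>s\<in>diagram l. (1 - fps_u powi (- 2 * eps' s) * fps_q ^ (2 * hook l s)) / (1 - fps_q ^ (2 * hook l s)))) has_sum
      (weight_series :: 'a :: field_char_0 fls fps fps)) DD'"
proof (rule has_sum_reindex_bij[OF legs_bij])
  show "((\<lambda>S. fps_const (Vq ^ \<Sum>S * wt xq Wq Dq S) * fps_X ^ \<Sum>S) has_sum (weight_series :: 'a fls fps fps)) pos_sets"
    unfolding weight_series_def by (rule has_sum_gser[OF finite_fibres_pos_sets])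
qed (rule partition_term_eq)

section \<open>Convergence of the product over \<open>m\<close> and \<open>r\<close>\<close>

lemma logd_quotient:
  fixes f :: "'k :: idom fps"
  assumes "logd d a" "logd n b" "d * f = n" "d \<noteq> 0"
  shows "logd f (b - a)"
proof -
  have "d * (fps_X * fps_deriv f) = fps_X * fps_deriv (d * f) - (fps_X * fps_deriv d) * f"
    by (simp add: algebra_simps)
  also have "\<dots> = d * ((b - a) * f)"
  proof -
    have "fps_X * fps_deriv d = a * d" using assms(1) by (simp add: logd_def)
    moreover have "fps_X * fps_deriv (d * f) = b * (d * f)" using assms(2) unfolding assms(3) logd_def .
    ultimately show ?thesis by (simp only: algebra_simps)
  qed
  finally show ?thesis using assms(4) by (simp add: logd_def)
qed

lemma logd_power: "logd f g \<Longrightarrow> logd (f ^ k) (of_nat k * g)"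
  using logd_prod[of "{..<k}" "\<lambda>_. f" "\<lambda>_. g"] by simp

lemma ceiling_half: "nat \<lceil>real r / 2\<rceil> = (r + 1) div 2"
proof (cases "even r")
  case True
  then obtain k where "r = 2 * k" by blast
  thus ?thesis by simp
next
  case False
  then obtain k where k: "r = 2 * k + 1" by (elim oddE)
  have "\<lceil>real r / 2\<rceil> = int k + 1" unfolding k by (rule ceiling_unique) auto
  thus ?thesis unfolding k by simp
qed

definition factor_logd :: "nat \<Rightarrow> nat \<Rightarrow> 'a :: field_char_0 fls fps fps" where
  "factor_logd m r = of_nat ((r + 1) div 2) *
    (Lfac (xq ^ (r + 2) * Wq) m + Lfac (xq ^ (r - 1) * Vq) m - (Lfac (xq ^ r) m + Lfac (xq ^ (r + 1)) m))"

definition prod_factor :: "nat \<Rightarrow> nat \<Rightarrow> 'a :: field_char_0 fls fps fps" where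
  "prod_factor m r =
    ((1 - fps_q ^ (2 * (r + 2)) * fps_u ^ 2 * fps_T ^ m) ^ nat \<lceil>real r / 2\<rceil> *
     (1 - fps_q ^ (2 * (r - 1)) * fps_u powi (- 2) * fps_T ^ m) ^ nat \<lceil>real r / 2\<rceil>)
  / ((1 - fps_q ^ (2 * r) * fps_T ^ m) ^ nat \<lceil>real r / 2\<rceil> *
     (1 - fps_q ^ (2 * (r + 1)) * fps_T ^ m) ^ nat \<lceil>real r / 2\<rceil>)"

lemma prod_factor:
  assumes m: "m > 0"
  shows "logd (prod_factor m r) (factor_logd m r :: 'a :: field_char_0 fls fps fps)" "fps_nth (prod_factor m r :: 'a fls fps fps) 0 = 1"
proof -
  let ?e = "(r + 1) div 2"
  let ?f = "\<lambda>c. 1 - fps_const c * fps_X ^ m :: 'a fls fps fps"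
  define n where "n = ?f (xq ^ (r + 2) * Wq) ^ ?e * ?f (xq ^ (r - 1) * Vq) ^ ?e"
  define d where "d = ?f (xq ^ r) ^ ?e * ?f (xq ^ (r + 1)) ^ ?e"
  have u: "fps_u\<^sup>2 = fps_const (Wq :: 'a fls fps)" using fps_u_powi(2) by simp
  have prod_factor: "prod_factor m r = n / d"
    unfolding prod_factor_def n_def d_def ceiling_half fps_q_power fps_u_powi u fps_T_def fps_const_mult ..
  have 0: "fps_nth (?f c ^ k) 0 = 1" for c k using m by (simp add: fps_power_zeroth power_0_left)
  have d0: "fps_nth d 0 = 1" and n0: "fps_nth n 0 = 1" by (simp_all add: d_def n_def 0)
  have eq: "d * prod_factor m r = n" unfolding prod_factor by (rule fps_mult_divide_cancel) (simp add: d0)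
  have "fps_nth (d * prod_factor m r) 0 = 1" unfolding eq by (rule n0)
  thus "fps_nth (prod_factor m r :: 'a fls fps fps) 0 = 1" by (simp add: d0)
  have "logd (prod_factor m r) (of_nat ?e * Lfac (xq ^ (r + 2) * Wq) m + of_nat ?e * Lfac (xq ^ (r - 1) * Vq) m
      - (of_nat ?e * Lfac (xq ^ r) m + of_nat ?e * Lfac (xq ^ (r + 1)) m) :: 'a fls fps fps)"
  proof (rule logd_quotient)
    show "d \<noteq> 0" using d0 by auto
    show "logd d (of_nat ?e * Lfac (xq ^ r) m + of_nat ?e * Lfac (xq ^ (r + 1)) m)"
      unfolding d_def by (intro logd_mult logd_power logd_factor m)
    show "logd n (of_nat ?e * Lfac (xq ^ (r + 2) * Wq) m + of_nat ?e * Lfac (xq ^ (r - 1) * Vq) m)"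
      unfolding n_def by (intro logd_mult logd_power logd_factor m)
  qed (rule eq)
  thus "logd (prod_factor m r) (factor_logd m r :: 'a fls fps fps)"
    unfolding factor_logd_def by (simp only: distrib_left right_diff_distrib)
qed

lemma agree_add: "agree K f g \<Longrightarrow> agree K f' g' \<Longrightarrow> agree K (f + f') (g + g')"
  by (auto simp: agree_def)

lemma agree_sum: "(\<And>i. i \<in> A \<Longrightarrow> agree K (f i) (g i)) \<Longrightarrow> agree K (sum f A) (sum g A)"
  by (auto simp: agree_def fps_sum_nth intro!: sum.cong)

lemma agree_high: "K < k \<Longrightarrow> agree K (fps_X ^ k * f) 0"
  by (auto simp: agree_def fps_X_power_mult_nth)

text \<open>The expansion of \<open>1 / ((1 - y) * (1 - y^2))\<close>, truncated with its exact
  remainder; its coefficients \<open>1, 1, 2, 2, ...\<close> are the multiplicities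
  \<open>\<lceil>r / 2\<rceil>\<close>.\<close>

lemma half_power_sum:
  fixes y :: "'r :: comm_ring_1"
  shows "((1 - y) * (1 - y ^ 2)) * (\<Sum>r=1..2 * K. of_nat ((r + 1) div 2) * y ^ (r - 1)) =
    1 - y ^ (2 * K) * (of_nat (K + 1) - of_nat K * y ^ 2)"
proof (induction K)
  case (Suc K)
  let ?s = "\<lambda>K. \<Sum>r=1..2 * K. of_nat ((r + 1) div 2) * y ^ (r - 1)"
  have "?s (Suc K) = ?s K + of_nat (K + 1) * (y ^ (2 * K) * (1 + y))"
    by (simp add: algebra_simps)
  hence "((1 - y) * (1 - y ^ 2)) * ?s (Suc K) =
      ((1 - y) * (1 - y ^ 2)) * ?s K + ((1 - y) * (1 - y ^ 2)) * (of_nat (K + 1) * (y ^ (2 * K) * (1 + y)))"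
    by (simp only: distrib_left[of "(1 - y) * (1 - y ^ 2)"])
  also have "\<dots> = 1 - y ^ (2 * K) * (of_nat K + 1 - of_nat K * y ^ 2) + ((1 - y) * (1 - y ^ 2)) * ((of_nat K + 1) * (y ^ (2 * K) * (1 + y)))"
    unfolding Suc by (simp only: of_nat_add of_nat_1)
  also have "\<dots> = 1 - (y ^ (2 * K) * y ^ 2) * (of_nat K + 1 + 1 - (of_nat K + 1) * y ^ 2)"
  proof -
    have "1 - p * (a + 1 - a * y ^ 2) + ((1 - y) * (1 - y ^ 2)) * ((a + 1) * (p * (1 + y))) =
        1 - (p * y ^ 2) * (a + 1 + 1 - (a + 1) * y ^ 2)" for p a :: 'r
      by (simp add: algebra_simps power2_eq_square)
    thus ?thesis .
  qed
  also have "\<dots> = 1 - y ^ (2 * Suc K) * (of_nat (Suc K + 1) - of_nat (Suc K) * y ^ 2)"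
    by (simp add: power_add [symmetric] add.commute)
  finally show ?case .
qed simp

text \<open>With \<open>y = xq ^ d\<close>, each summand is the multiplicity times
  \<open>y ^ (r - 1)\<close> times an expression independent of \<open>r\<close>. The remainder in
  \<open>half_power_sum\<close> starts at order \<open>4 * d * K\<close> in \<open>q\<close>, beyond
  \<open>j\<close>.\<close>

lemma factor_logd_row:
  assumes d: "d > 0" and K: "j < K"
  shows "agree j (\<Sum>r=1..2 * K. of_nat ((r + 1) div 2) *
      ((xq ^ (r + 2) * Wq) ^ d + (xq ^ (r - 1) * Vq) ^ d - ((xq ^ r) ^ d + (xq ^ (r + 1)) ^ d)))
    ((Vq ^ d - xq ^ d - xq ^ (2 * d) + Wq ^ d * xq ^ (3 * d)) * (Dq d * Dq (2 * d)) :: 'a :: field_char_0 fls fps)"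
proof -
  define y :: "'a fls fps" where "y = xq ^ d"
  let ?T = "\<Sum>r=1..2 * K. of_nat ((r + 1) div 2) * y ^ (r - 1)"
  let ?c = "Vq ^ d - xq ^ d - xq ^ (2 * d) + Wq ^ d * xq ^ (3 * d) :: 'a fls fps"
  have c: "?c = Vq ^ d - y - y ^ 2 + Wq ^ d * y ^ 3"
  proof -
    have "xq ^ (k * d) = y ^ k" for k unfolding y_def by (subst mult.commute) (rule power_mult)
    thus ?thesis by (simp only: y_def)
  qed
  have "(\<Sum>r=1..2 * K. of_nat ((r + 1) div 2) *
      ((xq ^ (r + 2) * Wq) ^ d + (xq ^ (r - 1) * Vq) ^ d - ((xq ^ r) ^ d + (xq ^ (r + 1)) ^ d))) = ?c * ?T"
    unfolding sum_distrib_left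
  proof (rule sum.cong[OF refl])
    fix r assume "r \<in> {1..2 * K}"
    then obtain r' where r: "r = Suc r'" by (cases r) auto
    have p: "(xq ^ k) ^ d = y ^ k" for k unfolding y_def by (metis power_mult mult.commute)
    show "of_nat ((r + 1) div 2) * ((xq ^ (r + 2) * Wq) ^ d + (xq ^ (r - 1) * Vq) ^ d - ((xq ^ r) ^ d + (xq ^ (r + 1)) ^ d)) =
        ?c * (of_nat ((r + 1) div 2) * y ^ (r - 1))"
      unfolding c power_mult_distrib p r by (simp add: algebra_simps power2_eq_square power3_eq_cube del: fps_const_power)
  qed
  moreover have "agree j ?T (Dq d * Dq (2 * d))"
  proof -
    have "(1 - y) * Dq d = 1" "(1 - y ^ 2) * Dq (2 * d) = 1"
      using Dq[of d, where 'a = 'a] Dq[of "2 * d", where 'a = 'a] d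
      by (simp_all only: y_def power_mult [symmetric] mult.commute[of d 2]) auto
    hence "(Dq d * Dq (2 * d)) * ((1 - y) * (1 - y ^ 2)) = 1" by (simp only: mult_ac) (simp add: mult_ac)
    hence "?T = ((Dq d * Dq (2 * d)) * ((1 - y) * (1 - y ^ 2))) * ?T" by simp
    also have "\<dots> = (Dq d * Dq (2 * d)) * (1 - y ^ (2 * K) * (of_nat (K + 1) - of_nat K * y ^ 2))"
      unfolding mult.assoc[of "Dq d * Dq (2 * d)"] half_power_sum ..
    also have "\<dots> = Dq d * Dq (2 * d) + y ^ (2 * K) * (Dq d * Dq (2 * d) * (of_nat K * y ^ 2 - of_nat (K + 1)))"
      by (simp only: algebra_simps mult_1_right mult_1)
    also have "y ^ (2 * K) = fps_X ^ (2 * (d * (2 * K)))" unfolding y_def power_mult [symmetric] mult.assoc ..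
    finally have T: "?T = Dq d * Dq (2 * d) + fps_X ^ (2 * (d * (2 * K))) * (Dq d * Dq (2 * d) * (of_nat K * y ^ 2 - of_nat (K + 1)))" .
    have "1 * (2 * K) \<le> d * (2 * K)" by (rule mult_right_mono) (use d in auto)
    hence "j < 2 * (d * (2 * K))" using K by linarith
    from agree_add[OF agree_refl agree_high[OF this], of "Dq d * Dq (2 * d)"] show ?thesis unfolding T by simp
  qed
  ultimately show ?thesis by (simp only: agree_mult[OF agree_refl])
qed

lemma factor_logd_nth:
  "fps_nth (factor_logd m r :: 'a :: field_char_0 fls fps fps) N = (if N > 0 \<and> m dvd N then - (of_nat m * (of_nat ((r + 1) div 2) *
    ((xq ^ (r + 2) * Wq) ^ (N div m) + (xq ^ (r - 1) * Vq) ^ (N div m) - ((xq ^ r) ^ (N div m) + (xq ^ (r + 1)) ^ (N div m))))) else 0)"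
proof -
  have "fps_nth (of_nat k * f) N = of_nat k * fps_nth f N" for k and f :: "'a fls fps fps"
    unfolding fps_of_nat [symmetric] by simp
  thus ?thesis unfolding factor_logd_def by (simp only: fps_add_nth fps_sub_nth Lfac_def fps_nth_Abs_fps) (simp add: algebra_simps del: fps_const_power)
qed

text \<open>Unconditional convergence demands arbitrary finite \<open>F\<close> around the
  rectangle. A pair outside it is harmless: either \<open>m\<close> does not divide
  \<open>N\<close>, or \<open>r\<close> is so large that its contribution starts beyond
  \<open>q ^ j\<close>.\<close>

lemma factor_logd_sum:
  assumes F: "finite F" "F \<subseteq> {1..} \<times> {1..}" "{1..N} \<times> {1..2 * Suc j} \<subseteq> F" and N: "N > 0"
  shows "agree j (\<Sum>(m, r)\<in>F. fps_nth (factor_logd m r) N) (total_logd N :: 'a :: field_char_0 fls fps)"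
proof -
  let ?B = "{1..N} \<times> {1..2 * Suc j}"
  let ?g = "\<lambda>m r. fps_nth (factor_logd m r) N :: 'a fls fps"
  let ?h = "\<lambda>d r. of_nat ((r + 1) div 2) *
      ((xq ^ (r + 2) * Wq) ^ d + (xq ^ (r - 1) * Vq) ^ d - ((xq ^ r) ^ d + (xq ^ (r + 1)) ^ d)) :: 'a fls fps"
  have "agree j (\<Sum>(m, r)\<in>F - ?B. ?g m r) (\<Sum>(m, r)\<in>F - ?B. 0)"
  proof (rule agree_sum)
    fix p assume p: "p \<in> F - ?B"
    obtain m r where mr: "p = (m, r)" by (cases p)
    have "agree j (?g m r) 0"
    proof (cases "m dvd N")
      case False
      thus ?thesis by (simp add: factor_logd_nth)
    next
      case True
      hence "m \<le> N" using N by (auto dest: dvd_imp_le)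
      hence r: "r > 2 * Suc j" and m: "m \<ge> 1" using p mr F(2) by auto
      define d where "d = N div m"
      have d: "d > 0" using \<open>m \<le> N\<close> m by (simp add: d_def div_greater_zero_iff)
      have c: "(xq ^ (r - 1 + k)) ^ d = xq ^ ((r - 1) * d) * (xq ^ (k * d) :: 'a fls fps)" for k
        by (simp only: power_add power_mult_distrib power_mult)
      have r': "r + 2 = r - 1 + 3" "r - 1 = r - 1 + 0" "r = r - 1 + 1" "r + 1 = r - 1 + 2" using r by auto
      have "?h d r = xq ^ ((r - 1) * d) * (of_nat ((r + 1) div 2) *
          (xq ^ (3 * d) * Wq ^ d + xq ^ (0 * d) * Vq ^ d - (xq ^ (1 * d) + xq ^ (2 * d))))"
        using c[of 3] c[of 0] c[of 1] c[of 2] r' unfolding power_mult_distrib by (simp only:) (simp only: algebra_simps)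
      moreover have "j < 2 * ((r - 1) * d)"
      proof -
        have "j < r - 1" using r by simp
        also have "\<dots> \<le> (r - 1) * d" using d by simp
        also have "\<dots> \<le> 2 * ((r - 1) * d)" by simp
        finally show ?thesis .
      qed
      ultimately have "agree j (?h d r) 0" unfolding power_mult [symmetric, of fps_X 2] by (simp only: agree_high)
      from agree_mult[OF agree_refl this, of "- of_nat m"] True N show ?thesis
        by (simp only: factor_logd_nth d_def) simp
    qed
    thus "agree j (case p of (m, r) \<Rightarrow> ?g m r) (case p of (m, r) \<Rightarrow> 0)" by (simp add: mr)
  qed
  moreover have "(\<Sum>(m, r)\<in>F. ?g m r) = (\<Sum>(m, r)\<in>F - ?B. ?g m r) + (\<Sum>(m, r)\<in>?B. ?g m r)"
    using F by (intro sum.subset_diff) auto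
  moreover have "agree j (\<Sum>(m, r)\<in>?B. ?g m r) (total_logd N)"
  proof -
    have "(\<Sum>(m, r)\<in>?B. ?g m r) = (\<Sum>m=1..N. \<Sum>r=1..2 * Suc j. ?g m r)"
      by (rule sum.cartesian_product [symmetric])
    also have "\<dots> = (\<Sum>m | m dvd N. \<Sum>r=1..2 * Suc j. ?g m r)"
      by (rule sum.mono_neutral_right) (use N in \<open>auto simp: factor_logd_nth dvd_imp_le intro!: sum.neutral\<close>)
    also have "\<dots> = (\<Sum>m | m dvd N. of_nat m * - (\<Sum>r=1..2 * Suc j. ?h (N div m) r))"
      using N by (intro sum.cong refl) (simp only: mem_Collect_eq factor_logd_nth sum_distrib_left sum_negf mult_minus_right if_True simp_thms)
    also have "\<dots> = (\<Sum>d | d dvd N. of_nat (N div d) * - (\<Sum>r=1..2 * Suc j. ?h d r))"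
      by (rule sum.reindex_bij_witness[of _ "\<lambda>d. N div d" "\<lambda>d. N div d"]) (use N in auto)
    finally have B: "(\<Sum>(m, r)\<in>?B. ?g m r) = - (\<Sum>d | d dvd N. of_nat (N div d) * (\<Sum>r=1..2 * Suc j. ?h d r))"
      by (simp only: mult_minus_right sum_negf)
    have "agree j (\<Sum>d | d dvd N. of_nat (N div d) * (\<Sum>r=1..2 * Suc j. ?h d r)) (- total_logd N)"
      unfolding total_logd_def minus_minus
    proof (intro agree_sum agree_mult[OF agree_refl] factor_logd_row)
      fix d assume "d \<in> {d. d dvd N}"
      thus "d > 0" using N by (cases d) auto
    qed simp
    from agree_mult[OF agree_refl this, of "- 1"] show ?thesis unfolding B by simp
  qed
  ultimately show ?thesis using agree_add[of j _ 0] by simp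
qed

text \<open>Up to order \<open>j\<close> in \<open>q\<close>, the partial product obeys the
  recursion in the powers of \<open>T\<close> that determines \<open>weight_series\<close>;
  multiplying by \<open>ivq M\<close> solves it and preserves the agreement.\<close>

lemma partial_product:
  assumes F: "finite F" "F \<subseteq> {1..} \<times> {1..}" "{1..N} \<times> {1..2 * Suc j} \<subseteq> F"
  shows "agree j (fps_nth (\<Prod>(m, r)\<in>F. prod_factor m r) N) (fps_nth weight_series N :: 'a :: field_char_0 fls fps)"
proof -
  let ?P = "\<Prod>(m, r)\<in>F. prod_factor m r :: 'a fls fps fps" and ?L = "\<Sum>(m, r)\<in>F. factor_logd m r :: 'a fls fps fps"
  have P0: "fps_nth ?P 0 = 1"
    using F(1,2) by (induction F rule: finite_induct) (auto simp: prod_factor(2))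
  have "logd ?P ?L"
    by (rule logd_prod) (use F(2) in \<open>auto intro!: prod_factor(1)\<close>)
  hence rec: "of_nat N * fps_nth ?P N = (\<Sum>i=0..N. fps_nth ?L i * fps_nth ?P (N - i))" for N
    by (simp add: logd_iff)
  have L: "fps_nth ?L i = (\<Sum>(m, r)\<in>F. fps_nth (factor_logd m r) i)" for i
    by (simp add: fps_sum_nth case_prod_unfold)
  have L0: "fps_nth ?L 0 = 0" unfolding L factor_logd_nth by simp
  have "agree j (fps_nth ?P M) (fps_nth weight_series M)" if "M \<le> N" for M
    using that
  proof (induction M rule: less_induct)
    case (less M)
    show ?case
    proof (cases "M = 0")
      case True
      thus ?thesis by (simp add: P0 weight_series_nth del: fps_const_power)
    next
      case False
      have "of_nat M * fps_nth ?P M = (\<Sum>i=1..M. fps_nth ?L i * fps_nth ?P (M - i))"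
        unfolding rec sum.atLeast_Suc_atMost[OF le0] L0 by simp
      moreover have "of_nat M * fps_nth weight_series M = (\<Sum>i=1..M. total_logd i * fps_nth weight_series (M - i) :: 'a fls fps)"
        unfolding weight_series_nth by (rule logsol_rec) (rule ivq)
      moreover have "agree j (\<Sum>i=1..M. fps_nth ?L i * fps_nth ?P (M - i)) (\<Sum>i=1..M. total_logd i * fps_nth weight_series (M - i))"
      proof (intro agree_sum agree_mult)
        fix i assume i: "i \<in> {1..M}"
        show "agree j (fps_nth ?L i) (total_logd i)"
          unfolding L by (rule factor_logd_sum) (use F i less.prems in auto)
        show "agree j (fps_nth ?P (M - i)) (fps_nth weight_series (M - i))"
          by (rule less.IH) (use i less.prems in auto)
      qed
      ultimately have "agree j (ivq M * (of_nat M * fps_nth ?P M)) (ivq M * (of_nat M * fps_nth weight_series M))"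
        by (simp only: agree_mult[OF agree_refl])
      thus ?thesis unfolding mult.assoc [symmetric] using ivq[of M, where 'a = 'a] False by simp
    qed
  qed
  thus ?thesis by blast
qed

lemma has_formal_prod_factors: "((\<lambda>(m, r). prod_factor m r) has_formal_prod (weight_series :: 'a :: field_char_0 fls fps fps)) ({1..} \<times> {1..})"
  unfolding has_formal_prod_def
proof (intro allI tendsto_fpsI)
  fix N j
  show "eventually (\<lambda>F. fps_nth (fps_nth (\<Prod>(m, r)\<in>F. prod_factor m r) N) j = fps_nth (fps_nth (weight_series :: 'a fls fps fps) N) j)
    (finite_subsets_at_top ({1..} \<times> {1..}))"
    unfolding eventually_finite_subsets_at_top
  proof (intro exI[of _ "{1..N} \<times> {1..2 * Suc j}"] conjI allI impI)
    show "{1..N} \<times> {1..2 * Suc j} \<subseteq> {1..} \<times> {1..}" by auto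
    fix F :: "(nat \<times> nat) set"
    assume "finite F \<and> {1..N} \<times> {1..2 * Suc j} \<subseteq> F \<and> F \<subseteq> {1..} \<times> {1..}"
    hence "agree j (fps_nth (\<Prod>(m, r)\<in>F. prod_factor m r) N) (fps_nth (weight_series :: 'a fls fps fps) N)"
      by (intro partial_product) auto
    thus "fps_nth (fps_nth (\<Prod>(m, r)\<in>F. prod_factor m r) N) j = fps_nth (fps_nth (weight_series :: 'a fls fps fps) N) j"
      unfolding agree_def by blast
  qed simp
qed

text \<open>The denominator exponents \<open>2 * r\<close> and \<open>2 * (r + 1)\<close> are lower
  by 2 than in the formula displayed at the top. They are the right ones: at
  \<open>u^2 = q^-2\<close> every nonempty partition has weight 0, and the numerator factors become
  \<open>1 - q^(2 (r + 1)) T^m\<close> and \<open>1 - q^(2 r) T^m\<close>, which cancel precisely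
  these denominators.\<close>

theorem theorem6p13:
  fixes T q u :: "'a::field_char_0 fls fps fps"
  defines "T \<equiv> fps_T" and "q \<equiv> fps_q" and "u \<equiv> fps_u"
  shows "\<exists>S.
    ((\<lambda>l. (- (u powi (- 2))) ^ durfee l * T ^ (sum_list l div 2) *
        (\<Prod>s\<in>diagram l. (1 - u powi (- 2 * eps' s) * q ^ (2 * hook l s))
                          / (1 - q ^ (2 * hook l s)))) has_sum S) DD' \<and>
    ((\<lambda>(m, r).
        ((1 - q ^ (2 * (r + 2)) * u ^ 2 * T ^ m) ^ nat \<lceil>real r / 2\<rceil> *
         (1 - q ^ (2 * (r - 1)) * u powi (- 2) * T ^ m) ^ nat \<lceil>real r / 2\<rceil>)
      / ((1 - q ^ (2 * r) * T ^ m) ^ nat \<lceil>real r / 2\<rceil> *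
         (1 - q ^ (2 * (r + 1)) * T ^ m) ^ nat \<lceil>real r / 2\<rceil>))
      has_formal_prod S) ({1..} \<times> {1..})"
  unfolding T_def q_def u_def
  by (intro exI conjI, rule has_sum_weights, rule has_formal_prod_factors[unfolded prod_factor_def])

end
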